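(* There are universal constants $0<c\le C<\infty$ such that, for every $p\in[2,\infty)$, $$c\,\frac p{\log p}\le\mathfrak X_p\le C\,\frac p{\log p},\qquad c\,\frac p{\log p}\le\mathfrak M_p\le C\,\frac p{\log p}.$$
   Context: Notation: $[n]=\{1,\dots,n\}$, $\Omega_n=\{-1,1\}^n$ with the uniform probability measure, $\mathbb E$ the average over $\Omega_n$, $\|h\|_p=(\mathbb E|h|^p)^{1/p}$. For $S\subseteq[n]$, $P_Sh(\varepsilon)$ is the average of $h(\eta)$ over all $\eta\in\Omega_n$ with $\eta_j=\varepsilon_j$ for all $j\in S$. If $\varepsilon^{(j)}$ is $\varepsilon$ with the sign of its $j$th coordinate changed, $\partial_jh(\varepsilon)=h(\varepsilon)-h(\varepsilon^{(j)})$. Logarithms are natural. Definition of $\mathfrak X_p$ ($p\ge2$ fixed): the least $K\in[0,\infty]$ such that, for every $n\in\mathbb N$, $k\in[n]$, $\mathbb K\in\{\mathbb R,\mathbb C\}$, and $h:\Omega_n\to\mathbb K$ with $\mathbb E h=0$, $$\left(\binom nk^{-1}\sum_{\substack{S\subseteq[n]\\|S|=k}}\|P_Sh\|_p^p\right)^{1/p}\le K\left[\frac kn\sum_{j=1}^n\|\partial_jh\|_p^p+\left(\frac kn\right)^{p/2}\|h\|_p^p\right]^{1/p}.$$ Definition of $\mathfrak M_p$ ($p\ge2$ fixed): let $\mathbb Z_{8m}=\mathbb Z/(8m\mathbb Z)$, let $e_1,\dots,e_n$ be the coordinate vectors of $\mathbb Z_{8m}^n$, and write $\varepsilon_S=\sum_{j\in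 S}\varepsilon_je_j$ for $\varepsilon\in\{-1,1\}^n$, $S\subseteq[n]$ (and $x+\varepsilon=x+\varepsilon_{[n]}$). $\mathfrak M_p$ is the least $K\in[0,\infty]$ such that, for every $n\in\mathbb N$, $k\in[n]$, $m\in\mathbb N$ with $m\ge\sqrt{n/k}$, every measure space $(M,\nu)$, either choice of scalar field ($\mathbb R$ or $\mathbb C$), and every mapping $f:\mathbb Z_{8m}^n\to L_p(M,\nu)$, $$\left(\binom nk^{-1}\sum_{\substack{S\subseteq[n]\\|S|=k}}\mathbb E_{x,\varepsilon}\|f(x+4m\varepsilon_S)-f(x)\|_{L_p(M)}^p\right)^{1/p}\le Km\left[\frac kn\sum_{j=1}^n\mathbb E_x\|f(x+e_j)-f(x)\|_{L_p(M)}^p+\left(\frac kn\right)^{p/2}\mathbb E_{x,\varepsilon}\|f(x+\varepsilon)-f(x)\|_{L_p(M)}^p\right]^{1/p},$$ where $x$ is uniform in $\mathbb Z_{8m}^n$ and $\varepsilon$ is uniform in $\{-1,1\}^n$, independently. *)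

theory Defs
  imports "HOL-Analysis.Analysis" "HOL-Algebra.Elementary_Groups" "HOL-Algebra.Product_Groups"
begin

section \<open>The discrete cube and the linear constant\<close>

definition avg :: "'i set \<Rightarrow> ('i \<Rightarrow> 'b::real_vector) \<Rightarrow> 'b" where
  "avg A f = (\<Sum>x\<in>A. f x) /\<^sub>R real (card A)"

text \<open>The cube consists of functions on \<open>{1..n}\<close> that are \<open>undefined\<close> elsewhere.
  A function on the cube is a function on the whole type \<open>nat \<Rightarrow> int\<close>; its values off the cube
  are never used.\<close>

definition cube :: "nat \<Rightarrow> (nat \<Rightarrow> int) set" where
  "cube n = {1..n} \<rightarrow>\<^sub>E {-1, 1}"

definition cube_norm :: "real \<Rightarrow> nat \<Rightarrow> ((nat \<Rightarrow> int) \<Rightarrow> 'k::real_normed_field) \<Rightarrow> real" where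
  "cube_norm p n h = (avg (cube n) (\<lambda>\<epsilon>. norm (h \<epsilon>) powr p)) powr (1 / p)"

definition cube_proj ::
    "nat \<Rightarrow> nat set \<Rightarrow> ((nat \<Rightarrow> int) \<Rightarrow> 'k::real_normed_field) \<Rightarrow> (nat \<Rightarrow> int) \<Rightarrow> 'k" where
  "cube_proj n S h \<epsilon> = avg {\<eta> \<in> cube n. \<forall>j\<in>S. \<eta> j = \<epsilon> j} h"

definition cube_diff ::
    "nat \<Rightarrow> ((nat \<Rightarrow> int) \<Rightarrow> 'k::real_normed_field) \<Rightarrow> (nat \<Rightarrow> int) \<Rightarrow> 'k" where
  "cube_diff j h \<epsilon> = h \<epsilon> - h (\<epsilon>(j := - \<epsilon> j))"

definition linear_X_ineq :: "'k::real_normed_field itself \<Rightarrow> real \<Rightarrow> ennreal \<Rightarrow> bool" where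
  "linear_X_ineq _ p K \<longleftrightarrow>
     (\<forall>n. \<forall>k\<in>{1..n}. \<forall>h :: (nat \<Rightarrow> int) \<Rightarrow> 'k. avg (cube n) h = 0 \<longrightarrow>
        ennreal (((\<Sum>S | S \<subseteq> {1..n} \<and> card S = k. cube_norm p n (cube_proj n S h) powr p)
                    / real (n choose k)) powr (1 / p))
        \<le> K * ennreal ((real k / real n * (\<Sum>j=1..n. cube_norm p n (cube_diff j h) powr p)
                    + (real k / real n) powr (p / 2) * cube_norm p n h powr p) powr (1 / p)))"

text \<open>Both this infimum and the one in \<open>metric_X_const\<close> are minima; see
  \<open>linear_X_const_least\<close> and \<open>metric_X_const_least\<close> below.\<close>

definition linear_X_const :: "real \<Rightarrow> ennreal" where
  "linear_X_const p = Inf {K. linear_X_ineq TYPE(real) p K \<and> linear_X_ineq TYPE(complex) p K}"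


section \<open>The discrete torus and the metric constant\<close>

definition torus :: "nat \<Rightarrow> nat \<Rightarrow> (nat \<Rightarrow> int) monoid" where
  "torus m n = product_group {1..n} (\<lambda>_. integer_mod_group (8 * m))"

text \<open>The class in the torus of an integer vector\<close>

definition torus_vec :: "nat \<Rightarrow> nat \<Rightarrow> (nat \<Rightarrow> int) \<Rightarrow> nat \<Rightarrow> int" where
  "torus_vec m n v = (\<lambda>i\<in>{1..n}. v i mod int (8 * m))"

abbreviation torus_shift :: "nat \<Rightarrow> nat \<Rightarrow> (nat \<Rightarrow> int) \<Rightarrow> (nat \<Rightarrow> int) \<Rightarrow> nat \<Rightarrow> int" where
  "torus_shift m n x v \<equiv> x \<otimes>\<^bsub>torus m n\<^esub> torus_vec m n v"

definition unit_vec :: "nat \<Rightarrow> nat \<Rightarrow> int" where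
  "unit_vec j = (\<lambda>i. if i = j then 1 else 0)"

definition restrict_vec :: "nat set \<Rightarrow> (nat \<Rightarrow> int) \<Rightarrow> nat \<Rightarrow> int" where
  "restrict_vec S \<epsilon> = (\<lambda>i. if i \<in> S then \<epsilon> i else 0)"

text \<open>Elements of \<open>L\<^sub>p\<close> are represented by functions; nothing below distinguishes functions
  that agree almost everywhere.\<close>

definition Lp :: "real \<Rightarrow> 'a measure \<Rightarrow> ('a \<Rightarrow> 'k::real_normed_field) set" where
  "Lp p M = {g \<in> borel_measurable M. integrable M (\<lambda>\<omega>. norm (g \<omega>) powr p)}"

definition Lp_norm :: "real \<Rightarrow> 'a measure \<Rightarrow> ('a \<Rightarrow> 'k::real_normed_field) \<Rightarrow> real" where
  "Lp_norm p M g = (\<integral>\<omega>. norm (g \<omega>) powr p \<partial>M) powr (1 / p)"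

definition metric_X_ineq ::
    "'a itself \<Rightarrow> 'k::real_normed_field itself \<Rightarrow> real \<Rightarrow> ennreal \<Rightarrow> bool" where
  "metric_X_ineq _ _ p K \<longleftrightarrow>
     (\<forall>n. \<forall>k\<in>{1..n}. \<forall>m::nat. real m \<ge> sqrt (real n / real k) \<longrightarrow>
       (\<forall>(M :: 'a measure) (f :: (nat \<Rightarrow> int) \<Rightarrow> 'a \<Rightarrow> 'k).
          (\<forall>x \<in> carrier (torus m n). f x \<in> Lp p M) \<longrightarrow>
          ennreal (((\<Sum>S | S \<subseteq> {1..n} \<and> card S = k.
                avg (carrier (torus m n) \<times> cube n) (\<lambda>(x, \<epsilon>).
                  Lp_norm p M (\<lambda>\<omega>. f (torus_shift m n x (\<lambda>i. int (4 * m) * restrict_vec S \<epsilon> i)) \<omega>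
                                     - f x \<omega>) powr p))
              / real (n choose k)) powr (1 / p))
          \<le> K * ennreal (real m *
              (real k / real n * (\<Sum>j=1..n. avg (carrier (torus m n)) (\<lambda>x.
                   Lp_norm p M (\<lambda>\<omega>. f (torus_shift m n x (unit_vec j)) \<omega> - f x \<omega>) powr p))
               + (real k / real n) powr (p / 2) *
                 avg (carrier (torus m n) \<times> cube n) (\<lambda>(x, \<epsilon>).
                   Lp_norm p M (\<lambda>\<omega>. f (torus_shift m n x \<epsilon>) \<omega> - f x \<omega>) powr p))
              powr (1 / p))))"

text \<open>A definition cannot quantify over types, so the metric constant takes the type on which the
  measure spaces live as an argument. By \<open>metric_X_const_type_independent\<close> below its value
  does not depend on that argument: it is the least constant for measure spaces on all types
  simultaneously.\<close>

definition metric_X_const :: "'a itself \<Rightarrow> real \<Rightarrow> ennreal" where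
  "metric_X_const T p =
     Inf {K. metric_X_ineq T TYPE(real) p K \<and> metric_X_ineq T TYPE(complex) p K}"


section \<open>Independence of the type\<close>

definition torus_lhs :: "nat \<Rightarrow> nat \<Rightarrow> nat \<Rightarrow> ((nat \<Rightarrow> int) \<Rightarrow> (nat \<Rightarrow> int) \<Rightarrow> real) \<Rightarrow> real" where
  "torus_lhs n k m D = (\<Sum>S | S \<subseteq> {1..n} \<and> card S = k.
      avg (carrier (torus m n) \<times> cube n) (\<lambda>(x, \<epsilon>).
        D (torus_shift m n x (\<lambda>i. int (4 * m) * restrict_vec S \<epsilon> i)) x)) / real (n choose k)"

definition torus_rhs ::
    "real \<Rightarrow> nat \<Rightarrow> nat \<Rightarrow> nat \<Rightarrow> ((nat \<Rightarrow> int) \<Rightarrow> (nat \<Rightarrow> int) \<Rightarrow> real) \<Rightarrow> real" where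
  "torus_rhs p n k m D =
      real k / real n * (\<Sum>j=1..n. avg (carrier (torus m n)) (\<lambda>x.
          D (torus_shift m n x (unit_vec j)) x))
      + (real k / real n) powr (p / 2) *
        avg (carrier (torus m n) \<times> cube n) (\<lambda>(x, \<epsilon>). D (torus_shift m n x \<epsilon>) x)"

definition torus_ineq ::
    "real \<Rightarrow> ennreal \<Rightarrow> nat \<Rightarrow> nat \<Rightarrow> nat \<Rightarrow> ((nat \<Rightarrow> int) \<Rightarrow> (nat \<Rightarrow> int) \<Rightarrow> real) \<Rightarrow> bool" where
  "torus_ineq p K n k m D \<longleftrightarrow>
     ennreal (torus_lhs n k m D powr (1 / p))
       \<le> K * ennreal (real m * torus_rhs p n k m D powr (1 / p))"

lemma metric_X_ineq_iff:
  "metric_X_ineq (T :: 'a itself) (U :: 'k::real_normed_field itself) p K \<longleftrightarrow>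
     (\<forall>n. \<forall>k\<in>{1..n}. \<forall>m::nat. real m \<ge> sqrt (real n / real k) \<longrightarrow>
       (\<forall>(M :: 'a measure) (f :: (nat \<Rightarrow> int) \<Rightarrow> 'a \<Rightarrow> 'k).
          (\<forall>x \<in> carrier (torus m n). f x \<in> Lp p M) \<longrightarrow>
          torus_ineq p K n k m (\<lambda>x y. Lp_norm p M (\<lambda>\<omega>. f x \<omega> - f y \<omega>) powr p)))"
  unfolding metric_X_ineq_def torus_ineq_def torus_lhs_def torus_rhs_def ..

lemma torus_shift_closed: "m \<ge> 1 \<Longrightarrow> x \<in> carrier (torus m n) \<Longrightarrow> torus_shift m n x v \<in> carrier (torus m n)"
  by (auto simp: torus_def torus_vec_def carrier_integer_mod_group PiE_iff)

lemma finite_torus: "m \<ge> 1 \<Longrightarrow> finite (carrier (torus m n))"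
  by (auto simp: torus_def carrier_integer_mod_group intro!: finite_PiE)

lemma avg_nonneg: "(\<And>x. x \<in> A \<Longrightarrow> f x \<ge> (0::real)) \<Longrightarrow> avg A f \<ge> 0"
  by (auto simp: avg_def intro!: mult_nonneg_nonneg sum_nonneg)

lemma avg_integral:
  assumes "\<And>x. x \<in> A \<Longrightarrow> integrable M (\<lambda>\<omega>. g \<omega> x :: real)"
  shows "integrable M (\<lambda>\<omega>. avg A (g \<omega>))" "avg A (\<lambda>x. \<integral>\<omega>. g \<omega> x \<partial>M) = (\<integral>\<omega>. avg A (g \<omega>) \<partial>M)"
  using assms by (auto simp: avg_def Bochner_Integration.integral_sum)

context
  fixes m n :: nat and M :: "'a measure" and D :: "'a \<Rightarrow> (nat \<Rightarrow> int) \<Rightarrow> (nat \<Rightarrow> int) \<Rightarrow> real"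
  assumes m: "m \<ge> 1"
    and int: "\<And>x y. x \<in> carrier (torus m n) \<Longrightarrow> y \<in> carrier (torus m n) \<Longrightarrow> integrable M (\<lambda>\<omega>. D \<omega> x y)"
begin

lemma torus_lhs_integral:
  "integrable M (\<lambda>\<omega>. torus_lhs n k m (D \<omega>))"
  "torus_lhs n k m (\<lambda>x y. \<integral>\<omega>. D \<omega> x y \<partial>M) = (\<integral>\<omega>. torus_lhs n k m (D \<omega>) \<partial>M)"
proof -
  let ?g = "\<lambda>S \<omega>. \<lambda>(x, \<epsilon>). D \<omega> (torus_shift m n x (\<lambda>i. int (4 * m) * restrict_vec S \<epsilon> i)) x"
  have i: "integrable M (\<lambda>\<omega>. ?g S \<omega> z)" if "z \<in> carrier (torus m n) \<times> cube n" for S z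
    using that by (auto intro!: int torus_shift_closed m)
  have e: "(\<integral>\<omega>. ?g S \<omega> z \<partial>M) = (\<lambda>(x, \<epsilon>). \<integral>\<omega>. D \<omega> (torus_shift m n x (\<lambda>i. int (4 * m) * restrict_vec S \<epsilon> i)) x \<partial>M) z" for S z
    by (cases z) simp
  note a = avg_integral[where g = "?g S" for S, OF i, unfolded e]
  show "integrable M (\<lambda>\<omega>. torus_lhs n k m (D \<omega>))"
    unfolding torus_lhs_def by (intro integrable_divide Bochner_Integration.integrable_sum) (rule a(1))
  show "torus_lhs n k m (\<lambda>x y. \<integral>\<omega>. D \<omega> x y \<partial>M) = (\<integral>\<omega>. torus_lhs n k m (D \<omega>) \<partial>M)"
    unfolding torus_lhs_def using a
    by (simp add: Bochner_Integration.integral_sum)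
qed

lemma torus_rhs_integral:
  "integrable M (\<lambda>\<omega>. torus_rhs p n k m (D \<omega>))"
  "torus_rhs p n k m (\<lambda>x y. \<integral>\<omega>. D \<omega> x y \<partial>M) = (\<integral>\<omega>. torus_rhs p n k m (D \<omega>) \<partial>M)"
proof -
  let ?h = "\<lambda>j \<omega> x. D \<omega> (torus_shift m n x (unit_vec j)) x"
  let ?g = "\<lambda>\<omega>. \<lambda>(x, \<epsilon>). D \<omega> (torus_shift m n x \<epsilon>) x"
  have i: "integrable M (\<lambda>\<omega>. ?g \<omega> z)" if "z \<in> carrier (torus m n) \<times> cube n" for z
    using that by (auto intro!: int torus_shift_closed m)
  have e: "(\<integral>\<omega>. ?g \<omega> z \<partial>M) = (\<lambda>(x, \<epsilon>). \<integral>\<omega>. D \<omega> (torus_shift m n x \<epsilon>) x \<partial>M) z" for z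
    by (cases z) simp
  note a = avg_integral[where g = "?g", OF i, unfolded e]
  have ih: "integrable M (\<lambda>\<omega>. ?h j \<omega> x)" if "x \<in> carrier (torus m n)" for j x
    using that by (auto intro!: int torus_shift_closed m)
  note b = avg_integral[where g = "?h j" for j, OF ih]
  have b': "integrable M (\<lambda>\<omega>. real k / real n * (\<Sum>j=1..n. avg (carrier (torus m n)) (?h j \<omega>)))"
    by (intro integrable_mult_right Bochner_Integration.integrable_sum b(1))
  have a': "integrable M (\<lambda>\<omega>. (real k / real n) powr (p / 2) * avg (carrier (torus m n) \<times> cube n) (?g \<omega>))"
    by (intro integrable_mult_right a(1))
  show "integrable M (\<lambda>\<omega>. torus_rhs p n k m (D \<omega>))"
    unfolding torus_rhs_def by (rule Bochner_Integration.integrable_add[OF b' a'])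
  show "torus_rhs p n k m (\<lambda>x y. \<integral>\<omega>. D \<omega> x y \<partial>M) = (\<integral>\<omega>. torus_rhs p n k m (D \<omega>) \<partial>M)"
    unfolding torus_rhs_def Bochner_Integration.integral_add[OF b' a'] using a b
    by (simp add: Bochner_Integration.integral_sum)
qed

end

lemma torus_lhs_nonneg: "(\<And>x y. D x y \<ge> 0) \<Longrightarrow> torus_lhs n k m D \<ge> 0"
  unfolding torus_lhs_def by (intro divide_nonneg_nonneg sum_nonneg avg_nonneg) auto

lemma torus_rhs_nonneg: "(\<And>x y. D x y \<ge> 0) \<Longrightarrow> torus_rhs p n k m D \<ge> 0"
  unfolding torus_rhs_def
  by (intro add_nonneg_nonneg mult_nonneg_nonneg sum_nonneg avg_nonneg) auto

lemma torus_ineq_finite_iff: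
  assumes "p \<ge> 2" "q \<ge> 0" "\<And>x y. D x y \<ge> 0"
  shows "torus_ineq p (ennreal q) n k m D \<longleftrightarrow> torus_lhs n k m D \<le> (q * real m) powr p * torus_rhs p n k m D"
proof -
  note nn = torus_lhs_nonneg[of D n k m, OF assms(3)] torus_rhs_nonneg[of D p n k m, OF assms(3)]
  let ?L = "torus_lhs n k m D" and ?R = "torus_rhs p n k m D"
  have "torus_ineq p (ennreal q) n k m D \<longleftrightarrow> ?L powr (1 / p) \<le> q * (real m * ?R powr (1 / p))"
    unfolding torus_ineq_def using assms(2) by (simp flip: ennreal_mult)
  also have "q * (real m * ?R powr (1 / p)) = ((q * real m) powr p * ?R) powr (1 / p)"
    using assms nn by (simp add: powr_mult powr_powr mult.assoc)
  also have "?L powr (1 / p) \<le> \<dots> \<longleftrightarrow> ?L \<le> (q * real m) powr p * ?R"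
  proof
    assume "?L \<le> (q * real m) powr p * ?R"
    then show "?L powr (1 / p) \<le> ((q * real m) powr p * ?R) powr (1 / p)"
      using nn assms by (intro powr_mono2) auto
  next
    assume "?L powr (1 / p) \<le> ((q * real m) powr p * ?R) powr (1 / p)"
    then show "?L \<le> (q * real m) powr p * ?R"
      using nn assms
      by (meson divide_pos_pos linorder_not_le powr_less_mono2 mult_nonneg_nonneg powr_ge_zero
          zero_less_one less_le_trans zero_less_numeral)
  qed
  finally show ?thesis .
qed

lemma torus_ineq_top_iff:
  assumes "p \<ge> 2" "m \<ge> 1" "\<And>x y. D x y \<ge> 0"
  shows "torus_ineq p Orderings.top n k m D \<longleftrightarrow> (torus_rhs p n k m D = 0 \<longrightarrow> torus_lhs n k m D = 0)"
proof (cases "torus_rhs p n k m D = 0")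
  case True
  then show ?thesis
    using assms torus_lhs_nonneg[of D n k m, OF assms(3)] by (simp add: torus_ineq_def powr_def)
next
  case False
  then have "torus_rhs p n k m D > 0"
    using torus_rhs_nonneg[of D p n k m, OF assms(3)] by linarith
  then have "real m * torus_rhs p n k m D powr (1 / p) > 0"
    using assms by simp
  then have "ennreal (real m * torus_rhs p n k m D powr (1 / p)) \<noteq> 0"
    by (simp only: ennreal_eq_0_iff)
  then show ?thesis
    using False by (simp add: torus_ineq_def ennreal_top_mult del: ennreal_eq_0_iff)
qed

lemma torus_ineq_integral:
  assumes p: "p \<ge> 2" and m: "m \<ge> 1"
    and int: "\<And>x y. x \<in> carrier (torus m n) \<Longrightarrow> y \<in> carrier (torus m n) \<Longrightarrow> integrable M (\<lambda>\<omega>. D \<omega> x y)"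
    and nn: "\<And>\<omega> x y. D \<omega> x y \<ge> 0"
    and le: "\<And>\<omega>. torus_ineq p K n k m (D \<omega>)"
  shows "torus_ineq p K n k m (\<lambda>x y. \<integral>\<omega>. D \<omega> x y \<partial>M)"
proof -
  note l = torus_lhs_integral[where D = D and M = M and m = m and n = n and k = k, OF m int]
  note r = torus_rhs_integral[where D = D and M = M and m = m and n = n and k = k and p = p, OF m int]
  have nn': "(\<integral>\<omega>. D \<omega> x y \<partial>M) \<ge> 0" for x y
    using nn by simp
  show ?thesis
  proof (cases K)
    case (real q)
    have "(\<integral>\<omega>. torus_lhs n k m (D \<omega>) \<partial>M) \<le> (\<integral>\<omega>. (q * real m) powr p * torus_rhs p n k m (D \<omega>) \<partial>M)"
      using le real torus_ineq_finite_iff[OF p, of q "D \<omega>" for \<omega>] nn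
      by (intro integral_mono l(1) integrable_mult_right r(1)) auto
    then show ?thesis
      using real p nn' by (simp add: torus_ineq_finite_iff l r)
  next
    case top
    have pt: "torus_rhs p n k m (D \<omega>) = 0 \<longrightarrow> torus_lhs n k m (D \<omega>) = 0" for \<omega>
      using le[of \<omega>] torus_ineq_top_iff[OF p m, of "D \<omega>"] nn top by simp
    have "(\<integral>\<omega>. torus_lhs n k m (D \<omega>) \<partial>M) = 0" if "(\<integral>\<omega>. torus_rhs p n k m (D \<omega>) \<partial>M) = 0"
    proof -
      have "AE \<omega> in M. torus_rhs p n k m (D \<omega>) = 0"
        using that r(1) torus_rhs_nonneg[of "D \<omega>" for \<omega>, OF nn]
        by (subst integral_nonneg_eq_0_iff_AE[symmetric]) auto
      then have "AE \<omega> in M. torus_lhs n k m (D \<omega>) = 0"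
        using pt by auto
      then show ?thesis
        by (rule integral_eq_zero_AE)
    qed
    then show ?thesis
      using top p m nn' by (simp add: torus_ineq_top_iff l r)
  qed
qed

lemma Lp_norm_powr: "p \<ge> 2 \<Longrightarrow> Lp_norm p M g powr p = (\<integral>\<omega>. norm (g \<omega>) powr p \<partial>M)"
  by (simp add: Lp_norm_def powr_powr)

lemma Lp_diff_integrable:
  fixes f g :: "'a \<Rightarrow> 'k::{real_normed_field, second_countable_topology}"
  assumes p: "p \<ge> 2" and f: "f \<in> Lp p M" and g: "g \<in> Lp p M"
  shows "integrable M (\<lambda>\<omega>. norm (f \<omega> - g \<omega>) powr p)"
proof (rule Bochner_Integration.integrable_bound)
  show "integrable M (\<lambda>\<omega>. 2 powr p * (norm (f \<omega>) powr p + norm (g \<omega>) powr p))"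
    using f g by (auto simp: Lp_def)
  have [measurable]: "f \<in> borel_measurable M" "g \<in> borel_measurable M"
    using f g by (auto simp: Lp_def)
  show "(\<lambda>\<omega>. norm (f \<omega> - g \<omega>) powr p) \<in> borel_measurable M"
    by measurable
  have "norm (f \<omega> - g \<omega>) powr p \<le> 2 powr p * (norm (f \<omega>) powr p + norm (g \<omega>) powr p)" for \<omega>
  proof -
    have "norm (f \<omega> - g \<omega>) \<le> 2 * max (norm (f \<omega>)) (norm (g \<omega>))"
      using norm_triangle_ineq4[of "f \<omega>" "g \<omega>"] by linarith
    then have "norm (f \<omega> - g \<omega>) powr p \<le> (2 * max (norm (f \<omega>)) (norm (g \<omega>))) powr p"
      using p by (intro powr_mono2) auto
    also have "\<dots> = 2 powr p * max (norm (f \<omega>)) (norm (g \<omega>)) powr p"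
      by (subst powr_mult) (auto simp: max_def)
    also have "\<dots> \<le> 2 powr p * (norm (f \<omega>) powr p + norm (g \<omega>) powr p)"
      by (intro mult_left_mono) (auto simp: max_def)
    finally show ?thesis .
  qed
  then show "AE \<omega> in M. norm (norm (f \<omega> - g \<omega>) powr p) \<le>
      norm (2 powr p * (norm (f \<omega>) powr p + norm (g \<omega>) powr p))"
    by simp
qed

lemma metric_X_ineq_scalar_iff:
  assumes p: "p \<ge> 2"
  shows "metric_X_ineq (T :: 'a itself) (U :: 'k::{real_normed_field, second_countable_topology} itself) p K \<longleftrightarrow>
     (\<forall>n. \<forall>k\<in>{1..n}. \<forall>m::nat. real m \<ge> sqrt (real n / real k) \<longrightarrow>
       (\<forall>f :: (nat \<Rightarrow> int) \<Rightarrow> 'k. torus_ineq p K n k m (\<lambda>x y. norm (f x - f y) powr p)))"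
    (is "?A \<longleftrightarrow> ?B")
proof
  assume A: ?A
  show ?B
  proof (intro allI ballI impI)
    fix n k m :: nat and f :: "(nat \<Rightarrow> int) \<Rightarrow> 'k"
    assume kn: "k \<in> {1..n}" and m: "real m \<ge> sqrt (real n / real k)"
    define M :: "'a measure" where "M = count_space {undefined}"
    have "\<forall>x \<in> carrier (torus m n). (\<lambda>_. f x) \<in> Lp p M"
      by (auto simp: Lp_def M_def integrable_count_space)
    then have "torus_ineq p K n k m (\<lambda>x y. Lp_norm p M (\<lambda>\<omega>. f x - f y) powr p)"
      using A[unfolded metric_X_ineq_iff, rule_format, OF kn m, of "\<lambda>x _. f x"] by auto
    then show "torus_ineq p K n k m (\<lambda>x y. norm (f x - f y) powr p)"
      unfolding Lp_norm_powr[OF p] by (simp add: M_def lebesgue_integral_count_space_finite)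
  qed
next
  assume B: ?B
  show ?A
    unfolding metric_X_ineq_iff
  proof (intro allI ballI impI)
    fix n k m :: nat and M :: "'a measure" and f :: "(nat \<Rightarrow> int) \<Rightarrow> 'a \<Rightarrow> 'k"
    assume kn: "k \<in> {1..n}" and m: "real m \<ge> sqrt (real n / real k)"
      and f: "\<forall>x \<in> carrier (torus m n). f x \<in> Lp p M"
    have "0 < sqrt (real n / real k)"
      using kn by simp
    then have m1: "m \<ge> 1"
      using m by linarith
    show "torus_ineq p K n k m (\<lambda>x y. Lp_norm p M (\<lambda>\<omega>. f x \<omega> - f y \<omega>) powr p)"
      unfolding Lp_norm_powr[OF p]
    proof (rule torus_ineq_integral[OF p m1])
      show "torus_ineq p K n k m (\<lambda>x y. norm (f x \<omega> - f y \<omega>) powr p)" for \<omega>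
        using B[rule_format, OF kn m, of "\<lambda>x. f x \<omega>"] .
    qed (auto intro!: Lp_diff_integrable[OF p] bspec[OF f])
  qed
qed

theorem metric_X_const_type_independent:
  assumes "p \<ge> 2"
  shows "metric_X_const TYPE('a) p = metric_X_const TYPE('b) p"
  unfolding metric_X_const_def metric_X_ineq_scalar_iff[OF assms] ..


section \<open>The constants are least admissible ones\<close>

lemma Inf_ennreal_admissible:
  assumes "K0 \<in> A" "\<And>K. K \<in> A \<Longrightarrow> ennreal a \<le> K * ennreal b"
  shows "ennreal a \<le> Inf A * ennreal b"
proof (cases "ennreal b = 0")
  case True
  then show ?thesis using assms(2)[OF assms(1)] by simp
next
  case False
  have "ennreal a / ennreal b \<le> K" if "K \<in> A" for K
    using divide_right_mono_ennreal[OF assms(2)[OF that], of "ennreal b"] False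
    by (simp add: ennreal_mult_divide_eq)
  then have "ennreal a / ennreal b \<le> Inf A"
    by (rule Inf_greatest)
  then have "ennreal a / ennreal b * ennreal b \<le> Inf A * ennreal b"
    by (rule mult_right_mono) simp
  then show ?thesis
    using False by (simp add: ennreal_divide_times ennreal_mult_divide_eq)
qed

lemma linear_X_const_least:
  assumes "linear_X_ineq TYPE(real) p K" "linear_X_ineq TYPE(complex) p K"
  shows "linear_X_ineq TYPE(real) p (linear_X_const p)"
    and "linear_X_ineq TYPE(complex) p (linear_X_const p)"
    and "linear_X_const p \<le> K"
proof -
  define A where "A = {K. linear_X_ineq TYPE(real) p K \<and> linear_X_ineq TYPE(complex) p K}"
  have A: "K \<in> A"
    using assms by (simp add: A_def)
  have C: "linear_X_const p = Inf A"
    by (simp add: A_def linear_X_const_def)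
  show "linear_X_const p \<le> K"
    unfolding C by (rule Inf_lower[OF A])
  show "linear_X_ineq TYPE(real) p (linear_X_const p)"
    unfolding linear_X_ineq_def C
    by (intro allI ballI impI Inf_ennreal_admissible[OF A])
       (simp add: A_def linear_X_ineq_def)
  show "linear_X_ineq TYPE(complex) p (linear_X_const p)"
    unfolding linear_X_ineq_def C
    by (intro allI ballI impI Inf_ennreal_admissible[OF A])
       (simp add: A_def linear_X_ineq_def)
qed

text \<open>By the two theorems about \<open>metric_X_const\<close>, an admissible \<open>K\<close> for one type is at least
  the common value for all types, and that value is admissible for each of them.\<close>

theorem metric_X_const_least:
  assumes "metric_X_ineq TYPE('a) TYPE(real) p K" "metric_X_ineq TYPE('a) TYPE(complex) p K"
  shows "metric_X_ineq TYPE('a) TYPE(real) p (metric_X_const TYPE('a) p)"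
    and "metric_X_ineq TYPE('a) TYPE(complex) p (metric_X_const TYPE('a) p)"
    and "metric_X_const TYPE('a) p \<le> K"
proof -
  define A where
    "A = {K. metric_X_ineq TYPE('a) TYPE(real) p K \<and> metric_X_ineq TYPE('a) TYPE(complex) p K}"
  have A: "K \<in> A"
    using assms by (simp add: A_def)
  have C: "metric_X_const TYPE('a) p = Inf A"
    by (simp add: A_def metric_X_const_def)
  show "metric_X_const TYPE('a) p \<le> K"
    unfolding C by (rule Inf_lower[OF A])
  show "metric_X_ineq TYPE('a) TYPE(real) p (metric_X_const TYPE('a) p)"
    unfolding metric_X_ineq_iff torus_ineq_def C
    by (intro allI ballI impI Inf_ennreal_admissible[OF A])
       (auto simp: A_def metric_X_ineq_iff torus_ineq_def)
  show "metric_X_ineq TYPE('a) TYPE(complex) p (metric_X_const TYPE('a) p)"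
    unfolding metric_X_ineq_iff torus_ineq_def C
    by (intro allI ballI impI Inf_ennreal_admissible[OF A])
       (auto simp: A_def metric_X_ineq_iff torus_ineq_def)
qed

end

theory Submission
  imports Defs
begin

text \<open>
  Reveal the coordinates of the cube one at a time in a uniformly random order. After \<open>j\<close> steps the
  revealed set \<open>S\<close> is a uniform \<open>j\<close>-set, and \<open>P\<^sub>S h\<close> is a martingale, so the left side of the linear
  inequality is the \<open>p\<close>-th moment of this martingale at time \<open>k\<close>. Revealing \<open>\<epsilon>\<^sub>i\<close> adds the symmetric
  increment \<open>\<epsilon>\<^sub>i b\<^sub>i\<close> with \<open>b\<^sub>i = P\<^sub>S(\<epsilon>\<^sub>i h)\<close> (\<open>cube_proj_insert\<close>). Two facts about the increments make the
  argument work. First, the \<open>b\<^sub>i\<close> with \<open>i \<notin> S\<close> are Fourier coefficients of \<open>h\<close> on the fibre over \<open>\<epsilon>\<^sub>S\<close>, so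
  by Bessel's inequality \<open>\<Sum> b\<^sub>i\<^sup>2 \<le> P\<^sub>S(h\<^sup>2)\<close> (\<open>cube_proj_Bessel\<close>): the conditional variance of one step is at
  most \<open>P\<^sub>S(h\<^sup>2)\<close> divided by the number \<open>n - j\<close> of remaining coordinates, and the \<open>p/2\<close>-norm of
  \<open>P\<^sub>S(h\<^sup>2)\<close> is at most \<open>\<parallel>h\<parallel>\<^sub>p\<^sup>2\<close>, without any loss in \<open>p\<close>.
  Secondly, \<open>\<parallel>b\<^sub>i\<parallel>\<^sub>p \<le> \<parallel>\<partial>\<^sub>i h\<parallel>\<^sub>p / 2\<close>. A Rosenthal type argument then gives the factor \<open>p / ln p\<close>: an increment that is
  smaller than \<open>ln p / (2 p)\<close> times the current value is charged to the variance, a larger one to its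
  own \<open>p\<close>-th power (\<open>powr_even_increment\<close>), and the resulting recursion for the \<open>p\<close>-th moments is solved
  by \<open>powr_recursion_bound\<close>. The variance term comes with a power of \<open>p\<close> below \<open>p / ln p\<close>. Complex
  functions are split into real and imaginary parts.

  The metric inequality follows from the linear one with a constant of the same order. Replace \<open>f\<close> by
  its average \<open>g(x) = \<bbbE> f(x + \<delta>)\<close>. The error \<open>f - g\<close> is bounded by the diagonal term, and this is
  where \<open>m \<ge> sqrt (n / k)\<close> enters. A translation by \<open>4 m \<epsilon>\<^sub>S\<close> is made of \<open>2 m\<close> translations by \<open>2 \<epsilon>\<^sub>S\<close>,
  and \<open>g(y + 2 \<epsilon>\<^sub>S) - g(y)\<close> is an average of differences \<open>P\<^sub>S h(\<epsilon>) - P\<^sub>S h(-\<epsilon>)\<close> for the cube functions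
  \<open>h(\<epsilon>) = f(x + \<epsilon>) - g(x)\<close> (\<open>smooth_step\<close>), to which the linear inequality applies.

  For the lower bound in the metric case take \<open>r = \<lfloor>p / ln p\<rfloor>\<close>, \<open>k = m = r\<close>, \<open>n = r\<^sup>3\<close> and let \<open>f\<close> be the
  sum of the distances of the first \<open>r\<close> coordinates to \<open>0\<close>. With probability \<open>e\<close> to the power \<open>-O(p)\<close> the
  set \<open>S\<close> is \<open>{1..r}\<close> and these coordinates all lie in one eighth of the cycle, and then
  \<open>f(x + 4 m \<epsilon>\<^sub>S) - f(x)\<close> is at least \<open>2 m r\<close>, while the right side stays of order \<open>m\<close>. The linear lower
  bound is a consequence of the metric one and the comparison of the two constants.
\<close>

section \<open>Elementary inequalities\<close>

text \<open>Young's inequality for the exponents \<open>q\<close> and \<open>q / (q - 1)\<close>, equivalently: the graph of \<open>t powr q\<close> lies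
  above its tangent at \<open>c\<close>. The Jensen, Bernoulli and Hoelder inequalities below are all
  consequences.\<close>

lemma powr_young:
  fixes x c q :: real
  assumes "x \<ge> 0" "c \<ge> 0" "q \<ge> 1"
  shows "q * x * c powr (q - 1) \<le> x powr q + (q - 1) * c powr q"
proof (cases "x = 0 \<or> c = 0")
  case True
  then show ?thesis using assms by auto
next
  case False
  with assms have pos: "x > 0" "c > 0" by auto
  have "(x powr q) powr (1 / q) * (c powr q) powr (1 - 1 / q)
      \<le> 1 / q * x powr q + (1 - 1 / q) * c powr q"
    using pos assms by (intro Youngs_inequality_0) auto
  moreover have "q * (1 - 1 / q) = q - 1"
    using assms by (simp add: field_simps)
  ultimately have "x * c powr (q - 1) \<le> 1 / q * x powr q + (1 - 1 / q) * c powr q"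
    using pos assms by (simp add: powr_powr)
  then have "q * (x * c powr (q - 1)) \<le> q * (1 / q * x powr q + (1 - 1 / q) * c powr q)"
    using assms by (intro mult_left_mono) auto
  also have "\<dots> = x powr q + (q - 1) * c powr q"
    using assms by (simp add: field_simps)
  finally show ?thesis by (simp add: mult.assoc)
qed

lemma powr_bernoulli:
  fixes x s q :: real
  assumes "x \<ge> 0" "s \<ge> 0" "q \<ge> 1"
  shows "x powr q + q * s * x powr (q - 1) \<le> (x + s) powr q"
proof -
  have "x * x powr (q - 1) = x powr q"
    using assms by (metis powr_mult_base add.commute diff_add_cancel)
  then show ?thesis
    using powr_young[of "x + s" x q] assms by (simp add: algebra_simps)
qed

lemma powr_add_le:
  fixes a b p :: real
  assumes "a \<ge> 0" "b \<ge> 0" "p \<ge> 0"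
  shows "(a + b) powr p \<le> 2 powr p * (a powr p + b powr p)"
proof -
  have "(a + b) powr p \<le> (2 * max a b) powr p"
    using assms by (intro powr_mono2) auto
  also have "\<dots> = 2 powr p * max a b powr p"
    using assms by (simp add: powr_mult max_def)
  also have "\<dots> \<le> 2 powr p * (a powr p + b powr p)"
    by (intro mult_left_mono) (auto simp: max_def)
  finally show ?thesis .
qed

lemma powr_norm_add_le:
  assumes "p \<ge> 0"
  shows "norm (a + b) powr p \<le> 2 powr p * (norm a powr p + norm b powr p)"
  by (rule order_trans[OF powr_mono2[OF assms norm_ge_zero norm_triangle_ineq]
        powr_add_le[OF norm_ge_zero norm_ge_zero assms]])

lemma powr_norm_diff_le:
  assumes "p \<ge> 0"
  shows "norm (a - b) powr p \<le> 2 powr p * (norm a powr p + norm b powr p)"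
  using powr_norm_add_le[OF assms, of a "- b"] by simp

lemma div_ln_ge_one:
  assumes "p \<ge> (2::real)"
  shows "p / ln p \<ge> 1"
  using ln_bound[of p] assms by (simp add: field_simps)

lemma exp_even_increment:
  assumes "t \<ge> (0::real)"
  shows "exp t + exp (- t) \<le> 2 + t\<^sup>2 * exp t"
proof -
  have "exp t + exp (- t) - 2 = exp t * (1 - exp (- t))\<^sup>2"
    by (simp add: power2_eq_square algebra_simps flip: exp_add)
  also have "\<dots> \<le> exp t * t\<^sup>2"
  proof -
    have "1 - exp (- t) \<le> t"
      using exp_ge_add_one_self[of "- t"] by simp
    then have "(1 - exp (- t))\<^sup>2 \<le> t\<^sup>2"
      using assms by (intro power_mono) auto
    then show ?thesis by simp
  qed
  finally show ?thesis by (simp add: mult.commute)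
qed

text \<open>The threshold \<open>ln p / (2 p)\<close> for \<open>y / x\<close> is the one that produces \<open>p / ln p\<close>. Below it, the second order
  growth \<open>p\<^sup>2 y\<^sup>2 / x\<^sup>2\<close> is multiplied by at most \<open>exp (p y / x) \<le> sqrt p\<close>; above it, \<open>x + y\<close> is at most
  \<open>3 p / ln p\<close> times \<open>y\<close>. Writing \<open>(x\<^sup>2) powr (p / 2 - 1)\<close> for the power \<open>p - 2\<close> of \<open>x\<close> matches the
  form in which Hoelder's inequality is applied.\<close>

lemma powr_even_increment_nonneg:
  fixes x y p :: real
  assumes p: "p \<ge> 2" and x: "x \<ge> 0" and y: "y \<ge> 0"
  shows "(\<bar>x + y\<bar> powr p + \<bar>x - y\<bar> powr p) / 2
    \<le> x powr p + p powr (5/2) / 2 * (y\<^sup>2 * (x\<^sup>2) powr (p / 2 - 1)) + (3 * (p / ln p)) powr p * y powr p"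
proof -
  have l: "ln p > 0" using p by simp
  have nn: "p powr (5/2) / 2 * (y\<^sup>2 * (x\<^sup>2) powr (p / 2 - 1)) \<ge> 0"
    "(3 * (p / ln p)) powr p * y powr p \<ge> 0" by auto
  have th: "ln p / (2 * p) * x \<ge> 0"
    using l p x by simp
  consider "x = 0" "y = 0" | "x > 0" "y \<le> ln p / (2 * p) * x" | "y > 0" "y \<ge> ln p / (2 * p) * x"
    using x y th by (metis less_eq_real_def linorder_le_cases mult_zero_right)
  then show ?thesis
  proof cases
    case 1
    then show ?thesis by simp
  next
    case 2
    \<comment> \<open>Small increment: \<open>(1 \<plusminus> t / p) powr p \<le> exp (\<plusminus> t)\<close> with \<open>t \<le> ln p / 2\<close>.\<close>
    define t where "t = p * y / x"
    have t: "t \<ge> 0" "t \<le> ln p / 2"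
      using 2 p y by (auto simp: t_def field_simps)
    have yx: "y = t / p * x" using 2 p by (simp add: t_def)
    have "t / p \<le> ln p / 2 / p"
      using t p by (intro divide_right_mono) auto
    also have "\<dots> \<le> 1" using ln_bound[of p] p by (simp add: field_simps)
    finally have u1: "t / p \<le> 1" .
    have xp: "x powr p > 0" using 2 by simp
    have "\<bar>x + y\<bar> powr p = ((1 + t / p) * x) powr p"
      using x y by (simp add: yx algebra_simps)
    also have "\<dots> = (1 + t / p) powr p * x powr p"
      using x t p by (simp add: powr_mult)
    also have "(1 + t / p) powr p \<le> exp (t / p) powr p"
      using t p by (intro powr_mono2) auto
    also have "exp (t / p) powr p = exp t"
      using p by (simp add: powr_def)
    finally have a: "\<bar>x + y\<bar> powr p \<le> exp t * x powr p" using xp by simp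
    have "x - y = (1 - t / p) * x" by (simp add: yx algebra_simps)
    moreover have "(1 - t / p) * x \<ge> 0" using u1 x by simp
    ultimately have "\<bar>x - y\<bar> = (1 - t / p) * x" by simp
    then have "\<bar>x - y\<bar> powr p = (1 - t / p) powr p * x powr p"
      using x u1 by (simp add: powr_mult)
    also have "(1 - t / p) powr p \<le> exp (- t / p) powr p"
      using t p u1 exp_ge_add_one_self[of "- t / p"] by (intro powr_mono2) auto
    also have "exp (- t / p) powr p = exp (- t)"
      using p by (simp add: powr_def)
    finally have b: "\<bar>x - y\<bar> powr p \<le> exp (- t) * x powr p" using xp by simp
    have "exp t \<le> exp (ln p / 2)" using t by simp
    also have "\<dots> = p powr (1/2)" using p by (simp add: powr_def)
    finally have et: "exp t \<le> p powr (1/2)" .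
    have "(\<bar>x + y\<bar> powr p + \<bar>x - y\<bar> powr p) / 2 \<le> (exp t + exp (- t)) / 2 * x powr p"
      using a b by (simp add: field_simps)
    also have "\<dots> \<le> (2 + t\<^sup>2 * exp t) / 2 * x powr p"
      using exp_even_increment[OF t(1)] xp by (intro mult_right_mono divide_right_mono) auto
    also have "\<dots> \<le> (2 + t\<^sup>2 * p powr (1/2)) / 2 * x powr p"
      using et xp by (intro mult_right_mono divide_right_mono add_left_mono mult_left_mono) auto
    also have "\<dots> = x powr p + p powr (1/2) / 2 * (t\<^sup>2 * x powr p)"
      by (simp add: field_simps)
    also have "t\<^sup>2 * x powr p = p\<^sup>2 * (y\<^sup>2 * (x\<^sup>2) powr (p / 2 - 1))"
    proof -
      have "x\<^sup>2 * (x\<^sup>2) powr (p / 2 - 1) = (x\<^sup>2) powr (p / 2)"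
        by (metis add.commute diff_add_cancel powr_mult_base zero_le_power2)
      also have "\<dots> = x powr p" using 2 by (simp add: powr_powr flip: powr_numeral)
      finally have e: "x powr p = x\<^sup>2 * (x\<^sup>2) powr (p / 2 - 1)" ..
      have "t\<^sup>2 * x\<^sup>2 = p\<^sup>2 * y\<^sup>2" using 2 by (simp add: t_def power_divide power_mult_distrib)
      then show ?thesis by (simp add: e mult.assoc[symmetric])
    qed
    also have "p powr (1/2) / 2 * (p\<^sup>2 * (y\<^sup>2 * (x\<^sup>2) powr (p / 2 - 1)))
        = p powr (5/2) / 2 * (y\<^sup>2 * (x\<^sup>2) powr (p / 2 - 1))"
    proof -
      have "p powr (5/2) = p powr (1/2) * p\<^sup>2"
        using p by (simp flip: powr_numeral powr_add)
      then show ?thesis by simp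
    qed
    finally show ?thesis using nn by linarith
  next
    case 3
    \<comment> \<open>Large increment: the current value is dominated by a multiple of the increment.\<close>
    have "x \<le> 2 * (p / ln p) * y"
      using 3 l p by (simp add: field_simps)
    moreover have "1 * y \<le> p / ln p * y"
      using div_ln_ge_one[OF p] y by (intro mult_right_mono) auto
    ultimately have m: "x + y \<le> 3 * (p / ln p) * y"
      by linarith
    define Z where "Z = (3 * (p / ln p) * y) powr p"
    have "\<bar>x + y\<bar> powr p \<le> Z" "\<bar>x - y\<bar> powr p \<le> Z"
      using x y p m unfolding Z_def by (auto intro!: powr_mono2)
    then have "(\<bar>x + y\<bar> powr p + \<bar>x - y\<bar> powr p) / 2 \<le> Z" by simp
    also have "Z = (3 * (p / ln p)) powr p * y powr p"
      unfolding Z_def by (rule powr_mult)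
    finally show ?thesis using nn(1) by (smt (verit) powr_ge_zero)
  qed
qed

lemma powr_even_increment:
  fixes x y p :: real
  assumes p: "p \<ge> 2"
  shows "(\<bar>x + y\<bar> powr p + \<bar>x - y\<bar> powr p) / 2
    \<le> \<bar>x\<bar> powr p + p powr (5/2) / 2 * (y\<^sup>2 * (x\<^sup>2) powr (p / 2 - 1)) + (3 * (p / ln p)) powr p * \<bar>y\<bar> powr p"
proof -
  have "\<bar>x + y\<bar> powr p + \<bar>x - y\<bar> powr p = \<bar>\<bar>x\<bar> + \<bar>y\<bar>\<bar> powr p + \<bar>\<bar>x\<bar> - \<bar>y\<bar>\<bar> powr p"
    by (cases "x \<ge> 0"; cases "y \<ge> 0") (auto simp: abs_minus_commute add.commute)
  then show ?thesis
    using powr_even_increment_nonneg[OF p, of "\<bar>x\<bar>" "\<bar>y\<bar>"] by simp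
qed

text \<open>The discrete form of the differential inequality \<open>A' \<le> \<beta> A powr (1 - 1 / q) + b\<close>. Linearising it through
  \<open>A = X powr q\<close> gains the factor \<open>1 / q\<close> in front of \<open>\<beta>\<close>; with \<open>q = p / 2\<close> this gain is what keeps the
  variance term below \<open>p / ln p\<close>. The offset \<open>a\<close> absorbs the increments \<open>b\<close>.\<close>

lemma powr_recursion_bound:
  fixes A :: "nat \<Rightarrow> real"
  assumes q: "q \<ge> 1" and a: "a > 0" and \<beta>: "\<beta> \<ge> 0" and b: "b \<ge> 0"
    and init: "A 0 \<le> a powr q"
    and step: "\<And>j X. j < k \<Longrightarrow> X > 0 \<Longrightarrow> A j \<le> X powr q \<Longrightarrow> A (Suc j) \<le> A j + \<beta> * X powr (q - 1) + b"
  shows "j \<le> k \<Longrightarrow> A j \<le> (a + real j * ((\<beta> + b * a powr (1 - q)) / q)) powr q"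
proof (induction j)
  case 0
  then show ?case using init by simp
next
  case (Suc j)
  define s where "s = (\<beta> + b * a powr (1 - q)) / q"
  define X where "X = a + real j * s"
  have s: "s \<ge> 0" using q \<beta> b by (simp add: s_def)
  have X: "X \<ge> a" using s by (simp add: X_def)
  have IH: "A j \<le> X powr q" using Suc by (simp add: X_def s_def)
  have "1 \<le> (X / a) powr (q - 1)"
    using X a q by (intro ge_one_powr_ge_zero) auto
  also have "\<dots> = a powr (1 - q) * X powr (q - 1)"
    using X a powr_minus[of a "q - 1"] by (simp add: powr_divide field_simps)
  finally have "b * 1 \<le> b * (a powr (1 - q) * X powr (q - 1))"
    using b by (intro mult_left_mono) auto
  moreover have "A (Suc j) \<le> A j + \<beta> * X powr (q - 1) + b"
    using Suc.prems X a IH by (intro step) auto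
  ultimately have "A (Suc j) \<le> X powr q + (\<beta> + b * a powr (1 - q)) * X powr (q - 1)"
    using IH by (simp add: algebra_simps)
  also have "\<beta> + b * a powr (1 - q) = q * s" using q by (simp add: s_def)
  also have "X powr q + q * s * X powr (q - 1) \<le> (X + s) powr q"
    using X a s q by (intro powr_bernoulli) auto
  also have "X + s = a + real (Suc j) * s" by (simp add: X_def algebra_simps)
  finally show ?case by (simp add: s_def)
qed

section \<open>Averages over finite sets\<close>

lemma avg_mono: "(\<And>x. x \<in> A \<Longrightarrow> f x \<le> g x) \<Longrightarrow> avg A f \<le> (avg A g :: real)"
  by (auto simp: avg_def intro!: mult_left_mono sum_mono)

lemma avg_cong: "A = B \<Longrightarrow> (\<And>x. x \<in> B \<Longrightarrow> f x = g x) \<Longrightarrow> avg A f = avg B g"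
  by (simp add: avg_def cong: sum.cong)

lemma avg_add: "avg A (\<lambda>x. f x + g x) = avg A f + avg A g"
  by (simp add: avg_def sum.distrib scaleR_add_right)

lemma avg_diff: "avg A (\<lambda>x. f x - g x) = avg A f - avg A g"
  by (simp add: avg_def sum_subtractf scaleR_diff_right)

lemma avg_cmult: "avg A (\<lambda>x. c * f x) = c * (avg A f :: 'a::real_normed_field)"
  by (simp add: avg_def sum_distrib_left[symmetric])

lemma avg_uminus: "avg A (\<lambda>x. - f x) = - avg A f"
  by (simp add: avg_def sum_negf)

lemma avg_sum: "avg A (\<lambda>x. \<Sum>i\<in>I. f i x) = (\<Sum>i\<in>I. avg A (f i))"
  unfolding avg_def scaleR_sum_right[symmetric] by (subst sum.swap) rule

lemma avg_const: "finite A \<Longrightarrow> A \<noteq> {} \<Longrightarrow> avg A (\<lambda>_. c) = c"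
  by (simp add: avg_def sum_constant_scaleR)

lemma avg_reindex:
  assumes "bij_betw g A B"
  shows "avg B f = avg A (\<lambda>x. f (g x))"
  unfolding avg_def using sum.reindex_bij_betw[OF assms, of f] bij_betw_same_card[OF assms] by simp

lemma avg_Times: "avg (A \<times> B) (\<lambda>(x, y). f x y) = avg A (\<lambda>x. avg B (f x))"
  by (cases "finite A \<and> finite B")
     (auto simp: avg_def card_cartesian_product sum.cartesian_product[symmetric]
        scaleR_sum_right[symmetric] mult.commute card_eq_0_iff finite_cartesian_product_iff)

lemma avg_swap: "avg A (\<lambda>x. avg B (f x)) = avg B (\<lambda>y. avg A (\<lambda>x. f x y))"
proof -
  have "(\<Sum>x\<in>A. \<Sum>y\<in>B. f x y) = (\<Sum>y\<in>B. \<Sum>x\<in>A. f x y)" by (rule sum.swap)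
  then show ?thesis
    by (simp add: avg_def scaleR_sum_right[symmetric] mult.commute)
qed

text \<open>Jensen's inequality for \<open>t powr p\<close>: average the tangent \<open>powr_young\<close> at the mean of the norms.\<close>

lemma avg_Jensen:
  assumes "p \<ge> 1"
  shows "norm (avg A f) powr p \<le> avg A (\<lambda>x. norm (f x) powr p)"
proof (cases "finite A \<and> A \<noteq> {}")
  case False
  then show ?thesis by (auto simp: avg_def)
next
  case True
  define c where "c = avg A (\<lambda>x. norm (f x))"
  have c: "c \<ge> 0" unfolding c_def by (rule avg_nonneg) auto
  have "norm (avg A f) \<le> c"
    by (auto simp: c_def avg_def intro!: mult_left_mono norm_sum)
  then have "norm (avg A f) powr p \<le> c powr p"
    using assms by (intro powr_mono2) auto
  also have "\<dots> = p * c * c powr (p - 1) - (p - 1) * c powr p"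
    using c powr_mult_base[of c "p - 1"] by (simp add: algebra_simps)
  also have "\<dots> = avg A (\<lambda>x. p * c powr (p - 1) * norm (f x) - (p - 1) * c powr p)"
    using True by (simp add: avg_diff avg_cmult avg_const c_def[symmetric])
  also have "\<dots> \<le> avg A (\<lambda>x. norm (f x) powr p)"
  proof (rule avg_mono)
    show "p * c powr (p - 1) * norm (f x) - (p - 1) * c powr p \<le> norm (f x) powr p" for x
      using powr_young[OF norm_ge_zero c assms, of "f x"] by (simp add: mult_ac)
  qed
  finally show ?thesis .
qed

text \<open>Hoelder's inequality for the exponents \<open>q\<close> and \<open>q / (q - 1)\<close>, in terms of upper bounds for the two
  norms: this is the form in which the recursion for the moments consumes it.\<close>

lemma avg_Hoelder:
  fixes w u :: "'a \<Rightarrow> real"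
  assumes q: "q \<ge> 1" and X: "X > 0" and Y: "Y > 0"
    and w: "\<And>x. x \<in> A \<Longrightarrow> w x \<ge> 0" and u: "\<And>x. x \<in> A \<Longrightarrow> u x \<ge> 0"
    and wY: "avg A (\<lambda>x. w x powr q) \<le> Y powr q" and uX: "avg A (\<lambda>x. u x powr q) \<le> X powr q"
  shows "avg A (\<lambda>x. w x * u x powr (q - 1)) \<le> Y * X powr (q - 1)"
proof -
  have pt: "w x * u x powr (q - 1) \<le> Y * X powr (q - 1) *
      (1 / q * (1 / Y powr q * w x powr q) + (1 - 1 / q) * (1 / X powr q * u x powr q))"
    if "x \<in> A" for x
  proof -
    have "q * (w x / Y) * (u x / X) powr (q - 1) \<le> (w x / Y) powr q + (q - 1) * (u x / X) powr q"
      using w[OF that] u[OF that] X Y q by (intro powr_young) auto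
    then have "(w x / Y) * (u x / X) powr (q - 1)
        \<le> 1 / q * (w x / Y) powr q + (1 - 1 / q) * (u x / X) powr q"
      using q by (simp add: field_simps)
    then have "Y * X powr (q - 1) * ((w x / Y) * (u x / X) powr (q - 1))
       \<le> Y * X powr (q - 1) * (1 / q * (w x / Y) powr q + (1 - 1 / q) * (u x / X) powr q)"
      using X Y by (intro mult_left_mono) auto
    then show ?thesis
      using X Y w[OF that] u[OF that] by (simp add: powr_divide)
  qed
  have "avg A (\<lambda>x. w x * u x powr (q - 1)) \<le> avg A (\<lambda>x. Y * X powr (q - 1) *
      (1 / q * (1 / Y powr q * w x powr q) + (1 - 1 / q) * (1 / X powr q * u x powr q)))"
    by (rule avg_mono) (rule pt)
  also have "\<dots> = Y * X powr (q - 1) * (1 / q * (1 / Y powr q * avg A (\<lambda>x. w x powr q))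
      + (1 - 1 / q) * (1 / X powr q * avg A (\<lambda>x. u x powr q)))"
    by (simp only: avg_cmult avg_add)
  also have "\<dots> \<le> Y * X powr (q - 1) * (1 / q * 1 + (1 - 1 / q) * 1)"
    using q X Y wY uX by (intro mult_left_mono add_mono) auto
  finally show ?thesis by simp
qed

section \<open>Fibres and conditional expectations on the cube\<close>

definition fibre :: "nat \<Rightarrow> nat set \<Rightarrow> (nat \<Rightarrow> int) \<Rightarrow> (nat \<Rightarrow> int) set" where
  "fibre n S \<epsilon> = {\<eta> \<in> cube n. \<forall>j\<in>S. \<eta> j = \<epsilon> j}"

definition flip :: "nat \<Rightarrow> (nat \<Rightarrow> int) \<Rightarrow> nat \<Rightarrow> int" where
  "flip i \<epsilon> = \<epsilon>(i := - \<epsilon> i)"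

lemma cube_proj_fibre: "cube_proj n S h \<epsilon> = avg (fibre n S \<epsilon>) h"
  by (simp add: cube_proj_def fibre_def)

lemma finite_cube [simp]: "finite (cube n)"
  by (auto simp: cube_def intro!: finite_PiE)

lemma cube_nonempty [simp]: "cube n \<noteq> {}"
  by (auto simp: cube_def PiE_eq_empty_iff)

lemma cube_coord: "\<epsilon> \<in> cube n \<Longrightarrow> i \<in> {1..n} \<Longrightarrow> \<epsilon> i = 1 \<or> \<epsilon> i = -1"
  by (auto simp: cube_def PiE_iff)

lemma cube_coord_sq: "\<epsilon> \<in> cube n \<Longrightarrow> i \<in> {1..n} \<Longrightarrow> real_of_int (\<epsilon> i) * real_of_int (\<epsilon> i) = 1"
  using cube_coord by fastforce

lemma finite_fibre [simp]: "finite (fibre n S \<epsilon>)"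
  by (simp add: fibre_def)

lemma fibre_self: "\<epsilon> \<in> cube n \<Longrightarrow> \<epsilon> \<in> fibre n S \<epsilon>"
  by (simp add: fibre_def)

lemma fibre_nonempty: "\<epsilon> \<in> cube n \<Longrightarrow> fibre n S \<epsilon> \<noteq> {}"
  using fibre_self by blast

lemma card_fibre_pos: "\<epsilon> \<in> cube n \<Longrightarrow> card (fibre n S \<epsilon>) > 0"
  using fibre_nonempty by (simp add: card_gt_0_iff)

lemma flip_flip [simp]: "flip i (flip i \<epsilon>) = \<epsilon>"
  by (simp add: flip_def)

lemma flip_same [simp]: "flip i \<epsilon> i = - \<epsilon> i"
  by (simp add: flip_def)

lemma flip_other [simp]: "j \<noteq> i \<Longrightarrow> flip i \<epsilon> j = \<epsilon> j"
  by (simp add: flip_def)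

lemma flip_cube: "i \<in> {1..n} \<Longrightarrow> \<epsilon> \<in> cube n \<Longrightarrow> flip i \<epsilon> \<in> cube n"
  by (auto simp: cube_def flip_def PiE_iff extensional_def)

lemma bij_flip_fibre:
  assumes "i \<in> {1..n}" "i \<notin> S"
  shows "bij_betw (flip i) (fibre n S \<epsilon>) (fibre n S \<epsilon>)"
proof (rule bij_betw_byWitness[where f' = "flip i"])
  show "flip i ` fibre n S \<epsilon> \<subseteq> fibre n S \<epsilon>" "flip i ` fibre n S \<epsilon> \<subseteq> fibre n S \<epsilon>"
    using assms by (auto simp: fibre_def intro!: flip_cube) (auto simp: flip_def)
qed auto

lemma bij_flip_cube:
  assumes "i \<in> {1..n}"
  shows "bij_betw (flip i) (cube n) (cube n)"
  using bij_flip_fibre[OF assms, of "{}"] by (simp add: fibre_def)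

lemma cube_proj_cong_point: "(\<And>j. j \<in> S \<Longrightarrow> \<epsilon> j = \<epsilon>' j) \<Longrightarrow> cube_proj n S h \<epsilon> = cube_proj n S h \<epsilon>'"
  by (simp add: cube_proj_def)

lemma cube_proj_flip: "i \<notin> S \<Longrightarrow> cube_proj n S h (flip i \<epsilon>) = cube_proj n S h \<epsilon>"
  by (rule cube_proj_cong_point) (auto simp: flip_def)

lemma cube_proj_empty: "cube_proj n {} h \<epsilon> = avg (cube n) h"
  by (simp add: cube_proj_def)

text \<open>Lying in the same fibre is an equivalence relation, so each point is counted once with total weight
  \<open>1\<close>.\<close>

lemma avg_cube_proj: "avg (cube n) (cube_proj n S h) = avg (cube n) h"
proof -
  have sym: "\<eta> \<in> fibre n S \<epsilon> \<longleftrightarrow> \<epsilon> \<in> fibre n S \<eta>" if "\<epsilon> \<in> cube n" "\<eta> \<in> cube n" for \<epsilon> \<eta>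
    using that by (auto simp: fibre_def)
  have same: "fibre n S \<epsilon> = fibre n S \<eta>" if "\<epsilon> \<in> fibre n S \<eta>" for \<epsilon> \<eta>
    using that by (auto simp: fibre_def)
  have "(\<Sum>\<epsilon>\<in>cube n. cube_proj n S h \<epsilon>)
      = (\<Sum>\<epsilon>\<in>cube n. \<Sum>\<eta>\<in>cube n. if \<eta> \<in> fibre n S \<epsilon> then h \<eta> /\<^sub>R real (card (fibre n S \<epsilon>)) else 0)"
  proof (rule sum.cong[OF refl])
    fix \<epsilon> assume "\<epsilon> \<in> cube n"
    have "{\<eta> \<in> cube n. \<eta> \<in> fibre n S \<epsilon>} = fibre n S \<epsilon>" by (auto simp: fibre_def)
    then show "cube_proj n S h \<epsilon> = (\<Sum>\<eta>\<in>cube n. if \<eta> \<in> fibre n S \<epsilon> then h \<eta> /\<^sub>R real (card (fibre n S \<epsilon>)) else 0)"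
      by (simp add: cube_proj_fibre avg_def scaleR_sum_right sum.inter_filter[symmetric])
  qed
  also have "\<dots> = (\<Sum>\<eta>\<in>cube n. \<Sum>\<epsilon>\<in>cube n. if \<eta> \<in> fibre n S \<epsilon> then h \<eta> /\<^sub>R real (card (fibre n S \<epsilon>)) else 0)"
    by (rule sum.swap)
  also have "\<dots> = (\<Sum>\<eta>\<in>cube n. h \<eta>)"
  proof (rule sum.cong[OF refl])
    fix \<eta> assume \<eta>: "\<eta> \<in> cube n"
    have "(\<Sum>\<epsilon>\<in>cube n. if \<eta> \<in> fibre n S \<epsilon> then h \<eta> /\<^sub>R real (card (fibre n S \<epsilon>)) else 0)
       = (\<Sum>\<epsilon>\<in>cube n. if \<epsilon> \<in> fibre n S \<eta> then h \<eta> /\<^sub>R real (card (fibre n S \<eta>)) else 0)"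
      using sym \<eta> same by (intro sum.cong) auto
    also have "\<dots> = (\<Sum>\<epsilon>\<in>fibre n S \<eta>. h \<eta> /\<^sub>R real (card (fibre n S \<eta>)))"
    proof -
      have "{\<epsilon> \<in> cube n. \<epsilon> \<in> fibre n S \<eta>} = fibre n S \<eta>" by (auto simp: fibre_def)
      then show ?thesis by (simp add: sum.inter_filter[symmetric])
    qed
    also have "\<dots> = h \<eta>"
      using card_fibre_pos[OF \<eta>, of S] by (simp only: sum_constant_scaleR scaleR_scaleR) (simp add: card_gt_0_iff)
    finally show "(\<Sum>\<epsilon>\<in>cube n. if \<eta> \<in> fibre n S \<epsilon> then h \<eta> /\<^sub>R real (card (fibre n S \<epsilon>)) else 0) = h \<eta>" .
  qed
  finally show ?thesis by (simp add: avg_def)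
qed

lemma cube_proj_contraction:
  assumes "p \<ge> 1"
  shows "avg (cube n) (\<lambda>\<epsilon>. norm (cube_proj n S h \<epsilon>) powr p) \<le> avg (cube n) (\<lambda>\<epsilon>. norm (h \<epsilon>) powr p)"
proof -
  have "avg (cube n) (\<lambda>\<epsilon>. norm (cube_proj n S h \<epsilon>) powr p)
      \<le> avg (cube n) (cube_proj n S (\<lambda>\<epsilon>. norm (h \<epsilon>) powr p))"
    unfolding cube_proj_fibre by (intro avg_mono avg_Jensen assms)
  then show ?thesis by (simp add: avg_cube_proj)
qed

lemma cube_norm_powr: "p > 0 \<Longrightarrow> cube_norm p n h powr p = avg (cube n) (\<lambda>\<epsilon>. norm (h \<epsilon>) powr p)"
  using avg_nonneg[of "cube n" "\<lambda>\<epsilon>. norm (h \<epsilon>) powr p"] by (simp add: cube_norm_def powr_powr)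

section \<open>Adding one coordinate\<close>

text \<open>Flipping an unrevealed coordinate is an involution of the fibre.\<close>

lemma cube_proj_coord_zero:
  assumes "i \<in> {1..n}" "i \<notin> S" and inv: "\<And>\<eta>. \<eta> \<in> fibre n S \<epsilon> \<Longrightarrow> g (flip i \<eta>) = - g \<eta>"
  shows "cube_proj n S g \<epsilon> = (0 :: real)"
proof -
  have "cube_proj n S g \<epsilon> = avg (fibre n S \<epsilon>) (\<lambda>\<eta>. g (flip i \<eta>))"
    unfolding cube_proj_fibre by (rule avg_reindex[OF bij_flip_fibre[OF assms(1,2)]])
  also have "\<dots> = avg (fibre n S \<epsilon>) (\<lambda>\<eta>. - g \<eta>)"
    by (intro avg_cong refl inv)
  also have "\<dots> = - cube_proj n S g \<epsilon>" by (simp add: avg_uminus cube_proj_fibre)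
  finally show ?thesis by simp
qed

text \<open>The factor \<open>1 + \<epsilon>\<^sub>i \<eta>\<^sub>i\<close> is twice the indicator of the half of the fibre on which \<open>\<eta>\<^sub>i = \<epsilon>\<^sub>i\<close>. Neither
  conditional expectation on the right depends on \<open>\<epsilon>\<^sub>i\<close>, so this is a symmetric martingale increment.\<close>

lemma cube_proj_insert:
  fixes h :: "(nat \<Rightarrow> int) \<Rightarrow> real"
  assumes i: "i \<in> {1..n}" "i \<notin> S" and \<epsilon>: "\<epsilon> \<in> cube n"
  shows "cube_proj n (insert i S) h \<epsilon>
    = cube_proj n S h \<epsilon> + \<epsilon> i * cube_proj n S (\<lambda>\<eta>. \<eta> i * h \<eta>) \<epsilon>"
proof -
  have half: "(\<Sum>\<eta>\<in>fibre n S \<epsilon>. (1 + real_of_int (\<epsilon> i) * \<eta> i) * g \<eta>) = 2 * (\<Sum>\<eta>\<in>fibre n (insert i S) \<epsilon>. g \<eta>)"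
    for g :: "(nat \<Rightarrow> int) \<Rightarrow> real"
  proof -
    have "(\<Sum>\<eta>\<in>fibre n S \<epsilon>. (1 + real_of_int (\<epsilon> i) * \<eta> i) * g \<eta>)
       = (\<Sum>\<eta>\<in>fibre n (insert i S) \<epsilon>. (1 + real_of_int (\<epsilon> i) * \<eta> i) * g \<eta>)"
    proof (rule sum.mono_neutral_right)
      show "\<forall>\<eta>\<in>fibre n S \<epsilon> - fibre n (insert i S) \<epsilon>. (1 + real_of_int (\<epsilon> i) * \<eta> i) * g \<eta> = 0"
      proof
        fix \<eta> assume a: "\<eta> \<in> fibre n S \<epsilon> - fibre n (insert i S) \<epsilon>"
        then have "\<eta> i \<noteq> \<epsilon> i" "\<eta> \<in> cube n" by (auto simp: fibre_def)
        then show "(1 + real_of_int (\<epsilon> i) * \<eta> i) * g \<eta> = 0"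
          using cube_coord[OF \<epsilon> i(1)] cube_coord[of \<eta> n i] i by auto
      qed
    qed (auto simp: fibre_def)
    also have "\<dots> = (\<Sum>\<eta>\<in>fibre n (insert i S) \<epsilon>. 2 * g \<eta>)"
      using cube_coord_sq[OF \<epsilon> i(1)] by (intro sum.cong) (auto simp: fibre_def)
    finally show ?thesis by (simp add: sum_distrib_left)
  qed
  have "cube_proj n S (\<lambda>\<eta>. real_of_int (\<eta> i)) \<epsilon> = 0"
    by (rule cube_proj_coord_zero[OF i]) simp
  then have "(\<Sum>\<eta>\<in>fibre n S \<epsilon>. real_of_int (\<eta> i)) = 0"
    using fibre_nonempty[OF \<epsilon>, of S] by (simp add: cube_proj_fibre avg_def)
  then have card: "real (card (fibre n S \<epsilon>)) = 2 * real (card (fibre n (insert i S) \<epsilon>))"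
    using half[of "\<lambda>_. 1"] by (simp add: sum.distrib sum_distrib_left[symmetric])
  have "cube_proj n S h \<epsilon> + \<epsilon> i * cube_proj n S (\<lambda>\<eta>. \<eta> i * h \<eta>) \<epsilon>
     = avg (fibre n S \<epsilon>) (\<lambda>\<eta>. (1 + real_of_int (\<epsilon> i) * \<eta> i) * h \<eta>)"
    by (simp only: cube_proj_fibre distrib_right mult_1 mult.assoc avg_add avg_cmult)
  also have "\<dots> = cube_proj n (insert i S) h \<epsilon>"
    unfolding avg_def half card by (simp add: cube_proj_fibre avg_def)
  finally show ?thesis ..
qed

text \<open>The unrevealed coordinate functions are orthonormal on each fibre, and the sum on the left consists of
  squared coefficients with respect to them.\<close>

lemma cube_proj_Bessel:
  fixes h :: "(nat \<Rightarrow> int) \<Rightarrow> real"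
  assumes \<epsilon>: "\<epsilon> \<in> cube n"
  shows "(\<Sum>i\<in>{1..n} - S. (cube_proj n S (\<lambda>\<eta>. \<eta> i * h \<eta>) \<epsilon>)\<^sup>2) \<le> cube_proj n S (\<lambda>\<eta>. (h \<eta>)\<^sup>2) \<epsilon>"
proof -
  define I where "I = {1..n} - S"
  define b where "b i = cube_proj n S (\<lambda>\<eta>. \<eta> i * h \<eta>) \<epsilon>" for i
  define E :: "((nat \<Rightarrow> int) \<Rightarrow> real) \<Rightarrow> real" where "E = avg (fibre n S \<epsilon>)"
  have b: "E (\<lambda>\<eta>. \<eta> i * h \<eta>) = b i" for i by (simp add: b_def E_def cube_proj_fibre)
  have lin: "E (\<lambda>\<eta>. f \<eta> + g \<eta>) = E f + E g" "E (\<lambda>\<eta>. f \<eta> - g \<eta>) = E f - E g"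
    "E (\<lambda>\<eta>. c * f \<eta>) = c * E f" "E (\<lambda>\<eta>. \<Sum>i\<in>J. F i \<eta>) = (\<Sum>i\<in>J. E (F i))"
    for f g c F and J :: "nat set"
    by (simp_all add: E_def avg_add avg_diff avg_cmult avg_sum)
  have orth: "E (\<lambda>\<eta>. real_of_int (\<eta> i) * \<eta> j) = (if i = j then 1 else 0)" if "i \<in> I" "j \<in> I" for i j
  proof (cases "i = j")
    case True
    have "E (\<lambda>\<eta>. real_of_int (\<eta> i) * \<eta> j) = E (\<lambda>_. 1)"
      unfolding E_def using that True by (intro avg_cong) (auto simp: I_def fibre_def intro: cube_coord_sq)
    then show ?thesis using True fibre_nonempty[OF \<epsilon>] by (simp add: E_def avg_const)
  next
    case False
    have "cube_proj n S (\<lambda>\<eta>. real_of_int (\<eta> i) * \<eta> j) \<epsilon> = 0"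
      by (rule cube_proj_coord_zero[of i]) (use that False in \<open>auto simp: I_def\<close>)
    then show ?thesis using False by (simp add: E_def cube_proj_fibre)
  qed
  have "0 \<le> E (\<lambda>\<eta>. (h \<eta> - (\<Sum>i\<in>I. b i * \<eta> i))\<^sup>2)"
    unfolding E_def by (rule avg_nonneg) auto
  also have "(\<lambda>\<eta>. (h \<eta> - (\<Sum>i\<in>I. b i * \<eta> i))\<^sup>2)
      = (\<lambda>\<eta>. (h \<eta>)\<^sup>2 - 2 * (\<Sum>i\<in>I. b i * (\<eta> i * h \<eta>)) + (\<Sum>i\<in>I. \<Sum>j\<in>I. (b i * b j) * (real_of_int (\<eta> i) * \<eta> j)))"
  proof
    fix \<eta> :: "nat \<Rightarrow> int"
    have "(\<Sum>i\<in>I. b i * \<eta> i) * (\<Sum>i\<in>I. b i * \<eta> i)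
        = (\<Sum>i\<in>I. \<Sum>j\<in>I. (b i * b j) * (real_of_int (\<eta> i) * \<eta> j))"
      by (simp add: sum_product mult_ac)
    moreover have "h \<eta> * (\<Sum>i\<in>I. b i * \<eta> i) = (\<Sum>i\<in>I. b i * (\<eta> i * h \<eta>))"
      by (simp add: sum_distrib_left mult_ac)
    ultimately show "(h \<eta> - (\<Sum>i\<in>I. b i * \<eta> i))\<^sup>2 = (h \<eta>)\<^sup>2 - 2 * (\<Sum>i\<in>I. b i * (\<eta> i * h \<eta>))
        + (\<Sum>i\<in>I. \<Sum>j\<in>I. (b i * b j) * (real_of_int (\<eta> i) * \<eta> j))"
      by (simp add: power2_eq_square algebra_simps)
  qed
  also have "E \<dots> = E (\<lambda>\<eta>. (h \<eta>)\<^sup>2) - 2 * (\<Sum>i\<in>I. b i * b i) + (\<Sum>i\<in>I. \<Sum>j\<in>I. (b i * b j) * (if i = j then 1 else 0))"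
    by (simp only: lin b) (simp add: orth)
  also have "(\<Sum>i\<in>I. \<Sum>j\<in>I. (b i * b j) * (if i = j then 1 else 0)) = (\<Sum>i\<in>I. b i * b i)"
    by (intro sum.cong refl) (simp add: I_def if_distrib cong: if_cong)
  finally have "(\<Sum>i\<in>I. (b i)\<^sup>2) \<le> E (\<lambda>\<eta>. (h \<eta>)\<^sup>2)"
    by (simp add: power2_eq_square)
  then show ?thesis
    by (simp only: I_def b_def E_def cube_proj_fibre)
qed

text \<open>On the fibre, \<open>\<eta>\<^sub>i h\<close> may be replaced by its symmetrisation under the flip of \<open>\<eta>\<^sub>i\<close>, which is
  \<open>\<eta>\<^sub>i \<partial>\<^sub>i h / 2\<close>; conditional expectation is a contraction.\<close>

lemma cube_proj_coord_le_diff: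
  fixes h :: "(nat \<Rightarrow> int) \<Rightarrow> real"
  assumes p: "p \<ge> 1" and i: "i \<in> {1..n}" "i \<notin> S"
  shows "avg (cube n) (\<lambda>\<epsilon>. \<bar>cube_proj n S (\<lambda>\<eta>. \<eta> i * h \<eta>) \<epsilon>\<bar> powr p)
    \<le> (1 / 2) powr p * avg (cube n) (\<lambda>\<epsilon>. \<bar>cube_diff i h \<epsilon>\<bar> powr p)"
proof -
  have "cube_proj n S (\<lambda>\<eta>. \<eta> i * h \<eta>) \<epsilon> = cube_proj n S (\<lambda>\<eta>. \<eta> i * (1 / 2 * cube_diff i h \<eta>)) \<epsilon>" for \<epsilon>
  proof -
    have "cube_proj n S (\<lambda>\<eta>. real_of_int (\<eta> i) * (h \<eta> + h (flip i \<eta>)) / 2) \<epsilon> = 0"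
      by (rule cube_proj_coord_zero[OF i]) (simp add: add.commute)
    then have "cube_proj n S (\<lambda>\<eta>. \<eta> i * (1 / 2 * cube_diff i h \<eta>)) \<epsilon>
      = cube_proj n S (\<lambda>\<eta>. real_of_int (\<eta> i) * (h \<eta> + h (flip i \<eta>)) / 2) \<epsilon> +
        cube_proj n S (\<lambda>\<eta>. \<eta> i * (1 / 2 * cube_diff i h \<eta>)) \<epsilon>" by simp
    also have "\<dots> = cube_proj n S (\<lambda>\<eta>. \<eta> i * h \<eta>) \<epsilon>"
      unfolding cube_proj_fibre avg_add[symmetric]
      by (intro avg_cong refl) (simp add: cube_diff_def flip_def field_simps)
    finally show ?thesis ..
  qed
  then have "avg (cube n) (\<lambda>\<epsilon>. \<bar>cube_proj n S (\<lambda>\<eta>. \<eta> i * h \<eta>) \<epsilon>\<bar> powr p)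
     = avg (cube n) (\<lambda>\<epsilon>. norm (cube_proj n S (\<lambda>\<eta>. \<eta> i * (1 / 2 * cube_diff i h \<eta>)) \<epsilon>) powr p)"
    by simp
  also have "\<dots> \<le> avg (cube n) (\<lambda>\<eta>. norm (\<eta> i * (1 / 2 * cube_diff i h \<eta>)) powr p)"
    by (rule cube_proj_contraction[OF p])
  also have "\<dots> = avg (cube n) (\<lambda>\<eta>. (1 / 2) powr p * \<bar>cube_diff i h \<eta>\<bar> powr p)"
  proof (rule avg_cong[OF refl])
    fix \<eta> assume "\<eta> \<in> cube n"
    then have "\<bar>real_of_int (\<eta> i)\<bar> = 1" using cube_coord[OF _ i(1)] by fastforce
    then have "norm (\<eta> i * (1 / 2 * cube_diff i h \<eta>)) = 1 / 2 * \<bar>cube_diff i h \<eta>\<bar>"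
      by (simp add: abs_mult)
    then show "norm (\<eta> i * (1 / 2 * cube_diff i h \<eta>)) powr p = (1 / 2) powr p * \<bar>cube_diff i h \<eta>\<bar> powr p"
      by (simp only: powr_mult)
  qed
  finally show ?thesis by (simp add: avg_cmult)
qed

text \<open>Averaging over the sign of the revealed coordinate turns the moment into the even expression of
  \<open>powr_even_increment\<close>.\<close>

lemma cube_proj_insert_moment:
  fixes h :: "(nat \<Rightarrow> int) \<Rightarrow> real"
  assumes p: "p \<ge> 2" and i: "i \<in> {1..n}" "i \<notin> S"
  shows "avg (cube n) (\<lambda>\<epsilon>. \<bar>cube_proj n (insert i S) h \<epsilon>\<bar> powr p)
    \<le> avg (cube n) (\<lambda>\<epsilon>. \<bar>cube_proj n S h \<epsilon>\<bar> powr p)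
      + p powr (5/2) / 2 * avg (cube n) (\<lambda>\<epsilon>. (cube_proj n S (\<lambda>\<eta>. \<eta> i * h \<eta>) \<epsilon>)\<^sup>2 * ((cube_proj n S h \<epsilon>)\<^sup>2) powr (p / 2 - 1))
      + (3 / 2 * (p / ln p)) powr p * avg (cube n) (\<lambda>\<epsilon>. \<bar>cube_diff i h \<epsilon>\<bar> powr p)"
proof -
  define a where "a = cube_proj n S h"
  define b where "b = cube_proj n S (\<lambda>\<eta>. \<eta> i * h \<eta>)"
  define F where "F \<epsilon> = \<bar>a \<epsilon> + \<epsilon> i * b \<epsilon>\<bar> powr p" for \<epsilon> :: "nat \<Rightarrow> int"
  define c D where "c = p powr (5/2) / 2" and "D = (3 * (p / ln p)) powr p"
  have flip: "F (flip i \<epsilon>) = \<bar>a \<epsilon> - \<epsilon> i * b \<epsilon>\<bar> powr p" for \<epsilon>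
    using i(2) by (simp add: F_def a_def b_def cube_proj_flip)
  have "avg (cube n) (\<lambda>\<epsilon>. \<bar>cube_proj n (insert i S) h \<epsilon>\<bar> powr p) = avg (cube n) F"
    by (intro avg_cong refl) (simp add: F_def a_def b_def cube_proj_insert[OF i])
  also have "\<dots> = 1 / 2 * (avg (cube n) F + avg (cube n) (\<lambda>\<epsilon>. F (flip i \<epsilon>)))"
    using avg_reindex[OF bij_flip_cube[OF i(1)], of F] by simp
  also have "\<dots> = avg (cube n) (\<lambda>\<epsilon>. 1 / 2 * (F \<epsilon> + F (flip i \<epsilon>)))"
    by (simp only: avg_add avg_cmult)
  also have "\<dots> \<le> avg (cube n) (\<lambda>\<epsilon>. \<bar>a \<epsilon>\<bar> powr p + c * ((b \<epsilon>)\<^sup>2 * ((a \<epsilon>)\<^sup>2) powr (p / 2 - 1)) + D * \<bar>b \<epsilon>\<bar> powr p)"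
  proof (rule avg_mono)
    fix \<epsilon> assume \<epsilon>: "\<epsilon> \<in> cube n"
    have "\<bar>real_of_int (\<epsilon> i)\<bar> = 1" "(real_of_int (\<epsilon> i))\<^sup>2 = 1" using cube_coord[OF \<epsilon> i(1)] by fastforce+
    then show "1 / 2 * (F \<epsilon> + F (flip i \<epsilon>))
       \<le> \<bar>a \<epsilon>\<bar> powr p + c * ((b \<epsilon>)\<^sup>2 * ((a \<epsilon>)\<^sup>2) powr (p / 2 - 1)) + D * \<bar>b \<epsilon>\<bar> powr p"
      unfolding flip unfolding F_def c_def D_def using powr_even_increment[OF p, of "a \<epsilon>" "\<epsilon> i * b \<epsilon>"]
      by (simp add: abs_mult power_mult_distrib)
  qed
  also have "\<dots> = avg (cube n) (\<lambda>\<epsilon>. \<bar>a \<epsilon>\<bar> powr p) + c * avg (cube n) (\<lambda>\<epsilon>. (b \<epsilon>)\<^sup>2 * ((a \<epsilon>)\<^sup>2) powr (p / 2 - 1))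
      + D * avg (cube n) (\<lambda>\<epsilon>. \<bar>b \<epsilon>\<bar> powr p)"
    by (simp only: avg_add avg_cmult)
  also have "D * avg (cube n) (\<lambda>\<epsilon>. \<bar>b \<epsilon>\<bar> powr p)
      \<le> D * ((1 / 2) powr p * avg (cube n) (\<lambda>\<epsilon>. \<bar>cube_diff i h \<epsilon>\<bar> powr p))"
    unfolding b_def using p i by (intro mult_left_mono cube_proj_coord_le_diff) (auto simp: D_def)
  also have "\<dots> = (3 / 2 * (p / ln p)) powr p * avg (cube n) (\<lambda>\<epsilon>. \<bar>cube_diff i h \<epsilon>\<bar> powr p)"
  proof -
    have "D * (1 / 2) powr p = (3 / 2 * (p / ln p)) powr p"
      unfolding D_def powr_mult[symmetric] by (simp add: mult.commute)
    then show ?thesis by (simp only: mult.assoc[symmetric])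
  qed
  finally show ?thesis unfolding a_def b_def c_def by simp
qed

section \<open>Random subsets of fixed size\<close>

definition ksets :: "nat \<Rightarrow> nat \<Rightarrow> nat set set" where
  "ksets n k = {S. S \<subseteq> {1..n} \<and> card S = k}"

lemma finite_ksets [simp]: "finite (ksets n k)"
  by (simp add: ksets_def)

lemma card_ksets: "card (ksets n k) = n choose k"
  by (simp add: ksets_def n_subsets)

lemma ksets_nonempty: "k \<le> n \<Longrightarrow> ksets n k \<noteq> {}"
  using card_ksets[of n k] zero_less_binomial[of k n] by (metis card.empty less_irrefl)

lemma avg_ksets: "(\<Sum>S | S \<subseteq> {1..n} \<and> card S = k. F S) / real (n choose k) = avg (ksets n k) F"
  unfolding avg_def card_ksets by (simp add: ksets_def divide_inverse mult.commute)

lemma ratio_cancel: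
  fixes a b c d P Q :: real
  assumes "a * P = b * Q" "a * c = b * d" "c > 0" "d > 0" "b > 0" "a > 0"
  shows "P / c = Q / d"
proof -
  have "a * (P * d) = a * (Q * c)"
    using assms(1,2) by (metis mult.assoc mult.commute)
  then show ?thesis using assms by (simp add: frac_eq_eq)
qed

text \<open>A uniform \<open>(j + 1)\<close>-set arises from a uniform \<open>j\<close>-set by adding a uniform new element: both sides count
  pairs of a set and one of its elements.\<close>

lemma avg_ksets_Suc:
  fixes F :: "nat set \<Rightarrow> real"
  assumes "j < n"
  shows "avg (ksets n (Suc j)) F = avg (ksets n j) (\<lambda>S. avg ({1..n} - S) (\<lambda>i. F (insert i S)))"
proof -
  have fin: "finite S" if "S \<in> ksets n k" for S k
    using that finite_subset[of S "{1..n}"] by (auto simp: ksets_def)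
  have "real (Suc j) * (\<Sum>T\<in>ksets n (Suc j). F T) = (\<Sum>T\<in>ksets n (Suc j). \<Sum>i\<in>T. F T)"
    by (simp add: ksets_def sum_distrib_left)
  also have "\<dots> = (\<Sum>(T, i)\<in>Sigma (ksets n (Suc j)) (\<lambda>T. T). F T)"
    using fin by (intro sum.Sigma) auto
  also have "\<dots> = (\<Sum>(S, i)\<in>Sigma (ksets n j) (\<lambda>S. {1..n} - S). F (insert i S))"
  proof (rule sum.reindex_bij_witness[where i = "\<lambda>(S, i). (insert i S, i)" and j = "\<lambda>(T, i). (T - {i}, i)"])
    show "(\<lambda>(T, i). (T - {i}, i)) a \<in> Sigma (ksets n j) (\<lambda>S. {1..n} - S)"
      if "a \<in> Sigma (ksets n (Suc j)) (\<lambda>T. T)" for a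
      using that fin[of "fst a" "Suc j"] by (cases a) (auto simp: ksets_def)
    show "(\<lambda>(S, i). (insert i S, i)) b \<in> Sigma (ksets n (Suc j)) (\<lambda>T. T)"
      if "b \<in> Sigma (ksets n j) (\<lambda>S. {1..n} - S)" for b
      using that fin[of "fst b" j] by (cases b) (auto simp: ksets_def)
  qed (auto simp: insert_absorb)
  also have "\<dots> = (\<Sum>S\<in>ksets n j. \<Sum>i\<in>{1..n} - S. F (insert i S))"
    by (intro sum.Sigma[symmetric]) auto
  also have "\<dots> = (\<Sum>S\<in>ksets n j. real (n - j) * avg ({1..n} - S) (\<lambda>i. F (insert i S)))"
  proof (rule sum.cong[OF refl])
    fix S assume S: "S \<in> ksets n j"
    then have "card ({1..n} - S) = n - j"
      using fin[OF S] by (simp add: ksets_def card_Diff_subset)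
    then show "(\<Sum>i\<in>{1..n} - S. F (insert i S)) = real (n - j) * avg ({1..n} - S) (\<lambda>i. F (insert i S))"
      using assms by (simp add: avg_def)
  qed
  finally have "real (Suc j) * (\<Sum>T\<in>ksets n (Suc j). F T)
     = real (n - j) * (\<Sum>S\<in>ksets n j. avg ({1..n} - S) (\<lambda>i. F (insert i S)))"
    by (simp add: sum_distrib_left)
  moreover have "real (Suc j) * real (n choose Suc j) = real (n - j) * real (n choose j)"
  proof -
    have "Suc j * (n choose Suc j) = (n - j) * (n choose j)"
      by (simp only: binomial_absorption binomial_absorb_comp)
    then show ?thesis by (simp only: of_nat_mult[symmetric])
  qed
  moreover have "real (n choose Suc j) > 0" "real (n choose j) > 0"
    using assms by (simp_all add: zero_less_binomial)
  moreover have "real (n - j) > 0" "real (Suc j) > 0" using assms by auto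
  ultimately have "(\<Sum>T\<in>ksets n (Suc j). F T) / real (n choose Suc j)
     = (\<Sum>S\<in>ksets n j. avg ({1..n} - S) (\<lambda>i. F (insert i S))) / real (n choose j)"
    by (rule ratio_cancel)
  then show ?thesis
    unfolding avg_def[of "ksets n j"] avg_def[of "ksets n (Suc j)"] card_ksets
    by (simp add: divide_inverse mult.commute)
qed

section \<open>The linear inequality for real functions\<close>

text \<open>The two sides of the linear inequality before the exponent \<open>1 / p\<close> is applied.\<close>

definition linear_lhs :: "real \<Rightarrow> nat \<Rightarrow> nat \<Rightarrow> ((nat \<Rightarrow> int) \<Rightarrow> 'k::real_normed_field) \<Rightarrow> real" where
  "linear_lhs p n k h = avg (ksets n k) (\<lambda>S. avg (cube n) (\<lambda>\<epsilon>. norm (cube_proj n S h \<epsilon>) powr p))"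

definition linear_rhs :: "real \<Rightarrow> nat \<Rightarrow> nat \<Rightarrow> ((nat \<Rightarrow> int) \<Rightarrow> 'k::real_normed_field) \<Rightarrow> real" where
  "linear_rhs p n k h =
     real k / real n * (\<Sum>j=1..n. avg (cube n) (\<lambda>\<epsilon>. norm (cube_diff j h \<epsilon>) powr p))
     + (real k / real n) powr (p / 2) * avg (cube n) (\<lambda>\<epsilon>. norm (h \<epsilon>) powr p)"

lemma linear_lhs_nonneg: "linear_lhs p n k h \<ge> 0"
  unfolding linear_lhs_def by (intro avg_nonneg) auto

lemma linear_rhs_nonneg: "linear_rhs p n k h \<ge> 0"
  unfolding linear_rhs_def by (intro add_nonneg_nonneg mult_nonneg_nonneg sum_nonneg avg_nonneg) auto

lemma powr_base_le_iff:
  fixes x y a :: real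
  assumes "a > 0" "x \<ge> 0" "y \<ge> 0"
  shows "x powr a \<le> y powr a \<longleftrightarrow> x \<le> y"
  using assms powr_mono2[of a x y] powr_less_mono2[of a y x] by linarith

text \<open>Taking \<open>p\<close>-th powers removes the outer exponents \<open>1 / p\<close> and the extended reals.\<close>

lemma linear_X_ineq_real_iff:
  fixes T :: "'k::real_normed_field itself"
  assumes p: "p \<ge> 2" and K: "K \<ge> 0"
  shows "linear_X_ineq T p (ennreal K) \<longleftrightarrow>
    (\<forall>n. \<forall>k\<in>{1..n}. \<forall>h :: (nat \<Rightarrow> int) \<Rightarrow> 'k. avg (cube n) h = 0 \<longrightarrow>
      linear_lhs p n k h \<le> K powr p * linear_rhs p n k h)"
proof -
  have key: "ennreal (L powr (1 / p)) \<le> ennreal K * ennreal (R powr (1 / p)) \<longleftrightarrow> L \<le> K powr p * R"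
    if "L \<ge> 0" "R \<ge> 0" for L R :: real
  proof -
    have e: "K * R powr (1 / p) = (K powr p * R) powr (1 / p)"
      using K p that by (simp add: powr_mult powr_powr)
    have "ennreal (L powr (1 / p)) \<le> ennreal K * ennreal (R powr (1 / p)) \<longleftrightarrow> L powr (1 / p) \<le> (K powr p * R) powr (1 / p)"
      using K by (simp add: e flip: ennreal_mult)
    also have "\<dots> \<longleftrightarrow> L \<le> K powr p * R"
      using p that K by (intro powr_base_le_iff) auto
    finally show ?thesis .
  qed
  have p0: "p > 0" using p by simp
  show ?thesis
    unfolding linear_X_ineq_def avg_ksets cube_norm_powr[OF p0]
      linear_lhs_def[symmetric] linear_rhs_def[symmetric]
    by (simp only: key[OF linear_lhs_nonneg linear_rhs_nonneg])
qed

lemma avg_le_twice_sum: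
  fixes g :: "nat \<Rightarrow> real"
  assumes "finite I" "real n \<le> 2 * real (card I)" "n > 0" "\<And>i. i \<in> I \<Longrightarrow> g i \<ge> 0"
  shows "avg I g \<le> 2 / real n * (\<Sum>i\<in>I. g i)"
proof -
  have c: "real (card I) > 0" using assms by linarith
  have "inverse (real (card I)) \<le> 2 / real n"
    using assms c by (simp add: field_simps)
  then have "inverse (real (card I)) * (\<Sum>i\<in>I. g i) \<le> 2 / real n * (\<Sum>i\<in>I. g i)"
    using assms by (intro mult_right_mono sum_nonneg) auto
  then show ?thesis by (simp add: avg_def)
qed

text \<open>One step of the martingale. As long as at most half of the coordinates are revealed, each of the
  others is chosen with probability at most \<open>2 / n\<close>. Bessel's inequality bounds the sum of the squared
  increments by the conditional second moment of \<open>h\<close>, and Hoelder's inequality for the joint average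
  over the set and the point separates it from the current value.\<close>

lemma linear_lhs_Suc:
  fixes h :: "(nat \<Rightarrow> int) \<Rightarrow> real"
  assumes p: "p \<ge> 2" and j: "2 * j \<le> n" "j < n" and X: "X > 0" and Y: "Y > 0"
    and AX: "linear_lhs p n j h \<le> X powr (p / 2)"
    and HY: "avg (cube n) (\<lambda>\<epsilon>. \<bar>h \<epsilon>\<bar> powr p) \<le> Y powr (p / 2)"
  shows "linear_lhs p n (Suc j) h \<le> linear_lhs p n j h
    + p powr (5/2) / real n * Y * X powr (p / 2 - 1)
    + 2 / real n * ((3 / 2 * (p / ln p)) powr p * (\<Sum>i=1..n. avg (cube n) (\<lambda>\<epsilon>. \<bar>cube_diff i h \<epsilon>\<bar> powr p)))"
proof -
  define c D where "c = p powr (5/2) / 2" and "D = (3 / 2 * (p / ln p)) powr p"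
  define F where "F S = avg (cube n) (\<lambda>\<epsilon>. \<bar>cube_proj n S h \<epsilon>\<bar> powr p)" for S
  define d where "d i = avg (cube n) (\<lambda>\<epsilon>. \<bar>cube_diff i h \<epsilon>\<bar> powr p)" for i
  define G where "G S = avg (cube n) (\<lambda>\<epsilon>. cube_proj n S (\<lambda>\<eta>. (h \<eta>)\<^sup>2) \<epsilon> * ((cube_proj n S h \<epsilon>)\<^sup>2) powr (p / 2 - 1))" for S
  have n: "n > 0" and c: "c \<ge> 0" and D: "D \<ge> 0" and d: "d i \<ge> 0" for i
    using j by (auto simp: c_def D_def d_def intro!: avg_nonneg)
  have step: "avg ({1..n} - S) (\<lambda>i. F (insert i S)) \<le> F S + (2 * c / real n * G S + 2 / real n * (D * (\<Sum>i=1..n. d i)))"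
    if S: "S \<in> ksets n j" for S
  proof -
    define I where "I = {1..n} - S"
    have "finite S" "S \<subseteq> {1..n}" "card S = j"
      using S finite_subset[of S "{1..n}"] by (auto simp: ksets_def)
    then have cI: "card I = n - j" by (simp add: I_def card_Diff_subset)
    have I: "finite I" "I \<noteq> {}" using cI j card_gt_0_iff[of I] by auto
    define g where "g i = avg (cube n) (\<lambda>\<epsilon>. (cube_proj n S (\<lambda>\<eta>. \<eta> i * h \<eta>) \<epsilon>)\<^sup>2 * ((cube_proj n S h \<epsilon>)\<^sup>2) powr (p / 2 - 1))" for i
    have g: "g i \<ge> 0" for i by (auto simp: g_def intro!: avg_nonneg)
    have "avg I (\<lambda>i. F (insert i S)) \<le> avg I (\<lambda>i. F S + (c * g i + D * d i))"
      using cube_proj_insert_moment[OF p, of _ n S h]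
      by (intro avg_mono) (simp add: F_def c_def D_def d_def g_def I_def add.assoc)
    also have "\<dots> = F S + avg I (\<lambda>i. c * g i + D * d i)"
      using I by (simp add: avg_add avg_const)
    also have "avg I (\<lambda>i. c * g i + D * d i) \<le> 2 / real n * (\<Sum>i\<in>I. c * g i + D * d i)"
      using I cI j n c D d g by (intro avg_le_twice_sum) auto
    also have "(\<Sum>i\<in>I. c * g i + D * d i) = c * (\<Sum>i\<in>I. g i) + D * (\<Sum>i\<in>I. d i)"
      by (simp add: sum.distrib sum_distrib_left)
    finally have le: "avg I (\<lambda>i. F (insert i S)) \<le> F S + 2 / real n * (c * (\<Sum>i\<in>I. g i) + D * (\<Sum>i\<in>I. d i))"
      by simp
    have "(\<Sum>i\<in>I. g i) = avg (cube n) (\<lambda>\<epsilon>. (\<Sum>i\<in>I. (cube_proj n S (\<lambda>\<eta>. \<eta> i * h \<eta>) \<epsilon>)\<^sup>2) * ((cube_proj n S h \<epsilon>)\<^sup>2) powr (p / 2 - 1))"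
      by (simp only: g_def avg_sum sum_distrib_right)
    also have "\<dots> \<le> G S"
      unfolding G_def I_def by (intro avg_mono mult_right_mono cube_proj_Bessel) auto
    finally have "(\<Sum>i\<in>I. g i) \<le> G S" .
    moreover have "(\<Sum>i\<in>I. d i) \<le> (\<Sum>i=1..n. d i)"
      using d by (intro sum_mono2) (auto simp: I_def)
    ultimately have "2 / real n * (c * (\<Sum>i\<in>I. g i) + D * (\<Sum>i\<in>I. d i))
        \<le> 2 / real n * (c * G S + D * (\<Sum>i=1..n. d i))"
      using c D by (intro mult_left_mono add_mono) auto
    also have "\<dots> = 2 * c / real n * G S + 2 / real n * (D * (\<Sum>i=1..n. d i))"
      by (simp add: algebra_simps)
    finally show ?thesis using le by (simp add: I_def)
  qed
  have A: "linear_lhs p n k h = avg (ksets n k) F" for k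
    by (simp add: linear_lhs_def F_def[abs_def])
  have GXY: "avg (ksets n j) G \<le> Y * X powr (p / 2 - 1)"
  proof -
    have pow: "(t\<^sup>2) powr (p / 2) = \<bar>t\<bar> powr p" for t :: real
      using powr_powr[of "\<bar>t\<bar>" 2 "p / 2"] by (simp add: powr_numeral)
    define w where "w = (\<lambda>(S, \<epsilon>). cube_proj n S (\<lambda>\<eta>. (h \<eta>)\<^sup>2) \<epsilon>)"
    define u where "u = (\<lambda>(S, \<epsilon>). (cube_proj n S h \<epsilon>)\<^sup>2)"
    have wf: "(\<lambda>x. w x powr (p / 2)) = (\<lambda>(S, \<epsilon>). cube_proj n S (\<lambda>\<eta>. (h \<eta>)\<^sup>2) \<epsilon> powr (p / 2))"
      and uf: "(\<lambda>x. u x powr (p / 2)) = (\<lambda>(S, \<epsilon>). \<bar>cube_proj n S h \<epsilon>\<bar> powr p)"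
      and wuf: "(\<lambda>x. w x * u x powr (p / 2 - 1)) = (\<lambda>(S, \<epsilon>). cube_proj n S (\<lambda>\<eta>. (h \<eta>)\<^sup>2) \<epsilon> * ((cube_proj n S h \<epsilon>)\<^sup>2) powr (p / 2 - 1))"
      by (auto simp: w_def u_def pow)
    have w0: "cube_proj n S (\<lambda>\<eta>. (h \<eta>)\<^sup>2) \<epsilon> \<ge> 0" for S \<epsilon>
      unfolding cube_proj_fibre by (rule avg_nonneg) auto
    have "avg (ksets n j \<times> cube n) (\<lambda>x. w x powr (p / 2)) \<le> avg (ksets n j) (\<lambda>S. Y powr (p / 2))"
      unfolding wf avg_Times
    proof (rule avg_mono)
      fix S
      have "avg (cube n) (\<lambda>\<epsilon>. cube_proj n S (\<lambda>\<eta>. (h \<eta>)\<^sup>2) \<epsilon> powr (p / 2))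
          \<le> avg (cube n) (\<lambda>\<epsilon>. norm ((h \<epsilon>)\<^sup>2) powr (p / 2))"
        using cube_proj_contraction[of "p / 2" n S "\<lambda>\<eta>. (h \<eta>)\<^sup>2"] p w0 by simp
      also have "\<dots> \<le> Y powr (p / 2)" using HY by (simp add: pow)
      finally show "avg (cube n) (\<lambda>\<epsilon>. cube_proj n S (\<lambda>\<eta>. (h \<eta>)\<^sup>2) \<epsilon> powr (p / 2)) \<le> Y powr (p / 2)" .
    qed
    also have "\<dots> = Y powr (p / 2)"
      using j ksets_nonempty[of j n] by (intro avg_const) auto
    finally have "avg (ksets n j \<times> cube n) (\<lambda>x. w x * u x powr (p / 2 - 1)) \<le> Y * X powr (p / 2 - 1)"
      using p X Y AX w0
      by (intro avg_Hoelder) (auto simp: uf avg_Times linear_lhs_def, auto simp: w_def u_def)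
    then show ?thesis
      unfolding wuf avg_Times G_def .
  qed
  have "linear_lhs p n (Suc j) h = avg (ksets n j) (\<lambda>S. avg ({1..n} - S) (\<lambda>i. F (insert i S)))"
    unfolding A by (rule avg_ksets_Suc[OF j(2)])
  also have "\<dots> \<le> avg (ksets n j) (\<lambda>S. F S + (2 * c / real n * G S + 2 / real n * (D * (\<Sum>i=1..n. d i))))"
    by (intro avg_mono step)
  also have "\<dots> = linear_lhs p n j h + (2 * c / real n * avg (ksets n j) G + 2 / real n * (D * (\<Sum>i=1..n. d i)))"
    unfolding avg_add avg_cmult A using j ksets_nonempty[of j n] by (simp add: avg_const)
  also have "\<dots> \<le> linear_lhs p n j h + (2 * c / real n * (Y * X powr (p / 2 - 1)) + 2 / real n * (D * (\<Sum>i=1..n. d i)))"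
    using c D d GXY by (intro add_mono mult_left_mono) (auto intro!: sum_nonneg)
  finally show ?thesis by (simp add: c_def D_def d_def add.assoc mult.assoc)
qed

lemma linear_lhs_le_moment:
  assumes "p \<ge> 1" "k \<le> n"
  shows "linear_lhs p n k h \<le> avg (cube n) (\<lambda>\<epsilon>. norm (h \<epsilon>) powr p)"
proof -
  have "linear_lhs p n k h \<le> avg (ksets n k) (\<lambda>S. avg (cube n) (\<lambda>\<epsilon>. norm (h \<epsilon>) powr p))"
    unfolding linear_lhs_def by (intro avg_mono cube_proj_contraction assms)
  also have "\<dots> = avg (cube n) (\<lambda>\<epsilon>. norm (h \<epsilon>) powr p)"
    using ksets_nonempty[OF assms(2)] by (intro avg_const) auto
  finally show ?thesis .
qed

lemma ln_sq_le_sqrt: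
  assumes "p \<ge> (1::real)"
  shows "(ln p)\<^sup>2 \<le> 16 * p powr (1/2)"
proof -
  have "ln p \<le> 4 * p powr (1/4)" using ln_powr_bound[of p "1/4"] assms by simp
  then have "(ln p)\<^sup>2 \<le> (4 * p powr (1/4))\<^sup>2" using assms by (intro power_mono) auto
  also have "\<dots> = 16 * p powr (1/2)" using powr_add[of p "1/4" "1/4"] by (simp add: power2_eq_square)
  finally show ?thesis .
qed

text \<open>The left side is the constant in front of the variance term: \<open>p powr (3 / 4)\<close> per unit of norm, which
  is of smaller order than \<open>p / ln p\<close>.\<close>

lemma diffusive_factor_le:
  assumes p: "p \<ge> (2::real)"
  shows "(8 * p powr (3/2)) powr (p / 2) \<le> (12 * (p / ln p)) powr p"
proof -
  have l: "ln p > 0" using p by simp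
  have "8 * p powr (3/2) * (ln p)\<^sup>2 \<le> 8 * p powr (3/2) * (16 * p powr (1/2))"
    using ln_sq_le_sqrt[of p] p by (intro mult_left_mono) auto
  also have "\<dots> = 128 * p\<^sup>2" using p by (simp add: mult.assoc flip: powr_add powr_numeral)
  also have "\<dots> \<le> 144 * p\<^sup>2" by simp
  finally have "8 * p powr (3/2) \<le> (12 * (p / ln p))\<^sup>2"
    using l by (simp add: power_mult_distrib power_divide pos_le_divide_eq)
  then have "(8 * p powr (3/2)) powr (p / 2) \<le> ((12 * (p / ln p))\<^sup>2) powr (p / 2)"
    using p by (intro powr_mono2) auto
  also have "\<dots> = (12 * (p / ln p)) powr p"
    using powr_powr[of "12 * (p / ln p)" 2 "p / 2"] l p by (simp add: powr_numeral)
  finally show ?thesis .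
qed

text \<open>The recursion, which runs on the scale of the squared norm, is started from the sum \<open>a\<close> of the two
  quantities that the final bound allows: the accumulated jumps and the variance
  \<open>(k / n) \<parallel>h\<parallel>\<^sub>p\<^sup>2\<close>. The second summand makes \<open>a\<close> positive even if all jumps vanish. The
  mean of \<open>h\<close> is the value of the martingale at time \<open>0\<close>.\<close>

lemma linear_bound_half:
  fixes h :: "(nat \<Rightarrow> int) \<Rightarrow> real"
  assumes p: "p \<ge> 2" and k: "2 * k \<le> n" "k \<ge> 1" and h0: "avg (cube n) h = 0"
    and Hpos: "avg (cube n) (\<lambda>\<epsilon>. \<bar>h \<epsilon>\<bar> powr p) > 0"
  shows "linear_lhs p n k h \<le> (12 * (p / ln p)) powr p * linear_rhs p n k h"
proof -
  define H where "H = avg (cube n) (\<lambda>\<epsilon>. \<bar>h \<epsilon>\<bar> powr p)"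
  define B where "B = (\<Sum>i=1..n. avg (cube n) (\<lambda>\<epsilon>. \<bar>cube_diff i h \<epsilon>\<bar> powr p))"
  define D where "D = (3 / 2 * (p / ln p)) powr p"
  define q where "q = p / 2"
  define Y where "Y = H powr (1 / q)"
  define b where "b = 2 / real n * (D * B)"
  define \<beta> where "\<beta> = p powr (5/2) / real n * Y"
  define r where "r = real k / real n"
  define a where "a = (real k * b) powr (1 / q) + r * Y"
  have q: "q \<ge> 1" using p by (simp add: q_def)
  have n: "n > 0" "real n > 0" using k by auto
  have H: "H > 0" using Hpos by (simp add: H_def)
  have B: "B \<ge> 0" by (auto simp: B_def intro!: sum_nonneg avg_nonneg)
  have b: "b \<ge> 0" using B by (simp add: b_def D_def)
  have Y: "Y > 0" "Y powr q = H" using H q by (auto simp: Y_def powr_powr)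
  have r: "r > 0" using k n by (simp add: r_def)
  have \<beta>: "\<beta> \<ge> 0" using Y by (simp add: \<beta>_def)
  have a: "a > 0" using r Y by (auto simp: a_def intro!: add_nonneg_pos)
  have kb: "real k * b \<le> a powr q"
  proof -
    have "real k * b = ((real k * b) powr (1 / q)) powr q" using q b by (simp add: powr_powr)
    also have "\<dots> \<le> a powr q" using q r Y b by (intro powr_mono2) (auto simp: a_def)
    finally show ?thesis .
  qed
  have "linear_lhs p n k h \<le> (a + real k * ((\<beta> + b * a powr (1 - q)) / q)) powr q"
  proof (rule powr_recursion_bound[where A = "\<lambda>j. linear_lhs p n j h" and k = k, OF q a \<beta> b])
    have "ksets n 0 = {{}}" using finite_subset by (fastforce simp: ksets_def)
    then show "linear_lhs p n 0 h \<le> a powr q"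
      by (simp add: linear_lhs_def avg_def[of "{{}}"] cube_proj_empty h0 avg_const)
  next
    fix j X
    assume "j < k" "X > 0" "linear_lhs p n j h \<le> X powr q"
    then show "linear_lhs p n (Suc j) h \<le> linear_lhs p n j h + \<beta> * X powr (q - 1) + b"
      using linear_lhs_Suc[OF p, of j n X Y h] k Y
      by (simp add: \<beta>_def b_def D_def B_def q_def H_def)
  qed simp
  also have "\<dots> \<le> (2 * (real k * b) powr (1 / q) + 4 * p powr (3/2) * r * Y) powr q"
  proof (rule powr_mono2)
    have "real k * b * a powr (1 - q) \<le> a powr q * a powr (1 - q)"
      using kb by (intro mult_right_mono) auto
    also have "\<dots> = a" using a by (simp flip: powr_add)
    finally have "real k * b * a powr (1 - q) / q \<le> a / 1"
      using q a by (intro frac_le) auto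
    moreover have "real k * \<beta> / q = 2 * p powr (3/2) * r * Y"
    proof -
      have "p powr (5/2) = p powr (3/2) * p" using p powr_add[of p "3/2" 1] by simp
      then show ?thesis using p n by (simp add: \<beta>_def q_def r_def field_simps)
    qed
    ultimately have "a + real k * ((\<beta> + b * a powr (1 - q)) / q) \<le> 2 * a + 2 * p powr (3/2) * r * Y"
      by (simp add: algebra_simps add_divide_distrib)
    also have "2 * a + 2 * p powr (3/2) * r * Y = 2 * (real k * b) powr (1 / q) + 2 * (1 * (r * Y)) + 2 * p powr (3/2) * r * Y"
      by (simp add: a_def algebra_simps)
    also have "1 * (r * Y) \<le> p powr (3/2) * (r * Y)"
      using p r Y by (intro mult_right_mono ge_one_powr_ge_zero) auto
    finally show "a + real k * ((\<beta> + b * a powr (1 - q)) / q) \<le> 2 * (real k * b) powr (1 / q) + 4 * p powr (3/2) * r * Y"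
      by (simp add: algebra_simps)
    show "0 \<le> a + real k * ((\<beta> + b * a powr (1 - q)) / q)" using a \<beta> b q by auto
  qed (use q in auto)
  also have "\<dots> \<le> 2 powr q * ((2 * (real k * b) powr (1 / q)) powr q + (4 * p powr (3/2) * r * Y) powr q)"
    using r Y q by (intro powr_add_le) auto
  also have "(2 * (real k * b) powr (1 / q)) powr q = 2 powr q * (real k * b)"
    using q b by (simp add: powr_mult powr_powr)
  also have "(4 * p powr (3/2) * r * Y) powr q = (4 * p powr (3/2)) powr q * (r powr q * H)"
    unfolding powr_mult[of _ Y] powr_mult[of _ r] Y by simp
  also have "2 powr q * (2 powr q * (real k * b) + (4 * p powr (3/2)) powr q * (r powr q * H))
      = 2 powr p * (real k * b) + (8 * p powr (3/2)) powr q * (r powr q * H)"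
  proof -
    have "2 powr q * 2 powr q = 2 powr p" by (simp add: q_def flip: powr_add)
    moreover have "2 powr q * (4 * p powr (3/2)) powr q = (8 * p powr (3/2)) powr q"
      by (simp flip: powr_mult)
    ultimately show ?thesis by (simp only: distrib_left mult.assoc[symmetric])
  qed
  also have "2 powr p * (real k * b) \<le> (12 * (p / ln p)) powr p * (r * B)"
  proof -
    have "2 powr p * (real k * b) = 2 * (2 powr p * D) * (r * B)"
      using n by (simp add: b_def r_def)
    also have "\<dots> \<le> 2 powr p * (2 powr p * D) * (r * B)"
      using p r B powr_mono[of 1 p 2] by (intro mult_right_mono) (auto simp: D_def)
    also have "2 powr p * (2 powr p * D) = (2 * (2 * (3 / 2 * (p / ln p)))) powr p"
      by (simp only: D_def powr_mult)
    also have "\<dots> \<le> (12 * (p / ln p)) powr p"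
      using p div_ln_ge_one[OF p] by (intro powr_mono2) linarith+
    finally show ?thesis using r B by (simp add: mult_right_mono)
  qed
  also have "(8 * p powr (3/2)) powr q \<le> (12 * (p / ln p)) powr p"
    unfolding q_def by (rule diffusive_factor_le[OF p])
  finally have "linear_lhs p n k h \<le> (12 * (p / ln p)) powr p * (r * B)
      + (12 * (p / ln p)) powr p * (r powr q * H)"
    using H by (simp add: mult_right_mono)
  also have "\<dots> = (12 * (p / ln p)) powr p * linear_rhs p n k h"
    by (simp add: linear_rhs_def r_def B_def H_def q_def distrib_left)
  finally show ?thesis .
qed

text \<open>If more than half of the coordinates are revealed, contractivity of conditional expectations suffices,
  because \<open>(k / n) powr (p / 2)\<close> is then at least \<open>2 powr (- p / 2)\<close>.\<close>

theorem linear_bound_real: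
  fixes h :: "(nat \<Rightarrow> int) \<Rightarrow> real"
  assumes p: "p \<ge> 2" and k: "k \<in> {1..n}" and h0: "avg (cube n) h = 0"
  shows "linear_lhs p n k h \<le> (12 * (p / ln p)) powr p * linear_rhs p n k h"
proof -
  define H where "H = avg (cube n) (\<lambda>\<epsilon>. \<bar>h \<epsilon>\<bar> powr p)"
  have H: "H \<ge> 0" by (auto simp: H_def intro!: avg_nonneg)
  have le: "linear_lhs p n k h \<le> H"
    using linear_lhs_le_moment[of p k n h] p k by (simp add: H_def)
  consider "2 * k \<le> n" "H > 0" | "H = 0" | "n < 2 * k" using H by linarith
  then show ?thesis
  proof cases
    case 1
    then show ?thesis using linear_bound_half[OF p] k h0 by (simp add: H_def)
  next
    case 2
    have "0 \<le> (12 * (p / ln p)) powr p * linear_rhs p n k h"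
      by (intro mult_nonneg_nonneg linear_rhs_nonneg) auto
    then show ?thesis using 2 le by linarith
  next
    case 3
    define r where "r = real k / real n"
    have n: "n > 0" using k by simp
    have "12 * 1 \<le> 12 * (p / ln p)"
      using div_ln_ge_one[OF p] by (intro mult_left_mono) auto
    then have "2 \<le> (12 * (p / ln p))\<^sup>2"
      using power_mono[of 12 "12 * (p / ln p)" 2] by simp
    then have "2 * r \<le> (12 * (p / ln p))\<^sup>2 * r"
      using n by (intro mult_right_mono) (auto simp: r_def)
    moreover have "1 \<le> 2 * r" using 3 n by (simp add: r_def field_simps)
    ultimately have "1 \<le> (12 * (p / ln p))\<^sup>2 * r" by linarith
    then have "1 \<le> ((12 * (p / ln p))\<^sup>2 * r) powr (p / 2)"
      using p by (intro ge_one_powr_ge_zero) auto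
    also have "\<dots> = (12 * (p / ln p)) powr p * r powr (p / 2)"
      using powr_powr[of "12 * (p / ln p)" 2 "p / 2"] p by (simp add: powr_mult powr_numeral)
    finally have "1 * H \<le> (12 * (p / ln p)) powr p * r powr (p / 2) * H"
      using H by (intro mult_right_mono) auto
    also have "\<dots> \<le> (12 * (p / ln p)) powr p * linear_rhs p n k h"
    proof -
      have "0 \<le> r * (\<Sum>j=1..n. avg (cube n) (\<lambda>\<epsilon>. \<bar>cube_diff j h \<epsilon>\<bar> powr p))"
        by (intro mult_nonneg_nonneg sum_nonneg avg_nonneg) (auto simp: r_def)
      then have "r powr (p / 2) * H \<le> linear_rhs p n k h"
        by (simp add: linear_rhs_def r_def H_def)
      then show ?thesis unfolding mult.assoc by (intro mult_left_mono) auto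
    qed
    finally show ?thesis using le by linarith
  qed
qed

section \<open>The linear inequality for complex functions\<close>

lemma Re_avg: "Re (avg A f) = avg A (\<lambda>x. Re (f x))"
  by (simp add: avg_def)

lemma Im_avg: "Im (avg A f) = avg A (\<lambda>x. Im (f x))"
  by (simp add: avg_def)

lemma complex_powr_le:
  "p \<ge> 0 \<Longrightarrow> norm (z :: complex) powr p \<le> 2 powr p * (\<bar>Re z\<bar> powr p + \<bar>Im z\<bar> powr p)"
  by (rule order_trans[OF powr_mono2[OF _ norm_ge_zero cmod_le] powr_add_le]) auto

lemma linear_lhs_complex_le:
  fixes h :: "(nat \<Rightarrow> int) \<Rightarrow> complex"
  assumes "p \<ge> 0"
  shows "linear_lhs p n k h \<le> 2 powr p * (linear_lhs p n k (\<lambda>\<epsilon>. Re (h \<epsilon>)) + linear_lhs p n k (\<lambda>\<epsilon>. Im (h \<epsilon>)))"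
proof -
  have "linear_lhs p n k h \<le> avg (ksets n k) (\<lambda>S. avg (cube n) (\<lambda>\<epsilon>.
     2 powr p * (\<bar>Re (cube_proj n S h \<epsilon>)\<bar> powr p + \<bar>Im (cube_proj n S h \<epsilon>)\<bar> powr p)))"
    unfolding linear_lhs_def by (intro avg_mono complex_powr_le assms)
  also have "\<dots> = 2 powr p * (linear_lhs p n k (\<lambda>\<epsilon>. Re (h \<epsilon>)) + linear_lhs p n k (\<lambda>\<epsilon>. Im (h \<epsilon>)))"
    by (simp add: avg_cmult avg_add linear_lhs_def cube_proj_def Re_avg Im_avg)
  finally show ?thesis .
qed

text \<open>Used for the real and the imaginary part, which are additive and contractive.\<close>

lemma linear_rhs_mono:
  assumes "p \<ge> 0" "\<And>x. norm (T x) \<le> norm x" "\<And>x y. T (x - y) = T x - T y"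
  shows "linear_rhs p n k (\<lambda>\<epsilon>. T (h \<epsilon>)) \<le> linear_rhs p n k h"
  unfolding linear_rhs_def cube_diff_def assms(3)[symmetric] using assms(1,2)
  by (intro add_mono mult_left_mono sum_mono avg_mono powr_mono2) auto

theorem linear_bound_complex:
  fixes h :: "(nat \<Rightarrow> int) \<Rightarrow> complex"
  assumes p: "p \<ge> 2" and k: "k \<in> {1..n}" and h0: "avg (cube n) h = 0"
  shows "linear_lhs p n k h \<le> (48 * (p / ln p)) powr p * linear_rhs p n k h"
proof -
  let ?K = "(12 * (p / ln p)) powr p"
  have z: "avg (cube n) (\<lambda>\<epsilon>. Re (h \<epsilon>)) = 0" "avg (cube n) (\<lambda>\<epsilon>. Im (h \<epsilon>)) = 0"
    using h0 by (simp_all flip: Re_avg Im_avg)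
  have m: "linear_rhs p n k (\<lambda>\<epsilon>. Re (h \<epsilon>)) \<le> linear_rhs p n k h"
    "linear_rhs p n k (\<lambda>\<epsilon>. Im (h \<epsilon>)) \<le> linear_rhs p n k h"
    using p by (intro linear_rhs_mono; simp add: abs_Re_le_cmod abs_Im_le_cmod)+
  have "linear_lhs p n k h \<le> 2 powr p * (?K * linear_rhs p n k h + ?K * linear_rhs p n k h)"
    using p m linear_bound_real[OF p k z(1)] linear_bound_real[OF p k z(2)]
    by (intro order_trans[OF linear_lhs_complex_le] mult_left_mono add_mono)
       (auto intro: order_trans mult_left_mono)
  also have "\<dots> = 2 * (2 powr p * (?K * linear_rhs p n k h))" by simp
  also have "\<dots> \<le> 2 powr p * (2 powr p * (?K * linear_rhs p n k h))"
    using p powr_mono[of 1 p 2] by (intro mult_right_mono mult_nonneg_nonneg linear_rhs_nonneg) auto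
  also have "\<dots> = (2 * (2 * (12 * (p / ln p)))) powr p * linear_rhs p n k h"
    by (simp only: powr_mult mult.assoc)
  finally show ?thesis by simp
qed

theorem linear_X_ineq_upper:
  assumes p: "p \<ge> 2"
  shows "linear_X_ineq TYPE(real) p (ennreal (48 * (p / ln p)))"
    and "linear_X_ineq TYPE(complex) p (ennreal (48 * (p / ln p)))"
proof -
  have nn: "p / ln p \<ge> 0" using p by simp
  have le: "(12 * (p / ln p)) powr p \<le> (48 * (p / ln p)) powr p"
    using p nn by (intro powr_mono2 mult_right_mono) auto
  show "linear_X_ineq TYPE(real) p (ennreal (48 * (p / ln p)))"
    unfolding linear_X_ineq_real_iff[OF p mult_nonneg_nonneg[OF zero_le_numeral nn]]
    by (intro allI ballI impI order_trans[OF linear_bound_real[OF p]] mult_right_mono[OF le] linear_rhs_nonneg)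
  show "linear_X_ineq TYPE(complex) p (ennreal (48 * (p / ln p)))"
    unfolding linear_X_ineq_real_iff[OF p mult_nonneg_nonneg[OF zero_le_numeral nn]]
    by (intro allI ballI impI linear_bound_complex[OF p])
qed

section \<open>Translations of the torus\<close>

lemma torus_carrier: "m \<ge> 1 \<Longrightarrow> carrier (torus m n) = {1..n} \<rightarrow>\<^sub>E {0..<int (8 * m)}"
  by (simp add: torus_def carrier_integer_mod_group)

lemma torus_nonempty: "m \<ge> 1 \<Longrightarrow> carrier (torus m n) \<noteq> {}"
  by (simp add: torus_carrier PiE_eq_empty_iff)

lemma torus_shift_eq: "torus_shift m n x v = (\<lambda>i\<in>{1..n}. (x i + v i) mod int (8 * m))"
  by (auto simp: torus_def torus_vec_def mod_add_right_eq)

lemma torus_shift_shift: "torus_shift m n (torus_shift m n x v) w = torus_shift m n x (\<lambda>i. v i + w i)"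
  unfolding torus_shift_eq by (auto simp: mod_add_left_eq add.assoc)

lemma torus_shift_cong: "(\<And>i. i \<in> {1..n} \<Longrightarrow> v i = w i) \<Longrightarrow> torus_shift m n x v = torus_shift m n x w"
  unfolding torus_shift_eq by auto

lemma torus_shift_zero:
  assumes "m \<ge> 1" "x \<in> carrier (torus m n)"
  shows "torus_shift m n x (\<lambda>_. 0) = x"
proof
  show "torus_shift m n x (\<lambda>_. 0) i = x i" for i
    unfolding torus_shift_eq using assms by (cases "i \<in> {1..n}") (auto simp: torus_carrier PiE_iff extensional_def)
qed

lemma bij_torus_shift:
  assumes "m \<ge> 1"
  shows "bij_betw (\<lambda>x. torus_shift m n x v) (carrier (torus m n)) (carrier (torus m n))"
  by (rule bij_betw_byWitness[where f' = "\<lambda>x. torus_shift m n x (\<lambda>i. - v i)"])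
     (auto simp: torus_shift_shift torus_shift_zero[OF assms] intro!: torus_shift_closed assms)

lemma avg_torus_shift:
  "m \<ge> 1 \<Longrightarrow> avg (carrier (torus m n)) (\<lambda>x. F (torus_shift m n x v)) = avg (carrier (torus m n)) F"
  by (rule avg_reindex[OF bij_torus_shift, symmetric])

text \<open>The modulus of continuity of \<open>f\<close> in \<open>L\<^sub>p\<close> of the torus, raised to the power \<open>p\<close>. Both sides of the metric
  inequality are averages of it.\<close>

definition translation_mod ::
    "real \<Rightarrow> nat \<Rightarrow> nat \<Rightarrow> ((nat \<Rightarrow> int) \<Rightarrow> 'k::real_normed_field) \<Rightarrow> (nat \<Rightarrow> int) \<Rightarrow> real" where
  "translation_mod p m n f v =
     avg (carrier (torus m n)) (\<lambda>x. norm (f (torus_shift m n x v) - f x) powr p)"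

lemma translation_mod_nonneg: "translation_mod p m n f v \<ge> 0"
  unfolding translation_mod_def by (intro avg_nonneg) auto

lemma translation_mod_cong:
  "(\<And>i. i \<in> {1..n} \<Longrightarrow> v i = w i) \<Longrightarrow> translation_mod p m n f v = translation_mod p m n f w"
  unfolding translation_mod_def using torus_shift_cong[of n v w m] by simp

lemma translation_mod_diff:
  assumes "m \<ge> 1"
  shows "avg (carrier (torus m n)) (\<lambda>x. norm (f (torus_shift m n x v) - f (torus_shift m n x w)) powr p)
    = translation_mod p m n f (\<lambda>i. v i - w i)"
proof -
  have "torus_shift m n x v = torus_shift m n (torus_shift m n x w) (\<lambda>i. v i - w i)" for x
    unfolding torus_shift_shift by simp
  then have "avg (carrier (torus m n)) (\<lambda>x. norm (f (torus_shift m n x v) - f (torus_shift m n x w)) powr p)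
    = avg (carrier (torus m n)) (\<lambda>x. norm (f (torus_shift m n (torus_shift m n x w) (\<lambda>i. v i - w i))
        - f (torus_shift m n x w)) powr p)"
    by simp
  also have "\<dots> = translation_mod p m n f (\<lambda>i. v i - w i)"
    unfolding translation_mod_def by (rule avg_torus_shift[OF assms])
  finally show ?thesis .
qed

lemma translation_mod_uminus:
  assumes "m \<ge> 1"
  shows "translation_mod p m n f (\<lambda>i. - v i) = translation_mod p m n f v"
proof -
  have "translation_mod p m n f v =
      avg (carrier (torus m n)) (\<lambda>x. norm (f (torus_shift m n x v) - f (torus_shift m n x (\<lambda>_. 0))) powr p)"
    unfolding translation_mod_def by (intro avg_cong refl) (simp only: torus_shift_zero[OF assms])
  also have "\<dots> = avg (carrier (torus m n)) (\<lambda>x. norm (f (torus_shift m n x (\<lambda>_. 0)) - f (torus_shift m n x v)) powr p)"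
    by (simp only: norm_minus_commute)
  also have "\<dots> = translation_mod p m n f (\<lambda>i. - v i)"
    unfolding translation_mod_diff[OF assms] by simp
  finally show ?thesis ..
qed

text \<open>The path from \<open>x\<close> to \<open>x + N v\<close> has \<open>N\<close> steps, each of which contributes equally because the uniform
  measure on the torus is invariant under translations.\<close>

lemma translation_mod_multiple:
  assumes m: "m \<ge> 1" and p: "p \<ge> 1"
  shows "translation_mod p m n f (\<lambda>i. int N * v i) \<le> real N powr p * translation_mod p m n f v"
proof (cases "N = 0")
  case True
  have "translation_mod p m n f (\<lambda>i. int N * v i) = avg (carrier (torus m n)) (\<lambda>x. 0)"
    unfolding translation_mod_def True
    by (intro avg_cong refl) (use torus_shift_zero[OF m] in simp)
  then show ?thesis using True by (simp add: avg_def)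
next
  case False
  define y where "y t x = torus_shift m n x (\<lambda>i. int t * v i)" for t x
  have y: "y (Suc t) x = torus_shift m n (y t x) v" for t x
    unfolding y_def torus_shift_shift by (rule torus_shift_cong) (simp add: algebra_simps)
  have "norm (f (y N x) - f x) powr p \<le> real N powr p * avg {..<N} (\<lambda>t. norm (f (torus_shift m n (y t x) v) - f (y t x)) powr p)"
    if "x \<in> carrier (torus m n)" for x
  proof -
    have "f (y N x) - f x = (\<Sum>t<N. f (y (Suc t) x) - f (y t x))"
    proof -
      have "(\<Sum>t<N. f (y (Suc t) x) - f (y t x)) = f (y N x) - f (y 0 x)"
        by (rule sum_lessThan_telescope)
      moreover have "y 0 x = x" using torus_shift_zero[OF m that] by (simp add: y_def)
      ultimately show ?thesis by simp
    qed
    also have "\<dots> = real N *\<^sub>R avg {..<N} (\<lambda>t. f (y (Suc t) x) - f (y t x))"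
      using False by (simp add: avg_def)
    finally have "norm (f (y N x) - f x) powr p = real N powr p * norm (avg {..<N} (\<lambda>t. f (y (Suc t) x) - f (y t x))) powr p"
      by (simp add: powr_mult)
    also have "\<dots> \<le> real N powr p * avg {..<N} (\<lambda>t. norm (f (y (Suc t) x) - f (y t x)) powr p)"
      by (intro mult_left_mono avg_Jensen p) auto
    finally show ?thesis by (simp only: y)
  qed
  then have "translation_mod p m n f (\<lambda>i. int N * v i)
      \<le> avg (carrier (torus m n)) (\<lambda>x. real N powr p * avg {..<N} (\<lambda>t. norm (f (torus_shift m n (y t x) v) - f (y t x)) powr p))"
    unfolding translation_mod_def by (intro avg_mono) (simp add: y_def)
  also have "\<dots> = real N powr p * avg {..<N} (\<lambda>t. avg (carrier (torus m n)) (\<lambda>x. norm (f (torus_shift m n (y t x) v) - f (y t x)) powr p))"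
    by (simp only: avg_cmult avg_swap[of "carrier (torus m n)"])
  also have "(\<lambda>t. avg (carrier (torus m n)) (\<lambda>x. norm (f (torus_shift m n (y t x) v) - f (y t x)) powr p)) = (\<lambda>t. translation_mod p m n f v)"
    unfolding y_def using avg_torus_shift[OF m, where F = "\<lambda>z. norm (f (torus_shift m n z v) - f z) powr p"]
    by (simp add: translation_mod_def)
  finally show ?thesis using False by (simp add: avg_const lessThan_empty_iff)
qed

lemma two_le_powr: "p \<ge> 1 \<Longrightarrow> 2 \<le> (2::real) powr p"
  using powr_mono[of 1 p 2] by simp

lemma translation_mod_sum:
  assumes m: "m \<ge> 1" and p: "p \<ge> 1"
  shows "translation_mod p m n (\<lambda>x. f x + g x) v
    \<le> 2 powr p * (translation_mod p m n f v + translation_mod p m n g v)"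
proof -
  have "translation_mod p m n (\<lambda>x. f x + g x) v \<le> avg (carrier (torus m n)) (\<lambda>x.
     2 powr p * (norm (f (torus_shift m n x v) - f x) powr p + norm (g (torus_shift m n x v) - g x) powr p))"
    unfolding translation_mod_def
  proof (rule avg_mono)
    fix x
    have "f (torus_shift m n x v) + g (torus_shift m n x v) - (f x + g x)
        = (f (torus_shift m n x v) - f x) + (g (torus_shift m n x v) - g x)" by simp
    then show "norm (f (torus_shift m n x v) + g (torus_shift m n x v) - (f x + g x)) powr p
      \<le> 2 powr p * (norm (f (torus_shift m n x v) - f x) powr p + norm (g (torus_shift m n x v) - g x) powr p)"
      using p by (simp only:) (rule powr_norm_add_le, simp)
  qed
  then show ?thesis by (simp add: avg_cmult avg_add translation_mod_def)
qed

lemma translation_mod_le_norm: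
  assumes m: "m \<ge> 1" and p: "p \<ge> 1"
  shows "translation_mod p m n f v \<le> 4 powr p * avg (carrier (torus m n)) (\<lambda>x. norm (f x) powr p)"
proof -
  let ?A = "avg (carrier (torus m n)) (\<lambda>x. norm (f x) powr p)"
  have "translation_mod p m n f v \<le> avg (carrier (torus m n)) (\<lambda>x.
      2 powr p * (norm (f (torus_shift m n x v)) powr p + norm (f x) powr p))"
    unfolding translation_mod_def using p by (intro avg_mono powr_norm_diff_le) auto
  also have "\<dots> = 2 powr p * (2 * ?A)"
    using avg_torus_shift[OF m, where F = "\<lambda>x. norm (f x) powr p"] by (simp add: avg_cmult avg_add)
  also have "\<dots> \<le> 2 powr p * (2 powr p * ?A)"
    using two_le_powr[OF p] by (intro mult_left_mono mult_right_mono avg_nonneg) auto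
  also have "\<dots> = 4 powr p * ?A" by (simp add: mult.assoc[symmetric] flip: powr_mult)
  finally show ?thesis .
qed

section \<open>Conditional expectations by resampling\<close>

definition merge :: "nat set \<Rightarrow> (nat \<Rightarrow> int) \<Rightarrow> (nat \<Rightarrow> int) \<Rightarrow> nat \<Rightarrow> int" where
  "merge S \<epsilon> \<eta> = (\<lambda>j. if j \<in> S then \<epsilon> j else \<eta> j)"

lemma cube_iff: "\<epsilon> \<in> cube n \<longleftrightarrow> (\<forall>i. if i \<in> {1..n} then \<epsilon> i = 1 \<or> \<epsilon> i = -1 else \<epsilon> i = undefined)"
  by (auto simp: cube_def PiE_iff extensional_def)

lemma card_fibre_cong:
  assumes "\<epsilon> \<in> cube n" "\<epsilon>' \<in> cube n"
  shows "card (fibre n S \<epsilon>) = card (fibre n S \<epsilon>')"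
proof -
  have "card (fibre n S \<epsilon>) = (\<Prod>i\<in>{1..n}. if i \<in> S then 1 else 2)" if "\<epsilon> \<in> cube n" for \<epsilon>
  proof -
    have "fibre n S \<epsilon> = (\<Pi>\<^sub>E i\<in>{1..n}. if i \<in> S then {\<epsilon> i} else {-1, 1})"
    proof (rule Set.set_eqI)
      fix \<eta>
      have undef: "\<epsilon> j = undefined" if "j \<notin> {1..n}" for j
        using \<open>\<epsilon> \<in> cube n\<close> that unfolding cube_iff by meson
      show "\<eta> \<in> fibre n S \<epsilon> \<longleftrightarrow> \<eta> \<in> (\<Pi>\<^sub>E i\<in>{1..n}. if i \<in> S then {\<epsilon> i} else {-1, 1})"
        using that undef unfolding fibre_def PiE_iff extensional_def mem_Collect_eq cube_iff
        by (smt (verit) insert_iff singletonD)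
    qed
    then have "card (fibre n S \<epsilon>) = (\<Prod>i\<in>{1..n}. card (if i \<in> S then {\<epsilon> i} else {-1, 1}))"
      by (simp add: card_PiE)
    also have "\<dots> = (\<Prod>i\<in>{1..n}. if i \<in> S then 1 else 2)"
      by (intro prod.cong) auto
    finally show ?thesis .
  qed
  then show ?thesis using assms by simp
qed

lemma merge_cube:
  assumes "\<epsilon> \<in> cube n" "\<eta> \<in> cube n"
  shows "merge S \<epsilon> \<eta> \<in> cube n"
  unfolding cube_iff
proof
  show "if i \<in> {1..n} then merge S \<epsilon> \<eta> i = 1 \<or> merge S \<epsilon> \<eta> i = -1 else merge S \<epsilon> \<eta> i = undefined" for i
    using assms(1)[unfolded cube_iff, rule_format, of i] assms(2)[unfolded cube_iff, rule_format, of i]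
    by (auto simp: merge_def)
qed

text \<open>Conditional expectation as resampling of the coordinates outside \<open>S\<close>. In contrast to the average over the
  fibre, the range of the average does not depend on \<open>\<epsilon>\<close>, so conditional expectations at different
  points can be compared term by term.\<close>

lemma cube_proj_merge:
  assumes \<epsilon>: "\<epsilon> \<in> cube n"
  shows "cube_proj n S h \<epsilon> = avg (cube n) (\<lambda>\<eta>. h (merge S \<epsilon> \<eta>))"
proof -
  define c where "c = card (fibre n (- S) \<epsilon>)"
  have c: "c > 0" unfolding c_def by (rule card_fibre_pos[OF \<epsilon>])
  have img: "merge S \<epsilon> ` cube n = fibre n S \<epsilon>"
  proof
    show "merge S \<epsilon> ` cube n \<subseteq> fibre n S \<epsilon>"
      using merge_cube[OF \<epsilon>] by (auto simp: fibre_def) (simp add: merge_def)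
    show "fibre n S \<epsilon> \<subseteq> merge S \<epsilon> ` cube n"
    proof
      fix \<eta> assume "\<eta> \<in> fibre n S \<epsilon>"
      then have "\<eta> \<in> cube n" "merge S \<epsilon> \<eta> = \<eta>" by (auto simp: fibre_def merge_def)
      then show "\<eta> \<in> merge S \<epsilon> ` cube n" by (metis imageI)
    qed
  qed
  have pre: "card {\<eta> \<in> cube n. merge S \<epsilon> \<eta> = \<zeta>} = c" if "\<zeta> \<in> fibre n S \<epsilon>" for \<zeta>
  proof -
    have "{\<eta> \<in> cube n. merge S \<epsilon> \<eta> = \<zeta>} = fibre n (- S) \<zeta>"
      using that by (auto simp: fibre_def merge_def fun_eq_iff)
    moreover have "\<zeta> \<in> cube n" using that by (simp add: fibre_def)
    ultimately show ?thesis unfolding c_def using card_fibre_cong \<epsilon> by metis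
  qed
  have sum: "(\<Sum>\<eta>\<in>cube n. g (merge S \<epsilon> \<eta>)) = real c *\<^sub>R (\<Sum>\<zeta>\<in>fibre n S \<epsilon>. g \<zeta>)" for g :: "(nat \<Rightarrow> int) \<Rightarrow> 'c::real_vector"
  proof -
    have "(\<Sum>\<eta>\<in>cube n. g (merge S \<epsilon> \<eta>)) = (\<Sum>\<zeta>\<in>fibre n S \<epsilon>. \<Sum>\<eta> | \<eta> \<in> cube n \<and> merge S \<epsilon> \<eta> = \<zeta>. g (merge S \<epsilon> \<eta>))"
      using img by (intro sum.group[symmetric]) auto
    also have "\<dots> = (\<Sum>\<zeta>\<in>fibre n S \<epsilon>. real c *\<^sub>R g \<zeta>)"
      using pre by (intro sum.cong refl) (simp add: sum_constant_scaleR)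
    finally show ?thesis by (simp add: scaleR_sum_right)
  qed
  have card: "real (card (cube n)) = real c * real (card (fibre n S \<epsilon>))"
    using sum[of "\<lambda>_. 1 :: real"] by simp
  show ?thesis
    unfolding cube_proj_fibre avg_def sum card using c by simp
qed

lemma uminus_cube: "\<epsilon> \<in> cube n \<Longrightarrow> (\<lambda>i\<in>{1..n}. - \<epsilon> i) \<in> cube n"
  by (auto simp: cube_def PiE_iff)

lemma bij_uminus_cube: "bij_betw (\<lambda>\<epsilon>. \<lambda>i\<in>{1..n}. - \<epsilon> i) (cube n) (cube n)"
proof (rule bij_betw_byWitness[where f' = "\<lambda>\<epsilon>. \<lambda>i\<in>{1..n}. - \<epsilon> i"])
  have "(\<lambda>i\<in>{1..n}. - (\<lambda>i\<in>{1..n}. - \<epsilon> i) i) = \<epsilon>" if "\<epsilon> \<in> cube n" for \<epsilon>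
    using that by (intro ext) (auto simp: cube_def PiE_iff extensional_def)
  then show "\<forall>\<epsilon>\<in>cube n. (\<lambda>i\<in>{1..n}. - (\<lambda>i\<in>{1..n}. - \<epsilon> i) i) = \<epsilon>" "\<forall>\<epsilon>\<in>cube n. (\<lambda>i\<in>{1..n}. - (\<lambda>i\<in>{1..n}. - \<epsilon> i) i) = \<epsilon>"
    by blast+
qed (use uminus_cube in blast)+

section \<open>From the linear to the metric inequality\<close>

locale torus_reduction =
  fixes p K :: real and n k m :: nat and f :: "(nat \<Rightarrow> int) \<Rightarrow> 'k::real_normed_field"
  assumes p: "p \<ge> 2" and K: "K \<ge> 0" and k: "k \<in> {1..n}" and m: "real m \<ge> sqrt (real n / real k)"
    and linear: "\<And>h :: (nat \<Rightarrow> int) \<Rightarrow> 'k. avg (cube n) h = 0 \<Longrightarrow> linear_lhs p n k h \<le> K powr p * linear_rhs p n k h"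
begin

lemma m_pos: "m \<ge> 1"
proof -
  have "sqrt (real n / real k) > 0" using k by simp
  then show ?thesis using m by linarith
qed

text \<open>The lower bound on \<open>m\<close> says that the diagonal term, multiplied by \<open>m powr p\<close>, has a coefficient of at
  least one, so that errors of the size of the diagonal average are harmless.\<close>

lemma scale_large: "1 \<le> real m powr p * (real k / real n) powr (p / 2)"
proof -
  have "real n / real k \<le> (real m)\<^sup>2"
    using m by (metis real_sqrt_le_iff real_sqrt_le_iff' real_sqrt_unique sqrt_le_D of_nat_0_le_iff)
  then have "1 \<le> (real m)\<^sup>2 * (real k / real n)"
    using k by (simp add: field_simps)
  then have "1 \<le> ((real m)\<^sup>2 * (real k / real n)) powr (p / 2)"
    using p by (intro ge_one_powr_ge_zero) auto
  also have "\<dots> = real m powr p * (real k / real n) powr (p / 2)"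
    unfolding powr_mult using powr_powr[of "real m" 2 "p / 2"] m_pos by (simp add: powr_numeral)
  finally show ?thesis .
qed

abbreviation "T \<equiv> carrier (torus m n)"
abbreviation "shift \<equiv> torus_shift m n"
abbreviation "tmod \<equiv> translation_mod p m n"

definition smooth :: "(nat \<Rightarrow> int) \<Rightarrow> 'k" where
  "smooth x = avg (cube n) (\<lambda>\<delta>. f (shift x \<delta>))"

text \<open>The function on the cube to which the linear inequality is applied: the values of \<open>f\<close> around \<open>x\<close>,
  centred.\<close>

definition local_fun :: "(nat \<Rightarrow> int) \<Rightarrow> (nat \<Rightarrow> int) \<Rightarrow> 'k" where
  "local_fun x \<epsilon> = f (shift x \<epsilon>) - smooth x"

definition edge_sum :: real where
  "edge_sum = (\<Sum>j=1..n. tmod f (unit_vec j))"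

definition diag_avg :: real where
  "diag_avg = avg (cube n) (tmod f)"

definition bound :: real where
  "bound = real k / real n * edge_sum + (real k / real n) powr (p / 2) * diag_avg"

lemma edge_sum_nonneg: "edge_sum \<ge> 0"
  unfolding edge_sum_def by (intro sum_nonneg translation_mod_nonneg)

lemma diag_avg_nonneg: "diag_avg \<ge> 0"
  unfolding diag_avg_def by (intro avg_nonneg translation_mod_nonneg)

lemma bound_nonneg: "bound \<ge> 0"
  unfolding bound_def using edge_sum_nonneg diag_avg_nonneg by simp

lemma torus_rhs_bound: "torus_rhs p n k m (\<lambda>x y. norm (f x - f y) powr p) = bound"
proof -
  have "avg (T \<times> cube n) (\<lambda>(x, \<epsilon>). norm (f (shift x \<epsilon>) - f x) powr p) = diag_avg"
    unfolding avg_Times diag_avg_def translation_mod_def[abs_def] by (rule avg_swap)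
  then show ?thesis
    unfolding torus_rhs_def bound_def edge_sum_def translation_mod_def by simp
qed

lemma torus_lhs_tmod:
  "torus_lhs n k m (\<lambda>x y. norm (f x - f y) powr p)
    = avg (ksets n k) (\<lambda>S. avg (cube n) (\<lambda>\<epsilon>. tmod f (\<lambda>i. int (4 * m) * restrict_vec S \<epsilon> i)))"
  unfolding torus_lhs_def avg_ksets avg_Times translation_mod_def
  by (intro avg_cong refl avg_swap)

lemma avg_local_fun: "avg (cube n) (local_fun x) = 0"
  unfolding local_fun_def by (simp add: avg_diff avg_const smooth_def)

lemma smooth_close: "avg T (\<lambda>x. norm (f x - smooth x) powr p) \<le> diag_avg"
proof -
  have "avg T (\<lambda>x. norm (f x - smooth x) powr p) \<le> avg T (\<lambda>x. avg (cube n) (\<lambda>\<delta>. norm (f (shift x \<delta>) - f x) powr p))"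
  proof (rule avg_mono)
    fix x
    have "norm (f x - smooth x) = norm (avg (cube n) (\<lambda>\<delta>. f (shift x \<delta>) - f x))"
      by (simp add: avg_diff avg_const smooth_def norm_minus_commute)
    then show "norm (f x - smooth x) powr p \<le> avg (cube n) (\<lambda>\<delta>. norm (f (shift x \<delta>) - f x) powr p)"
      using p by (simp only:) (rule avg_Jensen, simp)
  qed
  also have "\<dots> = diag_avg"
    unfolding diag_avg_def translation_mod_def[abs_def] by (rule avg_swap)
  finally show ?thesis .
qed

text \<open>Flipping \<open>\<epsilon>\<^sub>j\<close> moves the point \<open>x + \<epsilon>\<close> by two edges in direction \<open>j\<close>.\<close>

lemma avg_cube_diff_local_fun:
  assumes j: "j \<in> {1..n}"
  shows "avg T (\<lambda>x. avg (cube n) (\<lambda>\<epsilon>. norm (cube_diff j (local_fun x) \<epsilon>) powr p)) \<le> 4 powr p * tmod f (unit_vec j)"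
proof -
  have "avg T (\<lambda>x. avg (cube n) (\<lambda>\<epsilon>. norm (cube_diff j (local_fun x) \<epsilon>) powr p))
     = avg (cube n) (\<lambda>\<epsilon>. avg T (\<lambda>x. norm (f (shift x \<epsilon>) - f (shift x (flip j \<epsilon>))) powr p))"
    by (subst avg_swap) (simp only: cube_diff_def local_fun_def flip_def diff_diff_eq2 diff_add_cancel)
  also have "\<dots> = avg (cube n) (\<lambda>\<epsilon>. tmod f (\<lambda>i. \<epsilon> i - flip j \<epsilon> i))"
    unfolding translation_mod_diff[OF m_pos] ..
  also have "\<dots> \<le> avg (cube n) (\<lambda>\<epsilon>. 4 powr p * tmod f (unit_vec j))"
  proof (rule avg_mono)
    fix \<epsilon> assume "\<epsilon> \<in> cube n"
    then consider "\<epsilon> j = 1" | "\<epsilon> j = -1" using cube_coord j by blast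
    then have "tmod f (\<lambda>i. \<epsilon> i - flip j \<epsilon> i) = tmod f (\<lambda>i. int 2 * unit_vec j i)"
    proof cases
      case 1
      then show ?thesis by (intro translation_mod_cong) (auto simp: flip_def unit_vec_def)
    next
      case 2
      then have "tmod f (\<lambda>i. \<epsilon> i - flip j \<epsilon> i) = tmod f (\<lambda>i. - (int 2 * unit_vec j i))"
        by (intro translation_mod_cong) (auto simp: flip_def unit_vec_def)
      then show ?thesis by (simp only: translation_mod_uminus[OF m_pos])
    qed
    also have "\<dots> \<le> real 2 powr p * tmod f (unit_vec j)"
      using p by (intro translation_mod_multiple m_pos) auto
    also have "\<dots> \<le> 4 powr p * tmod f (unit_vec j)"
      using p by (intro mult_right_mono powr_mono2 translation_mod_nonneg) auto
    finally show "tmod f (\<lambda>i. \<epsilon> i - flip j \<epsilon> i) \<le> 4 powr p * tmod f (unit_vec j)" .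
  qed
  finally show ?thesis by (simp add: avg_const)
qed

lemma avg_norm_local_fun:
  "avg T (\<lambda>x. avg (cube n) (\<lambda>\<epsilon>. norm (local_fun x \<epsilon>) powr p)) \<le> 4 powr p * diag_avg"
proof -
  have "avg T (\<lambda>x. avg (cube n) (\<lambda>\<epsilon>. norm (local_fun x \<epsilon>) powr p))
     \<le> avg T (\<lambda>x. avg (cube n) (\<lambda>\<epsilon>. 2 powr p * (norm (f (shift x \<epsilon>) - f x) powr p + norm (f x - smooth x) powr p)))"
  proof (intro avg_mono)
    fix x \<epsilon>
    have "local_fun x \<epsilon> = (f (shift x \<epsilon>) - f x) + (f x - smooth x)" by (simp add: local_fun_def)
    then show "norm (local_fun x \<epsilon>) powr p \<le> 2 powr p * (norm (f (shift x \<epsilon>) - f x) powr p + norm (f x - smooth x) powr p)"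
      using p by (simp only:) (rule powr_norm_add_le, simp)
  qed
  also have "\<dots> = 2 powr p * (diag_avg + avg T (\<lambda>x. norm (f x - smooth x) powr p))"
    unfolding diag_avg_def translation_mod_def[abs_def]
    by (simp add: avg_cmult avg_add avg_const avg_swap[of "cube n"])
  also have "\<dots> \<le> 2 powr p * (2 powr p * diag_avg)"
  proof (rule mult_left_mono)
    have "2 * diag_avg \<le> 2 powr p * diag_avg"
      using p two_le_powr[of p] diag_avg_nonneg by (intro mult_right_mono) auto
    then show "diag_avg + avg T (\<lambda>x. norm (f x - smooth x) powr p) \<le> 2 powr p * diag_avg"
      using smooth_close by linarith
  qed simp
  also have "\<dots> = 4 powr p * diag_avg" by (simp add: mult.assoc[symmetric] flip: powr_mult)
  finally show ?thesis .
qed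

lemma avg_linear_lhs_local_fun:
  "avg T (\<lambda>x. linear_lhs p n k (local_fun x)) \<le> (4 * K) powr p * bound"
proof -
  have "avg T (\<lambda>x. linear_lhs p n k (local_fun x)) \<le> avg T (\<lambda>x. K powr p * linear_rhs p n k (local_fun x))"
    by (intro avg_mono linear avg_local_fun)
  also have "\<dots> = K powr p * (real k / real n * (\<Sum>j=1..n. avg T (\<lambda>x. avg (cube n) (\<lambda>\<epsilon>. norm (cube_diff j (local_fun x) \<epsilon>) powr p)))
      + (real k / real n) powr (p / 2) * avg T (\<lambda>x. avg (cube n) (\<lambda>\<epsilon>. norm (local_fun x \<epsilon>) powr p)))"
    by (simp only: linear_rhs_def avg_cmult avg_add avg_sum)
  also have "\<dots> \<le> K powr p * (real k / real n * (\<Sum>j=1..n. 4 powr p * tmod f (unit_vec j))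
      + (real k / real n) powr (p / 2) * (4 powr p * diag_avg))"
    by (intro mult_left_mono add_mono sum_mono avg_cube_diff_local_fun avg_norm_local_fun) auto
  also have "\<dots> = K powr p * (4 powr p * bound)"
    by (simp add: bound_def edge_sum_def sum_distrib_left[symmetric] algebra_simps)
  finally show ?thesis by (simp only: powr_mult mult_ac)
qed

text \<open>For fixed signs \<open>\<epsilon>\<close> and \<open>\<delta>\<close> put \<open>x = y + \<delta>\<^sub>S + \<epsilon>\<^sub>S\<close>. Resampling the coordinates outside \<open>S\<close> around the
  points \<open>y + 2 \<epsilon>\<^sub>S + \<delta>\<^sub>S = x + \<epsilon>\<^sub>S\<close> and \<open>y + \<delta>\<^sub>S = x - \<epsilon>\<^sub>S\<close> gives the values of one function, the conditional
  expectation of \<open>local_fun x\<close>, at the opposite points \<open>\<epsilon>\<close> and \<open>-\<epsilon>\<close>. The subtracted mean cancels, and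
  for a uniform \<open>y\<close> the point \<open>x\<close> is uniform as well.\<close>

lemma smooth_step:
  "avg (cube n) (\<lambda>\<epsilon>. tmod smooth (\<lambda>i. 2 * restrict_vec S \<epsilon> i))
    \<le> 4 powr p * avg T (\<lambda>x. avg (cube n) (\<lambda>\<epsilon>. norm (cube_proj n S (local_fun x) \<epsilon>) powr p))"
proof -
  define P where "P x = cube_proj n S (local_fun x)" for x
  define neg where "neg \<epsilon> = (\<lambda>i\<in>{1..n}. - \<epsilon> i)" for \<epsilon> :: "nat \<Rightarrow> int"
  have P_diff: "P x \<epsilon> - P x \<epsilon>' = cube_proj n S (\<lambda>\<eta>. f (shift x \<eta>)) \<epsilon> - cube_proj n S (\<lambda>\<eta>. f (shift x \<eta>)) \<epsilon>'"
    if "\<epsilon> \<in> cube n" "\<epsilon>' \<in> cube n" for x \<epsilon> \<epsilon>'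
    using that fibre_nonempty
    by (simp add: P_def cube_proj_fibre local_fun_def[abs_def] avg_diff avg_const)
  have pt: "smooth (shift y (\<lambda>i. 2 * restrict_vec S \<epsilon> i)) - smooth y
      = avg (cube n) (\<lambda>\<delta>. P (shift y (\<lambda>i. restrict_vec S \<delta> i + restrict_vec S \<epsilon> i)) \<epsilon>
          - P (shift y (\<lambda>i. restrict_vec S \<delta> i + restrict_vec S \<epsilon> i)) (neg \<epsilon>))"
    if \<epsilon>: "\<epsilon> \<in> cube n" for y \<epsilon>
  proof -
    have sm: "smooth z = avg (cube n) (\<lambda>\<delta>. cube_proj n S (\<lambda>\<eta>. f (shift z \<eta>)) \<delta>)" for z
      by (simp add: smooth_def avg_cube_proj)
    have a: "cube_proj n S (\<lambda>\<eta>. f (shift (shift y (\<lambda>i. 2 * restrict_vec S \<epsilon> i)) \<eta>)) \<delta>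
        = cube_proj n S (\<lambda>\<eta>. f (shift (shift y (\<lambda>i. restrict_vec S \<delta> i + restrict_vec S \<epsilon> i)) \<eta>)) \<epsilon>"
      if \<delta>: "\<delta> \<in> cube n" for \<delta>
      unfolding cube_proj_merge[OF \<delta>] cube_proj_merge[OF \<epsilon>] torus_shift_shift
      by (intro avg_cong refl arg_cong[where f = f] torus_shift_cong) (auto simp: merge_def restrict_vec_def)
    have b: "cube_proj n S (\<lambda>\<eta>. f (shift y \<eta>)) \<delta>
        = cube_proj n S (\<lambda>\<eta>. f (shift (shift y (\<lambda>i. restrict_vec S \<delta> i + restrict_vec S \<epsilon> i)) \<eta>)) (neg \<epsilon>)"
      if \<delta>: "\<delta> \<in> cube n" for \<delta>
      unfolding cube_proj_merge[OF \<delta>] cube_proj_merge[OF uminus_cube[OF \<epsilon>], folded neg_def] torus_shift_shift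
      by (intro avg_cong refl arg_cong[where f = f] torus_shift_cong) (auto simp: merge_def restrict_vec_def neg_def)
    show ?thesis
      unfolding sm avg_diff[symmetric] using a b P_diff[OF \<epsilon> uminus_cube[OF \<epsilon>, folded neg_def]]
      by (intro avg_cong refl) simp
  qed
  have "avg (cube n) (\<lambda>\<epsilon>. tmod smooth (\<lambda>i. 2 * restrict_vec S \<epsilon> i))
     \<le> avg (cube n) (\<lambda>\<epsilon>. avg T (\<lambda>x. norm (P x \<epsilon> - P x (neg \<epsilon>)) powr p))"
  proof (rule avg_mono)
    fix \<epsilon> assume \<epsilon>: "\<epsilon> \<in> cube n"
    have "tmod smooth (\<lambda>i. 2 * restrict_vec S \<epsilon> i) \<le> avg T (\<lambda>y. avg (cube n) (\<lambda>\<delta>.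
       norm (P (shift y (\<lambda>i. restrict_vec S \<delta> i + restrict_vec S \<epsilon> i)) \<epsilon>
          - P (shift y (\<lambda>i. restrict_vec S \<delta> i + restrict_vec S \<epsilon> i)) (neg \<epsilon>)) powr p))"
      unfolding translation_mod_def pt[OF \<epsilon>] using p by (intro avg_mono avg_Jensen) auto
    also have "\<dots> = avg (cube n) (\<lambda>\<delta>. avg T (\<lambda>y.
       norm (P (shift y (\<lambda>i. restrict_vec S \<delta> i + restrict_vec S \<epsilon> i)) \<epsilon>
          - P (shift y (\<lambda>i. restrict_vec S \<delta> i + restrict_vec S \<epsilon> i)) (neg \<epsilon>)) powr p))"
      by (rule avg_swap)
    also have "\<dots> = avg (cube n) (\<lambda>\<delta>. avg T (\<lambda>x. norm (P x \<epsilon> - P x (neg \<epsilon>)) powr p))"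
      by (intro avg_cong refl avg_torus_shift[OF m_pos])
    also have "\<dots> = avg T (\<lambda>x. norm (P x \<epsilon> - P x (neg \<epsilon>)) powr p)"
      by (simp add: avg_const)
    finally show "tmod smooth (\<lambda>i. 2 * restrict_vec S \<epsilon> i) \<le> avg T (\<lambda>x. norm (P x \<epsilon> - P x (neg \<epsilon>)) powr p)" .
  qed
  also have "\<dots> = avg T (\<lambda>x. avg (cube n) (\<lambda>\<epsilon>. norm (P x \<epsilon> - P x (neg \<epsilon>)) powr p))"
    by (rule avg_swap)
  also have "\<dots> \<le> avg T (\<lambda>x. 4 powr p * avg (cube n) (\<lambda>\<epsilon>. norm (P x \<epsilon>) powr p))"
  proof (rule avg_mono)
    fix x
    let ?A = "avg (cube n) (\<lambda>\<epsilon>. norm (P x \<epsilon>) powr p)"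
    have "avg (cube n) (\<lambda>\<epsilon>. norm (P x \<epsilon> - P x (neg \<epsilon>)) powr p)
       \<le> avg (cube n) (\<lambda>\<epsilon>. 2 powr p * (norm (P x \<epsilon>) powr p + norm (P x (neg \<epsilon>)) powr p))"
      using p by (intro avg_mono powr_norm_diff_le) auto
    also have "\<dots> = 2 powr p * (2 * ?A)"
      unfolding neg_def
      using avg_reindex[OF bij_uminus_cube, where f = "\<lambda>\<epsilon>. norm (P x \<epsilon>) powr p", symmetric]
      by (simp only: avg_cmult avg_add) simp
    also have "\<dots> \<le> 2 powr p * (2 powr p * ?A)"
      using two_le_powr[of p] p by (intro mult_left_mono mult_right_mono avg_nonneg) auto
    also have "\<dots> = 4 powr p * ?A" by (simp add: mult.assoc[symmetric] flip: powr_mult)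
    finally show "avg (cube n) (\<lambda>\<epsilon>. norm (P x \<epsilon> - P x (neg \<epsilon>)) powr p) \<le> 4 powr p * ?A" .
  qed
  finally show ?thesis by (simp add: avg_cmult P_def)
qed

text \<open>Write \<open>f\<close> as \<open>smooth\<close> plus an error. The error costs \<open>4 powr p\<close> times the diagonal average for every
  translation; the translation of the smooth part by \<open>4 m \<epsilon>\<^sub>S\<close> is split into \<open>2 m\<close> steps.\<close>

lemma torus_lhs_le:
  "torus_lhs n k m (\<lambda>x y. norm (f x - f y) powr p) \<le> (128 * (1 + K) * real m) powr p * bound"
proof -
  have split: "tmod f (\<lambda>i. int (4 * m) * restrict_vec S \<epsilon> i)
      \<le> 2 powr p * (4 powr p * diag_avg + (2 * real m) powr p * tmod smooth (\<lambda>i. 2 * restrict_vec S \<epsilon> i))" for S \<epsilon>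
  proof -
    define w where "w = (\<lambda>i. int (4 * m) * restrict_vec S \<epsilon> i)"
    have "tmod f w = tmod (\<lambda>x. (f x - smooth x) + smooth x) w" by simp
    also have "\<dots> \<le> 2 powr p * (tmod (\<lambda>x. f x - smooth x) w + tmod smooth w)"
      using p by (intro translation_mod_sum m_pos) auto
    also have "\<dots> \<le> 2 powr p * (4 powr p * diag_avg + (2 * real m) powr p * tmod smooth (\<lambda>i. 2 * restrict_vec S \<epsilon> i))"
    proof (intro mult_left_mono add_mono)
      show "tmod (\<lambda>x. f x - smooth x) w \<le> 4 powr p * diag_avg"
        using p smooth_close by (intro order_trans[OF translation_mod_le_norm[OF m_pos]] mult_left_mono) auto
      have "tmod smooth w = tmod smooth (\<lambda>i. int (2 * m) * (2 * restrict_vec S \<epsilon> i))"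
        by (intro translation_mod_cong) (simp add: w_def)
      also have "\<dots> \<le> real (2 * m) powr p * tmod smooth (\<lambda>i. 2 * restrict_vec S \<epsilon> i)"
        using p by (intro translation_mod_multiple m_pos) auto
      finally show "tmod smooth w \<le> (2 * real m) powr p * tmod smooth (\<lambda>i. 2 * restrict_vec S \<epsilon> i)" by simp
    qed simp
    finally show ?thesis unfolding w_def .
  qed
  have "torus_lhs n k m (\<lambda>x y. norm (f x - f y) powr p)
     \<le> avg (ksets n k) (\<lambda>S. avg (cube n) (\<lambda>\<epsilon>. 2 powr p * (4 powr p * diag_avg + (2 * real m) powr p * tmod smooth (\<lambda>i. 2 * restrict_vec S \<epsilon> i))))"
    unfolding torus_lhs_tmod by (intro avg_mono split)
  also have "\<dots> = 2 powr p * (4 powr p * diag_avg + (2 * real m) powr p *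
      avg (ksets n k) (\<lambda>S. avg (cube n) (\<lambda>\<epsilon>. tmod smooth (\<lambda>i. 2 * restrict_vec S \<epsilon> i))))"
    using k ksets_nonempty[of k n] by (simp only: avg_cmult avg_add) (simp add: avg_const)
  also have "\<dots> \<le> 2 powr p * (4 powr p * (real m powr p * bound) + (2 * real m) powr p * (4 powr p * ((4 * K) powr p * bound)))"
  proof (intro mult_left_mono add_mono)
    have "1 * diag_avg \<le> (real m powr p * (real k / real n) powr (p / 2)) * diag_avg"
      by (rule mult_right_mono[OF scale_large diag_avg_nonneg])
    also have "\<dots> \<le> real m powr p * bound"
      using edge_sum_nonneg by (simp add: bound_def mult.assoc mult_left_mono)
    finally show "diag_avg \<le> real m powr p * bound" by simp
    have "avg (ksets n k) (\<lambda>S. avg (cube n) (\<lambda>\<epsilon>. tmod smooth (\<lambda>i. 2 * restrict_vec S \<epsilon> i)))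
      \<le> avg (ksets n k) (\<lambda>S. 4 powr p * avg T (\<lambda>x. avg (cube n) (\<lambda>\<epsilon>. norm (cube_proj n S (local_fun x) \<epsilon>) powr p)))"
      by (intro avg_mono smooth_step)
    also have "\<dots> = 4 powr p * avg T (\<lambda>x. linear_lhs p n k (local_fun x))"
      unfolding linear_lhs_def avg_cmult by (subst avg_swap) (rule refl)
    also have "\<dots> \<le> 4 powr p * ((4 * K) powr p * bound)"
      by (intro mult_left_mono avg_linear_lhs_local_fun) auto
    finally show "avg (ksets n k) (\<lambda>S. avg (cube n) (\<lambda>\<epsilon>. tmod smooth (\<lambda>i. 2 * restrict_vec S \<epsilon> i)))
        \<le> 4 powr p * ((4 * K) powr p * bound)" .
  qed auto
  also have "\<dots> = ((2 * (4 * real m)) powr p + (2 * (2 * real m * (4 * (4 * K)))) powr p) * bound"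
    unfolding powr_mult by (simp add: algebra_simps)
  also have "\<dots> \<le> (2 * (64 * (1 + K) * real m) powr p) * bound"
  proof (rule mult_right_mono[OF _ bound_nonneg])
    have "(2 * (4 * real m)) powr p \<le> (64 * (1 + K) * real m) powr p"
      using p K by (intro powr_mono2) (auto simp: algebra_simps)
    moreover have "(2 * (2 * real m * (4 * (4 * K)))) powr p \<le> (64 * (1 + K) * real m) powr p"
      using p K by (intro powr_mono2) (auto simp: algebra_simps)
    ultimately show "(2 * (4 * real m)) powr p + (2 * (2 * real m * (4 * (4 * K)))) powr p \<le> 2 * (64 * (1 + K) * real m) powr p"
      by linarith
  qed
  also have "\<dots> \<le> (2 powr p * (64 * (1 + K) * real m) powr p) * bound"
    using p two_le_powr[of p] by (intro mult_right_mono bound_nonneg) auto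
  also have "2 powr p * (64 * (1 + K) * real m) powr p = (128 * (1 + K) * real m) powr p"
    unfolding powr_mult[symmetric] by (simp add: mult.assoc[symmetric])
  finally show ?thesis .
qed

end

text \<open>The summand \<open>1\<close> in the constant accounts for the error of smoothing, which does not pass through the
  linear inequality.\<close>

theorem metric_X_ineq_of_linear:
  fixes U :: "'k::{real_normed_field, second_countable_topology} itself"
  assumes p: "p \<ge> 2" and K: "K \<ge> 0" and lin: "linear_X_ineq U p (ennreal K)"
  shows "metric_X_ineq T U p (ennreal (128 * (1 + K)))"
  unfolding metric_X_ineq_scalar_iff[OF p]
proof (intro allI ballI impI)
  fix n k m :: nat and f :: "(nat \<Rightarrow> int) \<Rightarrow> 'k"
  assume k: "k \<in> {1..n}" and m: "sqrt (real n / real k) \<le> real m"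
  interpret torus_reduction p K n k m f
    using p K k m lin[unfolded linear_X_ineq_real_iff[OF p K], rule_format, OF k]
    by unfold_locales
  have "torus_lhs n k m (\<lambda>x y. norm (f x - f y) powr p)
      \<le> (128 * (1 + K) * real m) powr p * torus_rhs p n k m (\<lambda>x y. norm (f x - f y) powr p)"
    using torus_lhs_le torus_rhs_bound by simp
  then show "torus_ineq p (ennreal (128 * (1 + K))) n k m (\<lambda>x y. norm (f x - f y) powr p)"
    using p K by (subst torus_ineq_finite_iff) auto
qed

section \<open>The lower bounds\<close>

definition tent :: "nat \<Rightarrow> int \<Rightarrow> int" where
  "tent m t = min t (int (8 * m) - t)"

text \<open>The tent function is the distance to \<open>0\<close> on the cycle, hence a contraction.\<close>

lemma tent_step:
  assumes "m \<ge> 1" "0 \<le> t" "t < int (8 * m)" "s = 1 \<or> s = -1"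
  shows "\<bar>tent m ((t + s) mod int (8 * m)) - tent m t\<bar> \<le> 1"
proof -
  consider "t + s = int (8 * m)" | "t + s = -1" | "0 \<le> t + s" "t + s < int (8 * m)"
    using assms by linarith
  then show ?thesis
  proof cases
    case 1
    then have "(t + s) mod int (8 * m) = 0" by simp
    then show ?thesis using 1 assms by (auto simp: tent_def min_def)
  next
    case 2
    then have "(t + s) mod int (8 * m) = int (8 * m) - 1"
      using assms by (simp add: zmod_minus1)
    then show ?thesis using 2 assms by (auto simp: tent_def min_def)
  next
    case 3
    then have "(t + s) mod int (8 * m) = t + s" by (rule mod_pos_pos_trivial)
    then show ?thesis using assms by (auto simp: tent_def min_def)
  qed
qed

text \<open>The two signs lead to the same point because \<open>4 m\<close> is half of the period. All increments therefore
  have the same sign, and there is no cancellation in sums over coordinates.\<close>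

lemma tent_antipode:
  assumes "0 \<le> t" "t < int m" "s = 1 \<or> s = -1"
  shows "tent m ((t + int (4 * m) * s) mod int (8 * m)) - tent m t \<ge> 2 * int m"
proof -
  have "(t + int (4 * m) * s) mod int (8 * m) = t + int (4 * m)"
    using assms(3)
  proof
    assume "s = 1"
    then show ?thesis using assms by simp
  next
    assume "s = -1"
    then have "(t + int (4 * m) * s) mod int (8 * m) = (t + int (4 * m) + (- 1) * int (8 * m)) mod int (8 * m)"
      by simp
    also have "\<dots> = (t + int (4 * m)) mod int (8 * m)" by (rule mod_mult_self1)
    also have "\<dots> = t + int (4 * m)" using assms by simp
    finally show ?thesis .
  qed
  then show ?thesis using assms by (simp add: tent_def)
qed

definition tent_sum :: "nat \<Rightarrow> nat \<Rightarrow> (nat \<Rightarrow> int) \<Rightarrow> real" where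
  "tent_sum m r x = real_of_int (\<Sum>j=1..r. tent m (x j))"

context
  fixes p :: real and r n m :: nat
  assumes p: "p \<ge> 2" and r: "r \<ge> 1" and n: "r \<le> n" and m: "m \<ge> 1"
begin

lemma tent_sum_unit_step:
  assumes x: "x \<in> carrier (torus m n)" and j: "j \<in> {1..n}"
  shows "\<bar>tent_sum m r (torus_shift m n x (unit_vec j)) - tent_sum m r x\<bar> \<le> (if j \<le> r then 1 else 0)"
proof -
  have xi: "0 \<le> x i" "x i < int (8 * m)" if "i \<in> {1..r}" for i
    using x that n by (auto simp: torus_carrier[OF m] PiE_iff)
  have c: "torus_shift m n x (unit_vec j) i = (if i = j then (x i + 1) mod int (8 * m) else x i)" if "i \<in> {1..r}" for i
    unfolding torus_shift_eq using xi[OF that] that n by (auto simp: unit_vec_def)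
  have "(\<Sum>i=1..r. tent m (torus_shift m n x (unit_vec j) i)) - (\<Sum>i=1..r. tent m (x i))
     = (\<Sum>i=1..r. if i = j then tent m ((x i + 1) mod int (8 * m)) - tent m (x i) else 0)"
    unfolding sum_subtractf[symmetric] by (intro sum.cong refl) (simp only: c, simp)
  also have "\<dots> = (if j \<in> {1..r} then tent m ((x j + 1) mod int (8 * m)) - tent m (x j) else 0)"
    by simp
  finally have "tent_sum m r (torus_shift m n x (unit_vec j)) - tent_sum m r x
    = real_of_int (if j \<in> {1..r} then tent m ((x j + 1) mod int (8 * m)) - tent m (x j) else 0)"
    unfolding tent_sum_def of_int_diff[symmetric] by (simp only:)
  then have eq: "tent_sum m r (torus_shift m n x (unit_vec j)) - tent_sum m r x
    = real_of_int (if j \<in> {1..r} then tent m ((x j + 1) mod int (8 * m)) - tent m (x j) else 0)" .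
  show ?thesis
  proof (cases "j \<le> r")
    case True
    then have jr: "j \<in> {1..r}" using j by simp
    have "\<bar>tent m ((x j + 1) mod int (8 * m)) - tent m (x j)\<bar> \<le> 1"
      by (rule tent_step[OF m xi[OF jr]]) simp
    then show ?thesis unfolding eq if_P[OF jr] if_P[OF True] by linarith
  next
    case False
    then have "j \<notin> {1..r}" by simp
    then show ?thesis unfolding eq using False by simp
  qed
qed

lemma tent_sum_diagonal_step:
  assumes x: "x \<in> carrier (torus m n)" and \<epsilon>: "\<epsilon> \<in> cube n"
  shows "\<bar>tent_sum m r (torus_shift m n x \<epsilon>) - tent_sum m r x\<bar> \<le> real r"
proof -
  have "\<bar>(\<Sum>i=1..r. tent m (torus_shift m n x \<epsilon> i)) - (\<Sum>i=1..r. tent m (x i))\<bar>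
     \<le> (\<Sum>i=1..r. \<bar>tent m (torus_shift m n x \<epsilon> i) - tent m (x i)\<bar>)"
    unfolding sum_subtractf[symmetric] by (rule sum_abs)
  also have "\<dots> \<le> (\<Sum>i=1..r. 1)"
  proof (rule sum_mono)
    fix i assume i: "i \<in> {1..r}"
    then have in': "i \<in> {1..n}" using n by auto
    have "0 \<le> x i" "x i < int (8 * m)" using x in' by (auto simp: torus_carrier[OF m] PiE_iff)
    moreover have "torus_shift m n x \<epsilon> i = (x i + \<epsilon> i) mod int (8 * m)"
      unfolding torus_shift_eq using in' by simp
    ultimately show "\<bar>tent m (torus_shift m n x \<epsilon> i) - tent m (x i)\<bar> \<le> 1"
      using tent_step[OF m] cube_coord[OF \<epsilon> in'] by metis
  qed
  finally have "\<bar>(\<Sum>i=1..r. tent m (torus_shift m n x \<epsilon> i)) - (\<Sum>i=1..r. tent m (x i))\<bar> \<le> int r" by simp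
  then show ?thesis
    unfolding tent_sum_def of_int_diff[symmetric] of_int_abs[symmetric] by linarith
qed

lemma tent_sum_antipode:
  assumes x: "x \<in> carrier (torus m n)" and \<epsilon>: "\<epsilon> \<in> cube n" and small: "\<forall>j\<in>{1..r}. x j < int m"
  shows "\<bar>tent_sum m r (torus_shift m n x (\<lambda>i. int (4 * m) * restrict_vec {1..r} \<epsilon> i)) - tent_sum m r x\<bar> \<ge> 2 * real m * real r"
proof -
  define y where "y = torus_shift m n x (\<lambda>i. int (4 * m) * restrict_vec {1..r} \<epsilon> i)"
  have "(\<Sum>i=1..r. 2 * int m) \<le> (\<Sum>i=1..r. tent m (y i) - tent m (x i))"
  proof (rule sum_mono)
    fix i assume i: "i \<in> {1..r}"
    then have in': "i \<in> {1..n}" using n by auto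
    have "0 \<le> x i" "x i < int m" using x in' i small by (auto simp: torus_carrier[OF m] PiE_iff)
    moreover have "y i = (x i + int (4 * m) * \<epsilon> i) mod int (8 * m)"
      unfolding y_def torus_shift_eq using in' i by (simp add: restrict_vec_def)
    ultimately show "2 * int m \<le> tent m (y i) - tent m (x i)"
      using tent_antipode cube_coord[OF \<epsilon> in'] by metis
  qed
  then have "2 * int m * int r \<le> (\<Sum>i=1..r. tent m (y i)) - (\<Sum>i=1..r. tent m (x i))"
    by (simp add: sum_subtractf mult.commute)
  then have "real_of_int (2 * int m * int r) \<le> real_of_int ((\<Sum>i=1..r. tent m (y i)) - (\<Sum>i=1..r. tent m (x i)))"
    by (simp only: of_int_le_iff)
  then show ?thesis unfolding y_def[symmetric] tent_sum_def by simp
qed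

lemma torus_corner_fraction:
  "avg (carrier (torus m n)) (\<lambda>x. if \<forall>j\<in>{1..r}. x j < int m then 1 else 0) = (1 / 8 :: real) ^ r"
proof -
  let ?T = "carrier (torus m n)"
  define G where "G = ({1..n} \<rightarrow>\<^sub>E {0..<int (8 * m)}) \<inter> {x. \<forall>j\<in>{1..r}. x j < int m}"
  have "G = (\<Pi>\<^sub>E j\<in>{1..n}. if j \<in> {1..r} then {0..<int m} else {0..<int (8 * m)})"
    (is "_ = ?R")
  proof (intro equalityI subsetI)
    fix x assume "x \<in> G"
    then show "x \<in> ?R" by (auto simp: G_def PiE_iff)
  next
    fix x assume x: "x \<in> ?R"
    have "x j \<in> {0..<int (8 * m)}" if "j \<in> {1..n}" for j
      using PiE_mem[OF x that] by (cases "j \<in> {1..r}") auto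
    moreover have "x j < int m" if "j \<in> {1..r}" for j
      using PiE_mem[OF x, of j] that n by auto
    moreover have "x \<in> extensional {1..n}" using x by (simp add: PiE_iff)
    ultimately show "x \<in> G" unfolding G_def Int_iff PiE_iff mem_Collect_eq by blast
  qed
  then have "card G = (\<Prod>j\<in>{1..n}. card (if j \<in> {1..r} then {0..<int m} else {0..<int (8 * m)}))"
    by (simp add: card_PiE)
  also have "\<dots> = (\<Prod>j\<in>{1..n}. if j \<in> {1..r} then m else 8 * m)"
    by (intro prod.cong) auto
  finally have "8 ^ r * card G = (\<Prod>j\<in>{1..r}. 8) * (\<Prod>j\<in>{1..n}. if j \<in> {1..r} then m else 8 * m)"
    by simp
  also have "(\<Prod>j\<in>{1..r}. 8) = (\<Prod>j\<in>{1..n}. if j \<in> {1..r} then 8 else 1 :: nat)"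
  proof -
    have "{j \<in> {1..n}. j \<in> {1..r}} = {1..r}" using n by auto
    then show ?thesis using prod.inter_filter[of "{1..n}" "\<lambda>_. 8 :: nat" "\<lambda>j. j \<in> {1..r}"] by simp
  qed
  also have "\<dots> * (\<Prod>j\<in>{1..n}. if j \<in> {1..r} then m else 8 * m) = (\<Prod>j\<in>{1..n}. 8 * m)"
    unfolding prod.distrib[symmetric] by (intro prod.cong refl) auto
  also have "\<dots> = card ?T" by (simp add: torus_carrier[OF m] card_PiE nat_mult_distrib power_mult_distrib)
  finally have "real (8 ^ r * card G) = real (card ?T)" by (simp only:)
  then have card: "real (card ?T) = 8 ^ r * real (card G)" by simp
  have "card ?T > 0" using finite_torus[OF m] torus_nonempty[OF m] by (simp add: card_gt_0_iff)
  then have "real (card G) > 0" using card by (metis of_nat_0_less_iff mult_zero_right not_gr_zero of_nat_0)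
  moreover have "(\<Sum>x\<in>?T. if \<forall>j\<in>{1..r}. x j < int m then 1 else 0) = real (card G)"
    using finite_torus[OF m, of n] by (simp add: G_def torus_carrier[OF m] sum.If_cases)
  ultimately show ?thesis
    unfolding avg_def card by (simp add: power_one_over inverse_eq_divide)
qed

text \<open>Only the set \<open>{1..r}\<close> and the corner of the torus of measure \<open>(1 / 8) ^ r\<close> are kept on the left side.\<close>

lemma torus_lhs_tent:
  "(1 / 8) ^ r * (2 * real m * real r) powr p / real (n choose r)
    \<le> torus_lhs n r m (\<lambda>x y. norm (tent_sum m r x - tent_sum m r y) powr p)"
proof -
  let ?T = "carrier (torus m n)"
  let ?D = "\<lambda>x y. norm (tent_sum m r x - tent_sum m r y) powr p"
  define F where "F S = avg (?T \<times> cube n) (\<lambda>(x, \<epsilon>). ?D (torus_shift m n x (\<lambda>i. int (4 * m) * restrict_vec S \<epsilon> i)) x)" for S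
  have F: "F S \<ge> 0" for S unfolding F_def by (intro avg_nonneg) auto
  have "(1 / 8) ^ r * (2 * real m * real r) powr p
      = avg ?T (\<lambda>x. (2 * real m * real r) powr p * (if \<forall>j\<in>{1..r}. x j < int m then 1 else 0))"
    by (simp only: avg_cmult torus_corner_fraction mult.commute)
  also have "\<dots> \<le> F {1..r}"
    unfolding F_def avg_Times
  proof (rule avg_mono)
    fix x assume x: "x \<in> ?T"
    let ?R = "avg (cube n) (\<lambda>\<epsilon>. ?D (torus_shift m n x (\<lambda>i. int (4 * m) * restrict_vec {1..r} \<epsilon> i)) x)"
    show "(2 * real m * real r) powr p * (if \<forall>j\<in>{1..r}. x j < int m then 1 else 0) \<le> ?R"
    proof (cases "\<forall>j\<in>{1..r}. x j < int m")
      case True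
      have "avg (cube n) (\<lambda>_. (2 * real m * real r) powr p) \<le> ?R"
        using p tent_sum_antipode[OF x _ True] by (intro avg_mono powr_mono2) auto
      then show ?thesis using True by (simp add: avg_const)
    next
      case False
      have "?R \<ge> 0" by (intro avg_nonneg) auto
      then show ?thesis using False by (simp only: if_False mult_zero_right)
    qed
  qed
  also have "F {1..r} \<le> (\<Sum>S | S \<subseteq> {1..n} \<and> card S = r. F S)"
    using n F by (intro member_le_sum) auto
  finally show ?thesis
    unfolding torus_lhs_def F_def by (rule divide_right_mono) simp
qed

text \<open>With \<open>n = r\<^sup>3\<close> the ratio \<open>k / n\<close> is \<open>1 / r\<^sup>2\<close>. It balances the diagonal term, in which the trivial
  bound \<open>r\<close> for the increment is used, while the \<open>r\<close> nonzero edge terms contribute only \<open>1 / r\<close>.\<close>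

lemma torus_rhs_tent:
  assumes cube: "n = r ^ 3"
  shows "torus_rhs p n r m (\<lambda>x y. norm (tent_sum m r x - tent_sum m r y) powr p) \<le> 2"
proof -
  let ?T = "carrier (torus m n)"
  let ?f = "tent_sum m r"
  have T: "finite ?T" "?T \<noteq> {}" using finite_torus[OF m] torus_nonempty[OF m] by auto
  have "(\<Sum>j=1..n. avg ?T (\<lambda>x. norm (?f (torus_shift m n x (unit_vec j)) - ?f x) powr p))
     \<le> (\<Sum>j=1..n. avg ?T (\<lambda>x. if j \<le> r then 1 else 0))"
  proof (intro sum_mono avg_mono)
    fix j x assume "j \<in> {1..n}" "x \<in> ?T"
    then have "norm (?f (torus_shift m n x (unit_vec j)) - ?f x) powr p \<le> (if j \<le> r then 1 else 0) powr p"
      using p tent_sum_unit_step[of x j] by (intro powr_mono2) auto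
    then show "norm (?f (torus_shift m n x (unit_vec j)) - ?f x) powr p \<le> (if j \<le> r then 1 else 0)"
      by (simp split: if_splits)
  qed
  also have "\<dots> = (\<Sum>j=1..n. if j \<le> r then 1 else 0)" using T by (simp add: avg_const)
  also have "\<dots> = real r"
  proof -
    have "{1..n} \<inter> {j. j \<le> r} = {1..r}" using n by auto
    then show ?thesis by (simp add: sum.If_cases)
  qed
  finally have edges: "(\<Sum>j=1..n. avg ?T (\<lambda>x. norm (?f (torus_shift m n x (unit_vec j)) - ?f x) powr p)) \<le> real r" .
  have "avg (?T \<times> cube n) (\<lambda>(x, \<epsilon>). norm (?f (torus_shift m n x \<epsilon>) - ?f x) powr p)
      \<le> avg (?T \<times> cube n) (\<lambda>_. real r powr p)"
    using p tent_sum_diagonal_step by (intro avg_mono) (auto intro!: powr_mono2)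
  also have "\<dots> = real r powr p" using T by (simp add: avg_const)
  finally have diag: "avg (?T \<times> cube n) (\<lambda>(x, \<epsilon>). norm (?f (torus_shift m n x \<epsilon>) - ?f x) powr p) \<le> real r powr p" .
  have q: "real r / real n = 1 / (real r)\<^sup>2"
    using r by (simp add: cube power3_eq_cube power2_eq_square)
  have "torus_rhs p n r m (\<lambda>x y. norm (?f x - ?f y) powr p)
     \<le> real r / real n * real r + (real r / real n) powr (p / 2) * real r powr p"
    unfolding torus_rhs_def by (intro add_mono mult_left_mono edges diag) auto
  also have "real r / real n * real r = 1 / real r"
    using r by (simp add: q power2_eq_square)
  also have "(real r / real n) powr (p / 2) = 1 / real r powr p"
    using powr_powr[of "real r" 2 "p / 2"] r by (simp add: q powr_divide powr_numeral)
  also have "1 / real r + 1 / real r powr p * real r powr p \<le> 2"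
    using r by simp
  finally show ?thesis .
qed

end

text \<open>The choice \<open>r \<approx> p / ln p\<close> has the largest order for which \<open>r ^ r\<close> is only exponential in \<open>p\<close>, and such
  factors disappear in the \<open>p\<close>-th root.\<close>

lemma floor_div_ln_bounds:
  fixes p :: real
  assumes p: "p \<ge> 2"
  defines "r \<equiv> nat \<lfloor>p / ln p\<rfloor>"
  shows "r \<ge> 1" "real r \<ge> p / ln p / 2" "8 ^ r * real r ^ (3 * r) \<le> exp (9 * p)"
proof -
  have l: "ln p > 0" using p by simp
  note ge1 = div_ln_ge_one[OF p]
  then show r1: "r \<ge> 1" by (simp add: r_def le_nat_iff)
  have fl: "real r = of_int \<lfloor>p / ln p\<rfloor>" using ge1 by (simp add: r_def)
  show "real r \<ge> p / ln p / 2"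
  proof -
    have "real r > p / ln p - 1" unfolding fl by linarith
    then have "p / ln p \<le> 2 * real r" using r1 by linarith
    then show ?thesis by simp
  qed
  have rle: "real r \<le> p / ln p" unfolding fl by simp
  have "1 \<le> p * ln p"
  proof -
    have "1 / 2 \<le> ln (2 :: real)" using ln2_ge_two_thirds by simp
    also have "ln 2 \<le> ln p" using p by simp
    finally have "2 * (1 / 2) \<le> p * ln p" using p by (intro mult_mono) auto
    then show ?thesis by simp
  qed
  then have "p / ln p \<le> p\<^sup>2" using l p by (simp add: field_simps power2_eq_square)
  then have "real r ^ (3 * r) \<le> (p\<^sup>2) ^ (3 * r)" using rle by (intro power_mono) auto
  moreover have "(8 :: real) ^ r \<le> (p ^ 3) ^ r"
    using power_mono[of 2 p 3] p by (intro power_mono) auto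
  ultimately have "8 ^ r * real r ^ (3 * r) \<le> (p ^ 3) ^ r * (p\<^sup>2) ^ (3 * r)"
    using p by (intro mult_mono) auto
  also have "\<dots> = p ^ (9 * r)" by (simp flip: power_mult power_add)
  also have "\<dots> = exp (9 * (real r * ln p))"
    using p by (simp flip: powr_realpow add: powr_def)
  also have "\<dots> \<le> exp (9 * p)" using rle l by (simp add: field_simps)
  finally show "8 ^ r * real r ^ (3 * r) \<le> exp (9 * p)" .
qed

theorem metric_X_ineq_lower:
  assumes p: "p \<ge> 2" and K: "metric_X_ineq T TYPE(real) p K"
  shows "ennreal (exp (- 9) / 2 * (p / ln p)) \<le> K"
proof (cases K)
  case (real q)
  define r where "r = nat \<lfloor>p / ln p\<rfloor>"
  note b = floor_div_ln_bounds[OF p, folded r_def]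
  define n where "n = r ^ 3"
  have n: "r \<le> n" "n > 0" using b(1) by (auto simp: n_def power3_eq_cube)
  let ?D = "\<lambda>x y. norm (tent_sum r r x - tent_sum r r y) powr p"
  have "sqrt (real n / real r) = real r"
    using b(1) by (simp add: n_def power3_eq_cube)
  then have "torus_ineq p K n r r ?D"
    using K[unfolded metric_X_ineq_scalar_iff[OF p], rule_format, of r n r "tent_sum r r"] b(1) n by simp
  then have "torus_lhs n r r ?D \<le> (q * real r) powr p * torus_rhs p n r r ?D"
    using real torus_ineq_finite_iff[OF p, of q ?D n r r] by simp
  also have "\<dots> \<le> (q * real r) powr p * 2"
    by (intro mult_left_mono torus_rhs_tent) (use p b(1) n in \<open>auto simp: n_def\<close>)
  finally have "(1 / 8) ^ r * (2 * real r * real r) powr p / real (n choose r) \<le> (q * real r) powr p * 2"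
    using torus_lhs_tent[OF p b(1) n(1) b(1)] by linarith
  then have "(2 * real r * real r) powr p \<le> (q * real r) powr p * 2 * (8 ^ r * real (n choose r))"
    using n by (simp add: field_simps power_one_over zero_less_binomial)
  also have "real (n choose r) \<le> real r ^ (3 * r)"
    using binomial_le_pow[of r n] n unfolding of_nat_power[symmetric] of_nat_le_iff by (simp add: n_def power_mult)
  then have "(q * real r) powr p * 2 * (8 ^ r * real (n choose r))
      \<le> (q * real r) powr p * 2 powr p * exp (9 * p)"
    using two_le_powr[of p] p b(3)
    by (intro mult_mono order_trans[OF mult_left_mono b(3)]) auto
  also have "exp (9 * p) = exp 9 powr p" by (simp add: powr_def mult.commute)
  also have "(q * real r) powr p * 2 powr p * exp 9 powr p = (2 * real r * (exp 9 * q)) powr p"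
    unfolding powr_mult[symmetric] by (simp add: mult_ac)
  finally have "2 * real r * real r \<le> 2 * real r * (exp 9 * q)"
    using p real by (subst (asm) powr_base_le_iff) auto
  then have "real r \<le> exp 9 * q" using b(1) by simp
  then have "p / ln p / 2 \<le> exp 9 * q" using b(2) by linarith
  then have "exp (- 9) * (p / ln p / 2) \<le> exp (- 9) * (exp 9 * q)"
    by (intro mult_left_mono) auto
  also have "\<dots> = q" by (simp add: mult.assoc[symmetric] flip: exp_add)
  finally have "exp (- 9) / 2 * (p / ln p) \<le> q" by simp
  then show ?thesis using real by (simp add: ennreal_leI)
qed simp

text \<open>The case \<open>n = k = 1\<close> with \<open>h(\<epsilon>) = \<epsilon>\<close>. This bound lets the summand \<open>1\<close> in \<open>metric_X_ineq_of_linear\<close> be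
  absorbed into the linear constant.\<close>

lemma linear_X_ineq_ge_third:
  assumes p: "p \<ge> 2" and K: "K \<ge> 0" and lin: "linear_X_ineq TYPE(real) p (ennreal K)"
  shows "1 / 3 \<le> K"
proof -
  define h :: "(nat \<Rightarrow> int) \<Rightarrow> real" where "h \<epsilon> = \<epsilon> 1" for \<epsilon>
  have abs1: "\<bar>h \<epsilon>\<bar> = 1" if "\<epsilon> \<in> cube 1" for \<epsilon>
    using cube_coord[OF that, of 1] by (auto simp: h_def)
  have "cube_proj 1 {} h undefined = 0"
    by (rule cube_proj_coord_zero[of 1]) (simp_all add: h_def)
  then have mean: "avg (cube 1) h = 0" by (simp add: cube_proj_empty)
  have "linear_lhs p 1 1 h = avg (ksets 1 1) (\<lambda>S. avg (cube 1) (\<lambda>\<epsilon>. 1))"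
    unfolding linear_lhs_def
  proof (intro avg_cong refl)
    fix S \<epsilon> assume S: "S \<in> ksets 1 1" and \<epsilon>: "\<epsilon> \<in> cube 1"
    have "S = {1}" using S by (auto simp: ksets_def card_1_singleton_iff)
    then have "cube_proj 1 S h \<epsilon> = h \<epsilon>"
      unfolding cube_proj_merge[OF \<epsilon>] h_def by (simp add: merge_def avg_const)
    then show "norm (cube_proj 1 S h \<epsilon>) powr p = 1" using abs1[OF \<epsilon>] by simp
  qed
  also have "\<dots> = 1" using ksets_nonempty[of 1 1] by (simp add: avg_const)
  finally have L: "linear_lhs p 1 1 h = 1" .
  have "avg (cube 1) (\<lambda>\<epsilon>. norm (cube_diff 1 h \<epsilon>) powr p) = avg (cube 1) (\<lambda>\<epsilon>. 2 powr p)"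
  proof (rule avg_cong[OF refl])
    fix \<epsilon> assume "\<epsilon> \<in> cube 1"
    moreover have "cube_diff 1 h \<epsilon> = 2 * h \<epsilon>" by (simp add: cube_diff_def h_def)
    ultimately show "norm (cube_diff 1 h \<epsilon>) powr p = 2 powr p" using abs1 by (simp add: abs_mult)
  qed
  moreover have "avg (cube 1) (\<lambda>\<epsilon>. norm (h \<epsilon>) powr p) = avg (cube 1) (\<lambda>\<epsilon>. 1)"
    using abs1 by (intro avg_cong) auto
  ultimately have R: "linear_rhs p 1 1 h = 2 powr p + 1"
    by (simp add: linear_rhs_def avg_const)
  have "1 \<le> K powr p * (2 powr p + 1)"
    using lin[unfolded linear_X_ineq_real_iff[OF p K], rule_format, of 1 1 h] mean L R by simp
  also have "2 powr p + 1 \<le> 3 powr p"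
  proof -
    have "2 powr p + p * 1 * 2 powr (p - 1) \<le> (2 + 1) powr p"
      using p by (intro powr_bernoulli) auto
    moreover have "1 * 1 \<le> p * 2 powr (p - 1)"
      using p by (intro mult_mono ge_one_powr_ge_zero) auto
    ultimately show ?thesis by simp
  qed
  then have "K powr p * (2 powr p + 1) \<le> K powr p * 3 powr p" by (intro mult_left_mono) auto
  also have "\<dots> = (K * 3) powr p" by (simp only: powr_mult)
  finally have "1 powr p \<le> (K * 3) powr p" by simp
  then have "1 \<le> K * 3" using p K by (subst (asm) powr_base_le_iff) auto
  then show ?thesis by simp
qed

theorem theorem1p4:
  shows "\<exists>c C :: real. 0 < c \<and> c \<le> C \<and>
    (\<forall>p::real. p \<ge> 2 \<longrightarrow>
       ennreal (c * (p / ln p)) \<le> linear_X_const p \<and>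
       linear_X_const p \<le> ennreal (C * (p / ln p)) \<and>
       ennreal (c * (p / ln p)) \<le> metric_X_const TYPE('a) p \<and>
       metric_X_const TYPE('a) p \<le> ennreal (C * (p / ln p)))"
proof -
  \<comment> \<open>\<open>1024 = 2 * 512\<close> with \<open>128 (1 + x) \<le> 512 x\<close> for \<open>x \<ge> 1 / 3\<close>, and \<open>6272 = 128 (1 + 48)\<close>.\<close>
  define c :: real where "c = exp (- 9) / 1024"
  define C :: real where "C = 6272"
  have "ennreal (c * (p / ln p)) \<le> linear_X_const p \<and>
       linear_X_const p \<le> ennreal (C * (p / ln p)) \<and>
       ennreal (c * (p / ln p)) \<le> metric_X_const TYPE('a) p \<and>
       metric_X_const TYPE('a) p \<le> ennreal (C * (p / ln p))" if p: "p \<ge> 2" for p :: real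
  proof -
    define P where "P = p / ln p"
    have P: "P \<ge> 1" unfolding P_def by (rule div_ln_ge_one[OF p])
    note upper = linear_X_ineq_upper[OF p, folded P_def]
    note least = linear_X_const_least[OF upper]
    \<comment> \<open>The linear constant is finite and itself admissible, so it may be fed into the reduction.\<close>
    obtain x where x: "linear_X_const p = ennreal x" "x \<ge> 0"
      using least(3) by (cases "linear_X_const p") (auto simp: top_unique)
    have x48: "x \<le> 48 * P" using least(3) x P by simp
    note lin = least(1,2)[unfolded x(1)]
    have third: "1 / 3 \<le> x" by (rule linear_X_ineq_ge_third[OF p x(2) lin(1)])
    have met: "metric_X_ineq TYPE('a) TYPE(real) p (ennreal (128 * (1 + x)))"
      "metric_X_ineq TYPE('a) TYPE(complex) p (ennreal (128 * (1 + x)))"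
      by (rule metric_X_ineq_of_linear[OF p x(2) lin(1)], rule metric_X_ineq_of_linear[OF p x(2) lin(2)])
    have lower: "ennreal (exp (- 9) / 2 * P) \<le> metric_X_const TYPE('a) p"
      unfolding P_def by (rule metric_X_ineq_lower[OF p metric_X_const_least(1)[OF met]])
    have le: "metric_X_const TYPE('a) p \<le> ennreal (128 * (1 + x))"
      by (rule metric_X_const_least(3)[OF met])
    have "exp (- 9) / 2 * P \<le> 128 * (1 + x)"
      by (rule iffD1[OF ennreal_le_iff order_trans[OF lower le]]) (use x(2) in simp)
    also have "\<dots> \<le> 512 * x" using third by simp
    finally have "c * P \<le> x" by (simp add: c_def)
    moreover have "c * P \<le> exp (- 9) / 2 * P"
      using P by (intro mult_right_mono) (auto simp: c_def)
    moreover have "128 * (1 + x) \<le> C * P" "x \<le> C * P" using x48 P by (auto simp: C_def)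
    ultimately show ?thesis
      unfolding P_def[symmetric] x(1)
      using order_trans[OF ennreal_leI lower] order_trans[OF le ennreal_leI] by (auto intro: ennreal_leI)
  qed
  moreover have "0 < c" "c \<le> C"
    using exp_le_one_iff[of "- 9"] by (auto simp: c_def C_def) (smt (verit) exp_le_one_iff)
  ultimately show ?thesis by blast
qed

end
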